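(* Fix $\lambda>0$ (not depending on $d$) and let $I$ be chosen from $\mathcal{I}(Q_d)$ according to ${\rm hc}(\lambda)$. Let $I_{\rm min}$ be the smaller of $I\cap\mathcal{E}$ and $I\cap\mathcal{O}$. 1. If $\lambda>1$ then a.a.s. $I_{\rm min}=\emptyset$. 2. If $\lambda=1$ then a.a.s. all $2$-components of $I_{\rm min}$ have size $1$, and the number $k$ of $2$-components of $I_{\rm min}$ is asymptotically Poisson with parameter $1/2$; that is, for each integer $j\ge 0$, $\Pr(k=j)\to e^{-1/2}\frac{(1/2)^j}{j!}$ as $d\to\infty$. 3. If $1>\lambda>\sqrt2-1$ then, for every $\varepsilon>0$, a.a.s. $I_{\rm min}$ consists of $k$ $2$-components, each of size $1$, where $k$ satisfies $$\left|k-\frac{\lambda}{2}\left(\frac{2}{1+\lambda}\right)^d\right|\le\sqrt{(2+\varepsilon)\frac{\lambda}{2}\left(\frac{2}{1+\lambda}\right)^d\log\left(\frac{\lambda}{2}\left(\frac{2}{1+\lambda}\right)^d\right)}.$$ 4. If $2^{1/m}-1\ge\lambda>2^{1/(m+1)}-1$ for some integer $m\ge2$, then a.a.s. $I_{\rm min}$ consists of $k$ $2$-components, each of size at most $m$, where $k$ satisfies $$\frac{1}{4\log m}\,\frac{\lambda}{2}\left(\frac{2}{1+\lambda}\right)^d\le k\le e\,m\,\frac{\lambda}{2}\left(\frac{2}{1+\lambda}\right)^d.$$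
   Context: $Q_d$ is the discrete hypercube: the graph on vertex set $\{0,1\}^d$ in which two strings are adjacent iff they differ in exactly one coordinate. It is bipartite with classes $\mathcal{E}$ (strings with an even number of $1$'s) and $\mathcal{O}$ (strings with an odd number of $1$'s). $\mathcal{I}(Q_d)$ is the set of independent sets of $Q_d$ (including the empty set). For $\lambda>0$, the hard-core distribution ${\rm hc}(\lambda)$ on $\mathcal{I}(Q_d)$ chooses each $I$ with probability proportional to $\lambda^{|I|}$. An event holds asymptotically almost surely (a.a.s.) if its probability tends to $1$ as $d\to\infty$. Logarithms are to base $e$. If $|I\cap\mathcal{E}|=|I\cap\mathcal{O}|$, an arbitrary choice is made for $I_{\rm min}$ between $I\cap\mathcal{E}$ and $I\cap\mathcal{O}$. For a set $A$ of vertices, $N(A)$ is the set of vertices outside $A$ with a neighbour in $A$. A set $A\subseteq\mathcal{E}$ (or $A\subseteq\mathcal{O}$) is $2$-linked if $A\cup N(A)$ induces a connected subgraph of $Q_d$. The $2$-components of $A$ are its maximal $2$-linked (nonempty) subsets; they partition $A$. *)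

theory Defs
  imports "HOL-Probability.Probability" "Graph_Theory.Graph_Theory"
begin

text \<open>
  An undirected graph is a \<^typ>\<open>'a pair_pre_digraph\<close> whose arc set contains both
  orientations of each edge; see \<open>pair_graph_hypercube\<close> below.
\<close>

definition hypercube :: "nat \<Rightarrow> bool list pair_pre_digraph" where
  "hypercube d = \<lparr> pverts = {x. length x = d},
     parcs = {(x, y). length x = d \<and> length y = d \<and> card {i. i < d \<and> x ! i \<noteq> y ! i} = 1} \<rparr>"

definition even_verts :: "nat \<Rightarrow> bool list set" where
  "even_verts d = {x \<in> pverts (hypercube d). even (count_list x True)}"

definition odd_verts :: "nat \<Rightarrow> bool list set" where
  "odd_verts d = {x \<in> pverts (hypercube d). odd (count_list x True)}"

definition independent_sets :: "'a pair_pre_digraph \<Rightarrow> 'a set set" where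
  "independent_sets G = {I. I \<subseteq> pverts G \<and> (\<forall>x\<in>I. \<forall>y\<in>I. (x, y) \<notin> parcs G)}"

definition neighbourhood :: "'a pair_pre_digraph \<Rightarrow> 'a set \<Rightarrow> 'a set" where
  "neighbourhood G A = {y \<in> pverts G. y \<notin> A \<and> (\<exists>x\<in>A. (x, y) \<in> parcs G)}"

text \<open>
  The function given to \<^const>\<open>embed_pmf\<close> is a probability mass function if \<open>G\<close> is finite and
  \<open>lam > 0\<close>; see \<open>pmf_hard_core\<close> below.
\<close>

definition hard_core :: "'a pair_pre_digraph \<Rightarrow> real \<Rightarrow> 'a set pmf" where
  "hard_core G lam = embed_pmf (\<lambda>I. if I \<in> independent_sets G
     then lam ^ card I / (\<Sum>J\<in>independent_sets G. lam ^ card J) else 0)"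

text \<open>
  A relation rather than a function: if the two parts of \<open>I\<close> have the same size, either of them
  qualifies.
\<close>

definition is_smaller_part :: "nat \<Rightarrow> bool list set \<Rightarrow> bool list set \<Rightarrow> bool" where
  "is_smaller_part d I M \<longleftrightarrow>
     (M = I \<inter> even_verts d \<and> card (I \<inter> even_verts d) \<le> card (I \<inter> odd_verts d)) \<or>
     (M = I \<inter> odd_verts d \<and> card (I \<inter> odd_verts d) \<le> card (I \<inter> even_verts d))"

text \<open>
  The name \<open>connected\<close> is qualified because of the topological notion. A graph without vertices
  does not count as connected, so the empty set is not 2-linked.
\<close>

definition two_linked :: "nat \<Rightarrow> bool list set \<Rightarrow> bool" where
  "two_linked d A \<longleftrightarrow> (A \<subseteq> even_verts d \<or> A \<subseteq> odd_verts d) \<and>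
     Digraph_Component.connected
       (induce_subgraph (with_proj (hypercube d)) (A \<union> neighbourhood (hypercube d) A))"

definition two_components :: "nat \<Rightarrow> bool list set \<Rightarrow> bool list set set" where
  "two_components d A = {C. C \<subseteq> A \<and> C \<noteq> {} \<and> two_linked d C \<and>
     (\<forall>C'. C \<subseteq> C' \<and> C' \<subseteq> A \<and> two_linked d C' \<longrightarrow> C' = C)}"

definition aas :: "(nat \<Rightarrow> 'a pmf) \<Rightarrow> (nat \<Rightarrow> 'a \<Rightarrow> bool) \<Rightarrow> bool" where
  "aas p P \<longleftrightarrow> (\<lambda>d. measure_pmf.prob (p d) {x. P d x}) \<longlonglongrightarrow> 1"

lemma finite_pverts_hypercube: "finite (pverts (hypercube d))"
  using finite_lists_length_eq[of "UNIV :: bool set" d] by (simp add: hypercube_def)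

lemma pair_graph_hypercube: "pair_graph (hypercube d)"
proof
  have "parcs (hypercube d) \<subseteq> pverts (hypercube d) \<times> pverts (hypercube d)"
    by (auto simp: hypercube_def)
  then show "finite (parcs (hypercube d))"
    using finite_pverts_hypercube finite_subset by blast
  show "symmetric (with_proj (hypercube d))"
    unfolding symmetric_def with_proj_simps
  proof (rule symI)
    fix x y :: "bool list"
    have "{i. i < d \<and> x ! i \<noteq> y ! i} = {i. i < d \<and> y ! i \<noteq> x ! i}" by blast
    then show "(x, y) \<in> parcs (hypercube d) \<Longrightarrow> (y, x) \<in> parcs (hypercube d)"
      unfolding hypercube_def by (simp only: pair_pre_digraph.simps mem_Collect_eq case_prod_conv)
  qed
qed (auto simp: finite_pverts_hypercube, auto simp: hypercube_def)

lemma finite_independent_sets: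
  assumes "finite (pverts G)"
  shows "finite (independent_sets G)"
  by (rule finite_subset[of _ "Pow (pverts G)"]) (auto simp: independent_sets_def assms)

lemma pmf_hard_core:
  assumes "finite (pverts G)" "lam > 0"
  shows "pmf (hard_core G lam) I = (if I \<in> independent_sets G
     then lam ^ card I / (\<Sum>J\<in>independent_sets G. lam ^ card J) else 0)"
proof -
  let ?S = "independent_sets G"
  let ?Z = "\<Sum>J\<in>?S. lam ^ card J"
  let ?f = "\<lambda>I. if I \<in> ?S then lam ^ card I / ?Z else 0"
  have fin: "finite ?S" using assms(1) by (rule finite_independent_sets)
  have ne: "{} \<in> ?S" by (simp add: independent_sets_def)
  have Z: "?Z > 0" using fin ne assms(2) by (intro sum_pos) auto
  have nonneg: "0 \<le> ?f I" for I
    using Z assms(2) by (auto intro: divide_nonneg_pos)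
  have "(\<integral>\<^sup>+ I. ennreal (?f I) \<partial>count_space UNIV) = (\<Sum>I\<in>?S. ennreal (?f I))"
    using fin by (subst nn_integral_count_space'[of ?S]) auto
  also have "\<dots> = ennreal (\<Sum>I\<in>?S. ?f I)"
    by (rule sum_ennreal[OF nonneg])
  also have "(\<Sum>I\<in>?S. ?f I) = 1"
    using Z by (simp flip: sum_divide_distrib)
  finally have one: "(\<integral>\<^sup>+ I. ennreal (?f I) \<partial>count_space UNIV) = 1" by simp
  show ?thesis
    unfolding hard_core_def by (rule pmf_embed_pmf[where f = ?f, OF nonneg one])
qed

end

theory Submission
  imports Defs "HOL-Real_Asymp.Real_Asymp"
begin

text \<open>
  The weight of the independent sets with even part \<open>A\<close> is proportional to
  \<open>lam ^ |A| / (1 + lam) ^ |N(A)|\<close>, which is multiplicative over the 2-components of \<open>A\<close>. Deleting a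
  2-component \<open>C\<close> shows that it occurs with probability at most \<open>lam ^ |C| / (1 + lam) ^ |N(C)|\<close>.
  The closures of the even and the odd part are not joined by an edge, so one of them fills at most
  half of its side. On that side a union bound excludes all 2-components of size greater than \<open>m\<close>
  if \<open>(1 + lam) ^ (m + 1) > 2\<close>: for sets of size up to a small multiple of \<open>d\<close> it suffices to count
  2-linked sets, because \<open>|N(C)| \<ge> d |C| - |C|\<^sup>2\<close>; larger sets are covered by Sapozhenko's containers,
  which save enough because of the isoperimetric inequality \<open>|N(A)| \<ge> (1 + 1 / (2 \<surd>d)) |A|\<close>.
  A first moment bound shows that the side found in this way is the smaller one.

  Adding a singleton 2-component is the reverse of deleting it. Therefore the number \<open>k\<close> of
  singletons nearly satisfies \<open>E (\<phi>(k) k) = \<mu> E \<phi>(k + 1)\<close> with \<open>\<mu> = lam / 2 (2 / (1 + lam)) ^ d\<close>. This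
  gives the Poisson limit for \<open>lam = 1\<close> and, through the variance, the concentration of \<open>k\<close> for
  \<open>lam < 1\<close>, where the 2-components of size at least 2 are too few to matter.
\<close>

section \<open>Connected sets of a relation\<close>

text \<open>For large components everything depends on the excess t = |N(C)| - |cl C|. A container
  is described by about 3 g / \<psi> listed vertices with g = |N(C)|, each costing O(log d), while
  it saves a factor exponential in \<gamma> t; isoperimetry only gives t \<ge> g / (4 sqrt d). With
  \<psi> = \<gamma> d / 8 the cost stays below the saving if \<gamma>^2 sqrt d is large against log
  d. The second kind of container also lists up to \<gamma> t further vertices, so \<gamma> log d
  must be small. This leaves room for \<gamma> = d^(-1/8), and the saving, exponential in d^(11/8),
  absorbs all factors that are exponential in d.

  No asymptotics of the partition function are needed. The probability that a given side is good
  (all its components are small) is unknown and remains as a factor in every identity. It drops out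
  of the second-order terms of the variance, and for the Poisson limit only its sum over both sides
  enters, which tends to 1. The estimates are therefore expectations restricted to the good event of
  a fixed side, never conditioned on the random choice of the smaller part.\<close>

text \<open>Nonemptiness follows the convention that a graph without vertices is not connected, so
  that the empty set is never a component.\<close>

definition conn :: "('a \<times> 'a) set \<Rightarrow> 'a set \<Rightarrow> bool" where
  "conn r S \<longleftrightarrow> S \<noteq> {} \<and> (\<forall>x\<in>S. \<forall>y\<in>S. (x, y) \<in> (Restr r S)\<^sup>*)"

text \<open>A chain that starts inside \<open>T\<close> and ends outside has to cross the boundary
  of \<open>T\<close>. With the converse \<open>connI_cut\<close>, connectedness becomes a statement
  about cuts, which is the form used below.\<close>

lemma conn_cut:
  assumes "conn r S" "T \<subseteq> S" "T \<noteq> {}" "T \<noteq> S"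
  obtains x y where "x \<in> T" "y \<in> S - T" "(x, y) \<in> r"
proof -
  obtain a b where ab: "a \<in> T" "b \<in> S - T" using assms by blast
  then have "(a, b) \<in> (Restr r S)\<^sup>*" using assms unfolding conn_def by blast
  then have "b \<in> T \<or> (\<exists>x\<in>T. \<exists>y\<in>S - T. (x, y) \<in> r)"
    by induction (use ab in blast)+
  then show ?thesis using ab that by blast
qed

lemma connI_cut:
  assumes "S \<noteq> {}"
    and "\<And>T. T \<subseteq> S \<Longrightarrow> T \<noteq> {} \<Longrightarrow> T \<noteq> S \<Longrightarrow> \<exists>x\<in>T. \<exists>y\<in>S - T. (x, y) \<in> r"
  shows "conn r S"
proof -
  have "(x, y) \<in> (Restr r S)\<^sup>*" if "x \<in> S" "y \<in> S" for x y
  proof (rule ccontr)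
    assume n: "(x, y) \<notin> (Restr r S)\<^sup>*"
    define T where "T = {z \<in> S. (x, z) \<in> (Restr r S)\<^sup>*}"
    have "T \<subseteq> S" "T \<noteq> {}" "T \<noteq> S" using that n by (auto simp: T_def)
    then obtain u v where uv: "u \<in> T" "v \<in> S - T" "(u, v) \<in> r" using assms(2) by meson
    then have "(u, v) \<in> Restr r S" by (auto simp: T_def)
    with uv(1) have "(x, v) \<in> (Restr r S)\<^sup>*" unfolding T_def by (auto intro: rtrancl_into_rtrancl)
    with uv(2) show False by (simp add: T_def)
  qed
  with assms(1) show ?thesis unfolding conn_def by blast
qed

lemma conn_singleton: "conn r {x}"
  by (simp add: conn_def)

lemma conn_Un:
  assumes "sym r" "conn r A" "conn r B" "A \<inter> B \<noteq> {} \<or> (\<exists>x\<in>A. \<exists>y\<in>B. (x, y) \<in> r)"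
  shows "conn r (A \<union> B)"
proof (rule connI_cut)
  show "A \<union> B \<noteq> {}" using assms(2) by (auto simp: conn_def)
next
  fix T assume T: "T \<subseteq> A \<union> B" "T \<noteq> {}" "T \<noteq> A \<union> B"
  show "\<exists>x\<in>T. \<exists>y\<in>A \<union> B - T. (x, y) \<in> r"
  proof (cases "(T \<inter> A \<noteq> {} \<and> T \<inter> A \<noteq> A) \<or> (T \<inter> B \<noteq> {} \<and> T \<inter> B \<noteq> B)")
    case True
    then show ?thesis
    proof
      assume "T \<inter> A \<noteq> {} \<and> T \<inter> A \<noteq> A"
      then obtain x y where "x \<in> T \<inter> A" "y \<in> A - T \<inter> A" "(x, y) \<in> r"
        using conn_cut[OF assms(2), of "T \<inter> A"] by blast
      then show ?thesis by blast
    next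
      assume "T \<inter> B \<noteq> {} \<and> T \<inter> B \<noteq> B"
      then obtain x y where "x \<in> T \<inter> B" "y \<in> B - T \<inter> B" "(x, y) \<in> r"
        using conn_cut[OF assms(3), of "T \<inter> B"] by blast
      then show ?thesis by blast
    qed
  next
    case False
    with T have "(A \<subseteq> T \<and> T \<inter> B = {}) \<or> (B \<subseteq> T \<and> T \<inter> A = {})" by blast
    with assms(4) have "A \<inter> B = {}" using T assms(2,3) unfolding conn_def by blast
    with assms(4) obtain x y where "x \<in> A" "y \<in> B" "(x, y) \<in> r" by blast
    then show ?thesis
      using \<open>(A \<subseteq> T \<and> T \<inter> B = {}) \<or> (B \<subseteq> T \<and> T \<inter> A = {})\<close> symD[OF assms(1)] by blast
  qed
qed

section \<open>Components\<close>

text \<open>The maximality clause copies that of \<open>two_components\<close>, so that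
  \<open>two_components_eq\<close> only has to translate connectedness.\<close>

definition comps :: "('a \<times> 'a) set \<Rightarrow> 'a set \<Rightarrow> 'a set set" where
  "comps r A = {C. C \<subseteq> A \<and> conn r C \<and> (\<forall>C'. C \<subseteq> C' \<and> C' \<subseteq> A \<and> conn r C' \<longrightarrow> C' = C)}"

lemma compsD:
  assumes "C \<in> comps r A"
  shows "C \<subseteq> A" "conn r C" "C \<noteq> {}"
  using assms by (auto simp: comps_def conn_def)

lemma compsI:
  assumes "C \<subseteq> A" "conn r C" "\<And>C'. C \<subseteq> C' \<Longrightarrow> C' \<subseteq> A \<Longrightarrow> conn r C' \<Longrightarrow> C' = C"
  shows "C \<in> comps r A"
  unfolding comps_def mem_Collect_eq using assms by metis

lemma comps_maximal:
  assumes "C \<in> comps r A" "C \<subseteq> C'" "C' \<subseteq> A" "conn r C'"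
  shows "C' = C"
  using assms unfolding comps_def mem_Collect_eq by metis

lemma comps_no_edge:
  assumes "sym r" "C \<in> comps r A" "x \<in> C" "y \<in> A - C"
  shows "(x, y) \<notin> r"
proof
  assume "(x, y) \<in> r"
  then have "conn r (C \<union> {y})"
    using assms by (intro conn_Un conn_singleton compsD(2)[OF assms(2)]) auto
  then have "C \<union> {y} = C"
    using assms(4) compsD(1)[OF assms(2)] by (intro comps_maximal[OF assms(2)]) auto
  then show False using assms(4) by blast
qed

lemma comps_disjoint:
  assumes "sym r" "C \<in> comps r A" "C' \<in> comps r A" "C \<inter> C' \<noteq> {}"
  shows "C = C'"
proof -
  have "conn r (C \<union> C')"
    using assms by (intro conn_Un compsD(2)[OF assms(2)] compsD(2)[OF assms(3)]) auto
  then have "C \<union> C' = C" "C \<union> C' = C'"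
    using compsD(1)[OF assms(2)] compsD(1)[OF assms(3)]
    by (intro comps_maximal[OF assms(2)] comps_maximal[OF assms(3)]; simp)+
  then show ?thesis by blast
qed

lemma conn_subset_comp:
  assumes "finite A" "D \<subseteq> A" "conn r D"
  obtains C where "C \<in> comps r A" "D \<subseteq> C"
proof -
  define F where "F = {C. D \<subseteq> C \<and> C \<subseteq> A \<and> conn r C}"
  have "finite F" by (rule finite_subset[of _ "Pow A"]) (use assms in \<open>auto simp: F_def\<close>)
  moreover have "F \<noteq> {}" using assms by (auto simp: F_def)
  ultimately obtain C where C: "C \<in> F" "\<forall>C'\<in>F. C \<subseteq> C' \<longrightarrow> C = C'"
    by (rule bexE[OF finite_has_maximal])
  then have "D \<subseteq> C" "C \<subseteq> A" "conn r C" by (auto simp: F_def)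
  moreover have "C' = C" if "C \<subseteq> C'" "C' \<subseteq> A" "conn r C'" for C'
  proof -
    have "C' \<in> F" using that \<open>D \<subseteq> C\<close> by (auto simp: F_def)
    then show ?thesis using C(2) that(1) by blast
  qed
  ultimately have "C \<in> comps r A" "D \<subseteq> C" by (metis compsI, simp)
  then show ?thesis using that by blast
qed

lemma Union_comps:
  assumes "finite A"
  shows "\<Union> (comps r A) = A"
proof
  show "\<Union> (comps r A) \<subseteq> A" using compsD(1) by blast
  show "A \<subseteq> \<Union> (comps r A)"
  proof
    fix x assume "x \<in> A"
    then obtain C where "C \<in> comps r A" "{x} \<subseteq> C"
      using conn_subset_comp[OF assms, of "{x}" r] conn_singleton[of r x] by auto
    then show "x \<in> \<Union> (comps r A)" by blast
  qed
qed

lemma finite_comps: "finite A \<Longrightarrow> finite (comps r A)"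
  by (rule finite_subset[of _ "Pow A"]) (auto simp: comps_def)

text \<open>A connected subset of \<open>A \<union> C\<close> cannot straddle the two parts, since
  no edge joins them. This makes adding a component the inverse of deleting it.\<close>

lemma comps_insert:
  assumes "sym r" "finite A" "conn r C" "A \<inter> C = {}" "\<And>x y. x \<in> C \<Longrightarrow> y \<in> A \<Longrightarrow> (x, y) \<notin> r"
  shows "comps r (A \<union> C) = insert C (comps r A)" "C \<notin> comps r A"
proof -
  have split: "X \<subseteq> A \<or> X \<subseteq> C" if X: "X \<subseteq> A \<union> C" "conn r X" for X
  proof (rule ccontr)
    assume "\<not> ?thesis"
    with X have "X \<inter> C \<subseteq> X" "X \<inter> C \<noteq> {}" "X \<inter> C \<noteq> X" by blast+
    from conn_cut[OF X(2) this] obtain x y where "x \<in> X \<inter> C" "y \<in> X - X \<inter> C" "(x, y) \<in> r" by metis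
    with X(1) assms(5) show False by blast
  qed
  have ne: "X \<noteq> {}" if "conn r X" for X using that by (simp add: conn_def)
  show "comps r (A \<union> C) = insert C (comps r A)"
  proof (intro equalityI subsetI)
    fix X assume X: "X \<in> comps r (A \<union> C)"
    then consider "X \<subseteq> A" | "X \<subseteq> C" using split[OF compsD(1,2)[OF X]] by blast
    then show "X \<in> insert C (comps r A)"
    proof cases
      case 1
      have "X \<in> comps r A"
        using 1 compsD(2)[OF X] by (intro compsI comps_maximal[OF X]) auto
      then show ?thesis by simp
    next
      case 2
      then have "C = X" using assms(3) by (intro comps_maximal[OF X]) auto
      then show ?thesis by simp
    qed
  next
    fix X assume "X \<in> insert C (comps r A)"
    then show "X \<in> comps r (A \<union> C)"
    proof
      assume [simp]: "X = C"
      have "C' = C" if "C \<subseteq> C'" "C' \<subseteq> A \<union> C" "conn r C'" for C'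
      proof -
        have "\<not> C' \<subseteq> A" using that(1) assms(4) ne[OF assms(3)] by blast
        then show ?thesis using split[OF that(2,3)] that(1) by auto
      qed
      then show ?thesis using assms(3) compsI[of C "A \<union> C" r] by simp
    next
      assume X: "X \<in> comps r A"
      have "C' = X" if "X \<subseteq> C'" "C' \<subseteq> A \<union> C" "conn r C'" for C'
      proof -
        have "\<not> C' \<subseteq> C" using that(1) assms(4) compsD(1,3)[OF X] by blast
        then have "C' \<subseteq> A" using split[OF that(2,3)] by auto
        then show ?thesis using that(1,3) by (intro comps_maximal[OF X])
      qed
      then show ?thesis using compsD(1,2)[OF X] compsI by (metis le_supI1)
    qed
  qed
  show "C \<notin> comps r A" using assms(4) ne[OF assms(3)] compsD(1)[of C r A] by blast
qed

lemma card_eq_sum_comps: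
  assumes "sym r" "finite A"
  shows "card A = (\<Sum>C\<in>comps r A. card C)"
proof -
  have "card (\<Union> (comps r A)) = (\<Sum>C\<in>comps r A. card C)"
  proof (rule card_Union_disjoint)
    show "pairwise disjnt (comps r A)"
      unfolding pairwise_def disjnt_def using comps_disjoint[OF assms(1)] by blast
    show "\<And>C. C \<in> comps r A \<Longrightarrow> finite C" using assms(2) compsD(1) finite_subset by metis
  qed
  then show ?thesis by (simp add: Union_comps[OF assms(2)])
qed

section \<open>Counting connected sets\<close>

text \<open>The index counts steps rather than vertices, hence \<open>Suc k\<close>.\<close>

definition walks :: "('a \<times> 'a) set \<Rightarrow> 'a set \<Rightarrow> nat \<Rightarrow> 'a list set" where
  "walks r V k = {xs. length xs = Suc k \<and> set xs \<subseteq> V \<and> successively (\<lambda>x y. (x, y) \<in> r) xs}"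

lemma card_walks:
  assumes "finite V" "\<And>x. x \<in> V \<Longrightarrow> finite (r `` {x}) \<and> card (r `` {x}) \<le> D" "sym r"
  shows "finite (walks r V k) \<and> card (walks r V k) \<le> card V * D ^ k"
proof (induction k)
  case 0
  have "walks r V 0 = (\<lambda>x. [x]) ` V"
    by (auto simp: walks_def length_Suc_conv)
  then show ?case using assms(1) by (simp add: card_image inj_on_def)
next
  case (Suc k)
  let ?S = "SIGMA xs:walks r V k. r `` {hd xs}"
  have sub: "walks r V (Suc k) \<subseteq> (\<lambda>(xs, x). x # xs) ` ?S"
  proof
    fix ys assume ys: "ys \<in> walks r V (Suc k)"
    then obtain x xs where [simp]: "ys = x # xs" by (cases ys) (auto simp: walks_def)
    have "xs \<noteq> []" "(x, hd xs) \<in> r" "xs \<in> walks r V k"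
      using ys by (auto simp: walks_def successively_Cons)
    \<comment> \<open>Walks grow at the head, so symmetry is needed to see the new head as a
      neighbour of the old one.\<close>
    then have "(xs, x) \<in> ?S" using symD[OF assms(3)] by auto
    then show "ys \<in> (\<lambda>(xs, x). x # xs) ` ?S" by force
  qed
  have hd: "hd xs \<in> V" if "xs \<in> walks r V k" for xs
    using that by (cases xs) (auto simp: walks_def)
  have fS: "finite ?S" using Suc assms(2) hd by blast
  have "card (walks r V (Suc k)) \<le> card ?S"
    using fS sub by (rule surj_card_le)
  also have "\<dots> = (\<Sum>xs\<in>walks r V k. card (r `` {hd xs}))"
    using Suc assms(2) hd by (subst card_SigmaI) auto
  also have "\<dots> \<le> (\<Sum>xs\<in>walks r V k. D)"
    by (intro sum_mono) (use assms(2) hd in blast)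
  also have "\<dots> = card (walks r V k) * D" by simp
  also have "\<dots> \<le> card V * D ^ k * D" using Suc by (intro mult_right_mono) auto
  finally show ?case using finite_subset[OF sub] fS by (simp add: mult.commute mult.left_commute)
qed

text \<open>A walk around a spanning tree visits \<open>S\<close> in \<open>2 * (card S - 1)\<close>
  steps. The tree is not built: a maximal subset covered by a walk of the right length would be
  enlarged by a detour \<open>x, y, x\<close>, which costs two steps per new vertex. Reflexivity
  permits padding to a length that depends on \<open>k\<close> alone.\<close>

lemma conn_walk:
  assumes "finite S" "conn r S" "sym r" "refl_on S r" "card S \<le> Suc k"
  shows "\<exists>xs. xs \<noteq> [] \<and> length xs = Suc (2 * k) \<and> set xs = S \<and> successively (\<lambda>x y. (x, y) \<in> r) xs"
proof -
  let ?w = "\<lambda>xs. xs \<noteq> [] \<and> successively (\<lambda>x y. (x, y) \<in> r) xs"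
  define good where "good T \<longleftrightarrow> T \<subseteq> S \<and> (\<exists>xs. ?w xs \<and> length xs = 2 * card T - 1 \<and> set xs = T)" for T
  obtain a where a: "a \<in> S" using assms(2) by (auto simp: conn_def)
  have "good {a}" unfolding good_def using a by (intro conjI exI[of _ "[a]"]) auto
  moreover define F where "F = {T. good T}"
  moreover have "finite F"
    by (rule finite_subset[of _ "Pow S"]) (auto simp: F_def good_def assms(1))
  ultimately have "\<exists>T\<in>F. \<forall>T'\<in>F. T \<subseteq> T' \<longrightarrow> T = T'"
    by (intro finite_has_maximal) auto
  then obtain T where T: "good T" "\<And>T'. good T' \<Longrightarrow> T \<subseteq> T' \<Longrightarrow> T = T'"
    unfolding F_def by auto
  then obtain xs where xs: "?w xs" "length xs = 2 * card T - 1" "set xs = T" "T \<subseteq> S"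
    unfolding good_def by blast
  have finT: "finite T" using xs by auto
  have "T \<noteq> {}" using xs by auto
  have "T = S"
  proof (rule ccontr)
    assume "T \<noteq> S"
    with conn_cut[OF assms(2) xs(4) \<open>T \<noteq> {}\<close>] obtain x y
      where xy: "x \<in> T" "y \<in> S - T" "(x, y) \<in> r" by metis
    obtain us vs where us: "xs = us @ x # vs" using xy(1) xs(3) by (meson split_list)
    define ys where "ys = us @ [x, y, x] @ vs"
    have "?w ys" using xs(1) xy(3) symD[OF assms(3) xy(3)] unfolding us ys_def
      by (auto simp: successively_append_iff successively_Cons)
    moreover have "length ys = 2 * card (insert y T) - 1"
      using xs(2) xy finT \<open>T \<noteq> {}\<close> card_gt_0_iff[of T] unfolding us ys_def by simp
    moreover have "set ys = insert y T" using xs(3) unfolding us ys_def by auto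
    ultimately have "good (insert y T)" using xy xs(4) unfolding good_def by blast
    from T(2)[OF this] xy(2) show False by blast
  qed
  define ys where "ys = xs @ replicate (Suc (2 * k) - length xs) (last xs)"
  have rep: "successively (\<lambda>x y. (x, y) \<in> r) (replicate j (last xs))" for j
  proof (induction j)
    case (Suc j)
    have "last xs \<in> S" using xs \<open>T = S\<close> by (metis last_in_set)
    then have "(last xs, last xs) \<in> r" using assms(4) by (simp add: refl_on_def)
    then show ?case using Suc by (cases j) auto
  qed auto
  have l: "length xs \<le> Suc (2 * k)" using xs(2) assms(5) \<open>T = S\<close> by simp
  have "last xs \<in> S" using xs \<open>T = S\<close> by (metis last_in_set)
  then have "(last xs, last xs) \<in> r" using assms(4) by (simp add: refl_on_def)
  then have "successively (\<lambda>x y. (x, y) \<in> r) ys"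
    unfolding ys_def using xs(1) rep
    by (cases "Suc (2 * k) - length xs") (auto simp: successively_append_iff simp flip: replicate_Suc)
  moreover have "length ys = Suc (2 * k)" using l by (simp add: ys_def)
  moreover have "set ys = S" using xs \<open>T = S\<close> \<open>last xs \<in> S\<close> by (auto simp: ys_def)
  ultimately show ?thesis by (intro exI[of _ ys]) auto
qed

text \<open>Such a set is the vertex set of a walk with \<open>2 * (k - 1)\<close> steps, so walks
  are counted instead. For \<open>k = 0\<close> there is nothing to count, because connected sets
  are nonempty.\<close>

lemma card_conn_sets_le:
  assumes "finite V" "\<And>x. x \<in> V \<Longrightarrow> finite (r `` {x}) \<and> card (r `` {x}) \<le> D" "sym r" "refl r" "D \<ge> 1"
  shows "card {S. S \<subseteq> V \<and> conn r S \<and> card S \<le> k} \<le> card V * D ^ (2 * k)"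
proof (cases k)
  case 0
  have "{S. S \<subseteq> V \<and> conn r S \<and> card S \<le> k} = {}"
    using 0 assms(1) by (auto simp: conn_def dest: finite_subset)
  then show ?thesis by (simp only: card.empty)
next
  case (Suc j)
  have sub: "{S. S \<subseteq> V \<and> conn r S \<and> card S \<le> k} \<subseteq> set ` walks r V (2 * j)"
  proof
    fix S assume "S \<in> {S. S \<subseteq> V \<and> conn r S \<and> card S \<le> k}"
    then have S: "S \<subseteq> V" "conn r S" "card S \<le> Suc j" "finite S"
      using Suc finite_subset[OF _ assms(1)] by auto
    have "refl_on S r" using assms(4) by (auto simp: refl_on_def)
    from conn_walk[OF S(4,2) assms(3) this S(3)] obtain xs where
      "length xs = Suc (2 * j)" "set xs = S" "successively (\<lambda>x y. (x, y) \<in> r) xs" by blast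
    then show "S \<in> set ` walks r V (2 * j)" using S(1) by (auto simp: walks_def)
  qed
  have w: "finite (walks r V (2 * j))" "card (walks r V (2 * j)) \<le> card V * D ^ (2 * j)"
    using card_walks[OF assms(1-3)] by auto
  have "card {S. S \<subseteq> V \<and> conn r S \<and> card S \<le> k} \<le> card (walks r V (2 * j))"
    using w(1) sub by (rule surj_card_le)
  also have "\<dots> \<le> card V * D ^ (2 * j)" by (rule w(2))
  also have "\<dots> \<le> card V * D ^ (2 * k)" using Suc assms(5) by (intro mult_left_mono power_increasing) auto
  finally show ?thesis .
qed

section \<open>Regular bipartite graphs\<close>

lemma card_relpow_image:
  fixes r :: "('a \<times> 'a) set"
  assumes "\<And>x. finite (r `` {x}) \<and> card (r `` {x}) \<le> D"
  shows "finite ((r ^^ k) `` {x}) \<and> card ((r ^^ k) `` {x}) \<le> D ^ k"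
proof (induction k arbitrary: x)
  case 0
  have "(r ^^ 0) `` {x} = {x}" by auto
  then show ?case by simp
next
  case (Suc k)
  have eq: "(r ^^ Suc k) `` {x} = (\<Union>y\<in>(r ^^ k) `` {x}. r `` {y})" by auto
  have "card (\<Union>y\<in>(r ^^ k) `` {x}. r `` {y}) \<le> (\<Sum>y\<in>(r ^^ k) `` {x}. card (r `` {y}))"
    using Suc by (intro card_UN_le) auto
  also have "\<dots> \<le> (\<Sum>y\<in>(r ^^ k) `` {x}. D)" using assms by (intro sum_mono) auto
  also have "\<dots> = card ((r ^^ k) `` {x}) * D" by simp
  also have "\<dots> \<le> D ^ k * D" using Suc by (intro mult_right_mono) auto
  finally show ?case unfolding eq using Suc assms by (simp add: mult.commute)
qed

lemma sym_relpow: "sym r \<Longrightarrow> sym (r ^^ k)"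
proof (induction k)
  case (Suc k)
  have "(x, y) \<in> r ^^ Suc k \<Longrightarrow> (y, x) \<in> r ^^ Suc k" for x y
    using Suc relpow_Suc_I2[of y _ r x k] by (auto dest: symD)
  then show ?case by (rule symI)
qed (auto simp: sym_def)

lemma refl_relpow: "refl r \<Longrightarrow> refl (r ^^ k)"
  by (induction k) (auto simp: refl_on_def)

lemma relpow_mono_refl:
  assumes "refl r" "k \<le> l" "(x, y) \<in> r ^^ k"
  shows "(x, y) \<in> r ^^ l"
proof -
  have "(y, y) \<in> r ^^ (l - k)" using refl_relpow[OF assms(1)] by (auto simp: refl_on_def)
  then have "(x, y) \<in> r ^^ (k + (l - k))" using assms(3) by (auto simp: relpow_add)
  then show ?thesis using assms(2) by simp
qed

text \<open>A cut of \<open>Y\<close> splits \<open>W\<close> according to which side is near. If an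
  edge of \<open>W\<close> crosses the split, its ends lead to \<open>Y\<close> in 2 + 2 + 2 steps,
  which is the origin of the 6. If one side of the cut is near to all of \<open>W\<close>, a vertex
  of the other side reaches it in 3 + 2 steps.\<close>

lemma conn_relpow_of_conn:
  fixes r s :: "('a \<times> 'a) set"
  assumes "refl s" "sym s" "conn r W" "r \<subseteq> s ^^ 2"
    and near: "\<And>w. w \<in> W \<Longrightarrow> \<exists>y\<in>Y. (w, y) \<in> s ^^ 2" "\<And>y. y \<in> Y \<Longrightarrow> \<exists>w\<in>W. (y, w) \<in> s ^^ 3"
  shows "conn (s ^^ 6) Y"
proof (rule connI_cut)
  show "Y \<noteq> {}" using assms(3) near(1) unfolding conn_def by blast
next
  fix T assume T: "T \<subseteq> Y" "T \<noteq> {}" "T \<noteq> Y"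
  have tr: "(x, z) \<in> s ^^ 6" if "(x, y) \<in> s ^^ i" "(y, z) \<in> s ^^ j" "i + j \<le> 6" for x y z and i j :: nat
  proof -
    have "(x, z) \<in> s ^^ (i + j)" using that(1,2) by (auto simp: relpow_add)
    then show ?thesis by (rule relpow_mono_refl[OF assms(1) that(3)])
  qed
  have sy: "(y, x) \<in> s ^^ i" if "(x, y) \<in> s ^^ i" for x y and i :: nat
    using that sym_relpow[OF assms(2)] by (auto dest: symD)
  define A where "A = {w \<in> W. \<exists>y\<in>T. (w, y) \<in> s ^^ 2}"
  define B where "B = {w \<in> W. \<exists>y\<in>Y - T. (w, y) \<in> s ^^ 2}"
  have AB: "A \<union> B = W" using near(1) by (auto simp: A_def B_def)
  consider "A = W" | "A = {}" | "A \<subseteq> W" "A \<noteq> {}" "A \<noteq> W" by (auto simp: A_def)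
  then show "\<exists>x\<in>T. \<exists>y\<in>Y - T. (x, y) \<in> s ^^ 6"
  proof cases
    case 1
    obtain y where y: "y \<in> Y - T" using T by blast
    then obtain w where w: "w \<in> W" "(y, w) \<in> s ^^ 3" using near(2) by blast
    then obtain x where "x \<in> T" "(w, x) \<in> s ^^ 2" using 1 unfolding A_def by blast
    then show ?thesis using y tr[of x w 2 y 3] sy w by auto
  next
    case 2
    then have "B = W" using AB by blast
    obtain x where x: "x \<in> T" using T by blast
    then obtain w where w: "w \<in> W" "(x, w) \<in> s ^^ 3" using near(2) T by blast
    then obtain y where "y \<in> Y - T" "(w, y) \<in> s ^^ 2" using \<open>B = W\<close> unfolding B_def by blast
    then show ?thesis using x tr[of x w 3 y 2] w by auto
  next
    case 3
    then obtain v w where vw: "v \<in> A" "w \<in> W - A" "(v, w) \<in> r" using conn_cut[OF assms(3)] by metis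
    then have "w \<in> B" using AB by blast
    then obtain y where y: "y \<in> Y - T" "(w, y) \<in> s ^^ 2" by (auto simp: B_def)
    obtain x where x: "x \<in> T" "(v, x) \<in> s ^^ 2" using vw(1) by (auto simp: A_def)
    have "(v, y) \<in> s ^^ (2 + 2)" using vw(3) assms(4) y(2) unfolding relpow_add by blast
    then show ?thesis using x y tr[of x v 2 y 4] sy by auto
  qed
qed

text \<open>The roles of \<open>P\<close> and \<open>Q\<close> are not symmetric below: components
  are always taken in \<open>P\<close>. The lemma \<open>swap\<close> provides the same facts for
  the other side.\<close>

locale regular_bipartite =
  fixes P Q :: "'a set" and nb :: "'a \<Rightarrow> 'a set" and d :: nat
  assumes finite_P: "finite P" and finite_Q: "finite Q" and PQ_disjoint: "P \<inter> Q = {}"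
    and nb_P: "\<And>x. x \<in> P \<Longrightarrow> nb x \<subseteq> Q" and nb_Q: "\<And>y. y \<in> Q \<Longrightarrow> nb y \<subseteq> P"
    and card_nb: "\<And>x. x \<in> P \<union> Q \<Longrightarrow> card (nb x) = d"
    and nb_sym: "\<And>x y. x \<in> P \<Longrightarrow> y \<in> Q \<Longrightarrow> y \<in> nb x \<longleftrightarrow> x \<in> nb y"
    and d_pos: "d > 0"
begin

lemma swap: "regular_bipartite Q P nb d"
proof
  show "y \<in> nb x \<longleftrightarrow> x \<in> nb y" if "x \<in> Q" "y \<in> P" for x y
    using nb_sym[of y x] that by simp
qed (use PQ_disjoint in \<open>auto simp: finite_P finite_Q card_nb d_pos dest: nb_P nb_Q\<close>)

definition Nb :: "'a set \<Rightarrow> 'a set" where "Nb A = (\<Union>x\<in>A. nb x)"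

text \<open>Distance at most 2 through \<open>Q\<close>; connectedness for this relation is
  2-linkedness, see \<open>conn_Nb_iff\<close>.\<close>

definition lnk :: "('a \<times> 'a) set" where
  "lnk = {(x, y). x \<in> P \<and> y \<in> P \<and> nb x \<inter> nb y \<noteq> {}}"

text \<open>The closure: for \<open>A \<subseteq> P\<close> this is the largest subset of
  \<open>P\<close> with neighbourhood \<open>Nb A\<close>.\<close>

definition cl :: "'a set \<Rightarrow> 'a set" where "cl A = {x \<in> P. nb x \<subseteq> Nb A}"

text \<open>Adjacency with a loop at every element of the type. The loops make the powers
  increasing, so that \<open>step ^^ k\<close> means distance at most \<open>k\<close>.\<close>

definition step :: "('a \<times> 'a) set" where
  "step = {(x, y). y = x \<or> (x \<in> P \<union> Q \<and> y \<in> nb x)}"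

lemma finite_nb: "x \<in> P \<union> Q \<Longrightarrow> finite (nb x)"
  using finite_subset[OF nb_P finite_Q] finite_subset[OF nb_Q finite_P] by auto

lemma Nb_subset: "A \<subseteq> P \<Longrightarrow> Nb A \<subseteq> Q"
  using nb_P by (auto simp: Nb_def)

lemma Nb_mono: "A \<subseteq> B \<Longrightarrow> Nb A \<subseteq> Nb B"
  by (auto simp: Nb_def)

lemma Nb_Un: "Nb (A \<union> B) = Nb A \<union> Nb B"
  by (auto simp: Nb_def)

lemma finite_Nb: "A \<subseteq> P \<Longrightarrow> finite (Nb A)"
  by (rule finite_subset[OF Nb_subset finite_Q])

lemma double_count:
  assumes "A \<subseteq> P" "B \<subseteq> Q"
  shows "(\<Sum>x\<in>A. card (nb x \<inter> B)) = (\<Sum>y\<in>B. card (nb y \<inter> A))"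
proof -
  have fin: "finite A" "finite B" using assms finite_P finite_Q finite_subset by auto
  have "(\<Sum>x\<in>A. card (nb x \<inter> B)) = (\<Sum>x\<in>A. \<Sum>y\<in>B. of_bool (y \<in> nb x))"
    using fin by (intro sum.cong refl) (simp add: Int_commute)
  also have "\<dots> = (\<Sum>y\<in>B. \<Sum>x\<in>A. of_bool (y \<in> nb x))" by (rule sum.swap)
  also have "\<dots> = (\<Sum>y\<in>B. \<Sum>x\<in>A. of_bool (x \<in> nb y))"
  proof (intro sum.cong refl)
    fix x y assume "y \<in> B" "x \<in> A"
    then have "y \<in> nb x \<longleftrightarrow> x \<in> nb y" using assms by (intro nb_sym) auto
    then show "of_bool (y \<in> nb x) = (of_bool (x \<in> nb y) :: nat)" by simp
  qed
  also have "\<dots> = (\<Sum>y\<in>B. card (nb y \<inter> A))"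
    using fin by (intro sum.cong refl) (simp add: Int_commute)
  finally show ?thesis .
qed

lemma sum_card_nb:
  assumes "A \<subseteq> P" "Nb A \<subseteq> B" "B \<subseteq> Q"
  shows "(\<Sum>y\<in>B. card (nb y \<inter> A)) = d * card A"
proof -
  have "(\<Sum>y\<in>B. card (nb y \<inter> A)) = (\<Sum>x\<in>A. card (nb x \<inter> B))"
    by (rule double_count[symmetric]) (use assms in auto)
  also have "\<dots> = (\<Sum>x\<in>A. d)"
  proof (rule sum.cong)
    fix x assume "x \<in> A"
    then have "nb x \<inter> B = nb x" using assms by (auto simp: Nb_def)
    then show "card (nb x \<inter> B) = d" using \<open>x \<in> A\<close> assms(1) card_nb by auto
  qed simp
  finally show ?thesis by simp
qed

lemma card_P_eq_card_Q: "card P = card Q"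
proof -
  interpret sw: regular_bipartite Q P nb d by (rule swap)
  have "d * card P = (\<Sum>y\<in>Q. card (nb y \<inter> P))"
    using sum_card_nb[of P Q] Nb_subset[of P] by simp
  also have "\<dots> = (\<Sum>y\<in>Q. d)"
    using nb_Q card_nb by (intro sum.cong refl) (auto simp: Int_absorb2)
  finally show ?thesis using d_pos by simp
qed

lemma card_nb_Int_le:
  assumes "x \<in> P \<union> Q"
  shows "card (nb x \<inter> A) \<le> d"
  using card_mono[OF finite_nb[OF assms], of "nb x \<inter> A"] card_nb[OF assms] by simp

lemma card_nb_split:
  assumes "x \<in> P \<union> Q"
  shows "real d = real (card (nb x \<inter> A)) + real (card (nb x - A))"
proof -
  have "card (nb x \<inter> A) + card (nb x - A) = card (nb x)"
    using card_Int_Diff[OF finite_nb[OF assms]] by simp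
  then show ?thesis using card_nb[OF assms] by simp
qed

text \<open>Each of the \<open>d * card A\<close> edges at \<open>A\<close> ends in
  \<open>Nb A\<close>, and a vertex there absorbs at most \<open>d\<close> of them.\<close>

lemma card_le_card_Nb:
  assumes "A \<subseteq> P"
  shows "card A \<le> card (Nb A)"
proof -
  have "d * card A = (\<Sum>y\<in>Nb A. card (nb y \<inter> A))"
    using sum_card_nb[of A "Nb A"] assms Nb_subset by simp
  also have "\<dots> \<le> (\<Sum>y\<in>Nb A. d)"
    using Nb_subset[OF assms] by (intro sum_mono card_nb_Int_le) auto
  finally show ?thesis using d_pos by simp
qed

lemma card_Nb_le:
  assumes "A \<subseteq> P"
  shows "card (Nb A) \<le> d * card A"
proof -
  have "card (Nb A) \<le> (\<Sum>x\<in>A. card (nb x))"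
    unfolding Nb_def using assms finite_P finite_subset by (intro card_UN_le) auto
  also have "\<dots> = (\<Sum>x\<in>A. d)" using assms card_nb by (intro sum.cong) auto
  finally show ?thesis by (simp add: mult.commute)
qed

lemma cl_subset: "cl A \<subseteq> P"
  by (auto simp: cl_def)

lemma subset_cl: "A \<subseteq> P \<Longrightarrow> A \<subseteq> cl A"
  by (auto simp: cl_def Nb_def)

lemma Nb_cl: "A \<subseteq> P \<Longrightarrow> Nb (cl A) = Nb A"
  using Nb_mono[OF subset_cl, of A] by (auto simp: cl_def Nb_def)

lemma sym_lnk: "sym lnk"
  by (auto simp: lnk_def sym_def)

lemma sym_step: "sym step"
proof (rule symI)
  fix x y assume xy: "(x, y) \<in> step"
  then consider "y = x" | "x \<in> P" "y \<in> nb x" | "x \<in> Q" "y \<in> nb x" by (auto simp: step_def)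
  then show "(y, x) \<in> step"
  proof cases
    case 2
    then have "y \<in> Q" using nb_P by blast
    then show ?thesis using 2 nb_sym by (auto simp: step_def)
  next
    case 3
    then have "y \<in> P" using nb_Q by blast
    then show ?thesis using 3 nb_sym by (auto simp: step_def)
  qed (simp add: step_def)
qed

lemma refl_step: "refl step"
  by (auto simp: step_def refl_on_def)

lemma card_step_image: "finite (step `` {x}) \<and> card (step `` {x}) \<le> Suc d"
proof (cases "x \<in> P \<union> Q")
  case True
  then have "step `` {x} = insert x (nb x)" by (auto simp: step_def)
  then show ?thesis using finite_nb[OF True] card_nb[OF True] by (simp add: card_insert_le_m1 card_insert_if)
next
  case False
  then have "step `` {x} = {x}" by (auto simp: step_def)
  then show ?thesis by simp
qed

lemma lnk_subset_step2: "lnk \<subseteq> step ^^ 2"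
proof
  fix p assume "p \<in> lnk"
  then obtain x y z where "p = (x, y)" "x \<in> P" "y \<in> P" "z \<in> nb x" "z \<in> nb y"
    by (auto simp: lnk_def)
  moreover have "z \<in> Q" using calculation nb_P by blast
  ultimately have "(x, z) \<in> step" "(z, y) \<in> step" using nb_sym by (auto simp: step_def)
  then show "p \<in> step ^^ 2" using \<open>p = (x, y)\<close> by (auto simp: numeral_2_eq_2)
qed

text \<open>The exponent 6 is that of \<open>conn_relpow_of_conn\<close>, and a set of size
  \<open>k\<close> takes at most \<open>2 * k\<close> steps of a walk. This is the origin of the
  base \<open>Suc d ^ 12\<close> that appears from here on.\<close>

lemma card_conn_step_le:
  "card {Y. Y \<subseteq> P \<union> Q \<and> conn (step ^^ 6) Y \<and> card Y \<le> k} \<le> card (P \<union> Q) * (Suc d ^ 6) ^ (2 * k)"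
proof (rule card_conn_sets_le)
  show "finite ((step ^^ 6) `` {x}) \<and> card ((step ^^ 6) `` {x}) \<le> Suc d ^ 6" for x
    using card_relpow_image[of step "Suc d" 6 x] card_step_image by simp
qed (auto intro: sym_relpow refl_relpow sym_step refl_step finite_P finite_Q)

lemma conn_mono: "conn r S \<Longrightarrow> r \<subseteq> r' \<Longrightarrow> conn r' S"
  unfolding conn_def using rtrancl_mono[of "Restr r S" "Restr r' S"] by blast

text \<open>Routed through \<open>step ^^ 6\<close> so that small components and containers share
  one base.\<close>

lemma card_conn_lnk_le:
  "card {C. C \<subseteq> P \<and> conn lnk C \<and> card C \<le> k} \<le> card (P \<union> Q) * (Suc d ^ 6) ^ (2 * k)"
proof -
  have "lnk \<subseteq> step ^^ 6"
  proof
    fix p assume "p \<in> lnk"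
    then show "p \<in> step ^^ 6"
      using lnk_subset_step2 relpow_mono_refl[OF refl_step, of 2 6 "fst p" "snd p"] by auto
  qed
  then have sub: "{C. C \<subseteq> P \<and> conn lnk C \<and> card C \<le> k}
      \<subseteq> {Y. Y \<subseteq> P \<union> Q \<and> conn (step ^^ 6) Y \<and> card Y \<le> k}"
    using conn_mono by blast
  have "card {C. C \<subseteq> P \<and> conn lnk C \<and> card C \<le> k}
      \<le> card {Y. Y \<subseteq> P \<union> Q \<and> conn (step ^^ 6) Y \<and> card Y \<le> k}"
    by (rule card_mono[OF finite_subset[of _ "Pow (P \<union> Q)"] sub]) (auto simp: finite_P finite_Q)
  then show ?thesis using card_conn_step_le[of k] by linarith
qed

text \<open>Every vertex of the closure has a neighbour, as \<open>d > 0\<close>; it lies in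
  \<open>Nb C\<close> and thus links the vertex to one of \<open>C\<close>.\<close>

lemma conn_cl:
  assumes "C \<subseteq> P" "conn lnk C"
  shows "conn lnk (cl C)"
proof (rule connI_cut)
  show "cl C \<noteq> {}" using assms subset_cl[OF assms(1)] by (auto simp: conn_def)
next
  fix T assume T: "T \<subseteq> cl C" "T \<noteq> {}" "T \<noteq> cl C"
  have link: "\<exists>c\<in>C. (x, c) \<in> lnk" if "x \<in> cl C" for x
  proof -
    have "nb x \<noteq> {}" using that card_nb[of x] d_pos by (auto simp: cl_def)
    then obtain y where "y \<in> nb x" by blast
    moreover from this have "y \<in> Nb C" using that by (auto simp: cl_def)
    ultimately show ?thesis using that assms(1) by (auto simp: cl_def Nb_def lnk_def)
  qed
  consider "T \<inter> C \<noteq> {}" "T \<inter> C \<noteq> C" | "C \<subseteq> T" | "T \<inter> C = {}" by blast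
  then show "\<exists>x\<in>T. \<exists>y\<in>cl C - T. (x, y) \<in> lnk"
  proof cases
    case 1
    then obtain x y where "x \<in> T \<inter> C" "y \<in> C - T \<inter> C" "(x, y) \<in> lnk"
      using conn_cut[OF assms(2), of "T \<inter> C"] by blast
    then show ?thesis using subset_cl[OF assms(1)] by blast
  next
    case 2
    obtain y where y: "y \<in> cl C" "y \<notin> T" using T by blast
    then show ?thesis using link[OF y(1)] 2 symD[OF sym_lnk] by blast
  next
    case 3
    obtain x where x: "x \<in> T" using T by blast
    then obtain c where "c \<in> C" "(x, c) \<in> lnk" using link T by blast
    then show ?thesis using x 3 subset_cl[OF assms(1)] by blast
  qed
qed

end

section \<open>Containers\<close>

lemma sum_Pow_power:
  fixes lam :: "'b :: comm_semiring_1"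
  assumes "finite K"
  shows "(\<Sum>A\<in>Pow K. lam ^ card A) = (1 + lam) ^ card K"
  using assms
proof (induction K)
  case (insert x K)
  have fin: "finite A" if "A \<in> Pow K" for A using that insert(1) finite_subset by auto
  have "(\<Sum>A\<in>Pow (insert x K). lam ^ card A)
      = (\<Sum>A\<in>Pow K. lam ^ card A) + (\<Sum>A\<in>insert x ` Pow K. lam ^ card A)"
    unfolding Pow_insert using insert by (intro sum.union_disjoint) auto
  also have "(\<Sum>A\<in>insert x ` Pow K. lam ^ card A) = (\<Sum>A\<in>Pow K. lam ^ card (insert x A))"
  proof -
    have "inj_on (insert x) (Pow K)"
    proof (rule inj_onI)
      fix A B assume "A \<in> Pow K" "B \<in> Pow K" and eq: "insert x A = insert x B"
      then have "x \<notin> A" "x \<notin> B" using insert(2) by auto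
      with eq show "A = B" by (simp add: insert_ident)
    qed
    then show ?thesis by (simp add: sum.reindex)
  qed
  also have "\<dots> = (\<Sum>A\<in>Pow K. lam * lam ^ card A)"
  proof (rule sum.cong)
    fix A assume A: "A \<in> Pow K"
    then have "x \<notin> A" using insert(2) by auto
    then show "lam ^ card (insert x A) = lam * lam ^ card A" using fin[OF A] by simp
  qed simp
  finally show ?case using insert by (simp add: algebra_simps flip: sum_distrib_left)
qed simp

lemma sum_le_sum_UN:
  fixes f :: "'a \<Rightarrow> real"
  assumes "finite I" "\<And>i. i \<in> I \<Longrightarrow> finite (B i)" "A \<subseteq> (\<Union>i\<in>I. B i)" "\<And>x. f x \<ge> 0"
  shows "sum f A \<le> (\<Sum>i\<in>I. sum f (B i))"
proof -
  have "sum f (\<Union>i\<in>I. B i) \<le> (\<Sum>i\<in>I. sum f (B i))"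
    using assms(1,2)
  proof (induction I)
    case (insert i I)
    have "sum f (B i \<union> (\<Union>i\<in>I. B i)) = sum f (B i) + sum f (\<Union>i\<in>I. B i) - sum f (B i \<inter> (\<Union>i\<in>I. B i))"
      using insert by (intro sum_Un) auto
    also have "\<dots> \<le> sum f (B i) + sum f (\<Union>i\<in>I. B i)" by (simp add: assms(4) sum_nonneg)
    finally show ?case using insert by fastforce
  qed simp
  moreover have "sum f A \<le> sum f (\<Union>i\<in>I. B i)" using assms by (intro sum_mono2) auto
  ultimately show ?thesis by linarith
qed

context regular_bipartite
begin

text \<open>Take \<open>V\<close> maximal among the sets that cover at least \<open>\<psi>\<close>
  elements of \<open>Z\<close> per chosen vertex: a vertex that still saw \<open>\<psi>\<close>
  uncovered elements could be added. The last clause says that no chosen vertex is idle; it keeps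
  \<open>V\<close> close to \<open>Z\<close>, as is needed for connectedness.\<close>

lemma greedy_cover:
  fixes \<psi> :: real
  assumes "finite K" "K \<subseteq> P \<union> Q" "finite Z" "\<psi> > 0"
  obtains V where "V \<subseteq> K" "\<psi> * card V \<le> card (Z \<inter> Nb V)"
    "\<And>v. v \<in> K \<Longrightarrow> card (nb v \<inter> (Z - Nb V)) < \<psi>" "\<And>v. v \<in> V \<Longrightarrow> nb v \<inter> Z \<noteq> {}"
proof -
  define F where "F = {V. V \<subseteq> K \<and> \<psi> * card V \<le> card (Z \<inter> Nb V) \<and> (\<forall>v\<in>V. nb v \<inter> Z \<noteq> {})}"
  have "finite F" by (rule finite_subset[of _ "Pow K"]) (auto simp: F_def assms(1))
  moreover have "{} \<in> F" by (simp add: F_def)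
  ultimately have "\<exists>V\<in>F. \<forall>V'\<in>F. V \<subseteq> V' \<longrightarrow> V = V'"
    by (intro finite_has_maximal) auto
  then obtain V where V: "V \<in> F" "\<forall>V'\<in>F. V \<subseteq> V' \<longrightarrow> V = V'" by (rule bexE)
  have VF: "V \<subseteq> K" "\<psi> * card V \<le> card (Z \<inter> Nb V)" "\<And>v. v \<in> V \<Longrightarrow> nb v \<inter> Z \<noteq> {}"
    using V(1) by (auto simp: F_def)
  have finV: "finite V" using VF(1) assms(1) finite_subset by auto
  have "card (nb v \<inter> (Z - Nb V)) < \<psi>" if v: "v \<in> K" for v
  proof (rule ccontr)
    assume "\<not> ?thesis"
    then have big: "\<psi> \<le> card (nb v \<inter> (Z - Nb V))" by simp
    have ne: "nb v \<inter> (Z - Nb V) \<noteq> {}"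
    proof
      assume "nb v \<inter> (Z - Nb V) = {}"
      with big assms(4) show False by simp
    qed
    then have "v \<notin> V" by (auto simp: Nb_def)
    have "Z \<inter> Nb (insert v V) = (Z \<inter> Nb V) \<union> (nb v \<inter> (Z - Nb V))" by (auto simp: Nb_def)
    then have "card (Z \<inter> Nb (insert v V)) = card (Z \<inter> Nb V) + card (nb v \<inter> (Z - Nb V))"
      using assms(3) by (simp add: card_Un_disjoint Int_Diff disjoint_iff)
    moreover have "card (insert v V) = Suc (card V)" using finV \<open>v \<notin> V\<close> by simp
    ultimately have "\<psi> * card (insert v V) \<le> card (Z \<inter> Nb (insert v V))"
      using VF(2) big by (simp add: algebra_simps)
    then have "insert v V \<in> F" using VF v ne unfolding F_def by auto
    then have "V = insert v V" using V(2) by blast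
    then show False using \<open>v \<notin> V\<close> by blast
  qed
  then show ?thesis using that VF by blast
qed

text \<open>Sapozhenko's approximation of a 2-linked set \<open>C\<close> by sets that depend on few vertices: \<open>U\<close> is a
  greedy cover of \<open>Nb C\<close> by vertices of \<open>cl C\<close>, so that \<open>S1 \<psi> U\<close> contains \<open>cl C\<close>; a second greedy
  choice \<open>V\<close> outside \<open>Nb C\<close> then removes most of the surplus. The result \<open>cont_S\<close> contains \<open>cl C\<close>, and
  \<open>cont_F\<close>, which is contained in \<open>Nb C\<close>, is not much smaller than \<open>cont_S\<close>.\<close>

definition S1 :: "real \<Rightarrow> 'a set \<Rightarrow> 'a set" where
  "S1 \<psi> U = {u \<in> P. real (card (nb u \<inter> Nb U)) \<ge> real d - \<psi>}"

definition cont_S :: "real \<Rightarrow> 'a set \<Rightarrow> 'a set \<Rightarrow> 'a set" where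
  "cont_S \<psi> U V = S1 \<psi> U - Nb V"

definition cont_F :: "real \<Rightarrow> 'a set \<Rightarrow> 'a set \<Rightarrow> 'a set" where
  "cont_F \<psi> U V = Nb U \<union> {v \<in> Q. real (card (nb v \<inter> cont_S \<psi> U V)) \<ge> \<psi>}"

text \<open>This counts the edges that leave \<open>Nb A\<close> without ending in \<open>A\<close>.
  For \<open>A = cl C\<close> their number is \<open>d * t\<close>, the budget against which
  \<open>container\<close> charges all errors.\<close>

lemma sum_card_nb_Diff:
  assumes "A \<subseteq> P"
  shows "(\<Sum>y\<in>Nb A. real (card (nb y \<inter> (P - A)))) = real d * (real (card (Nb A)) - real (card A))"
proof -
  have "real (card (nb y \<inter> (P - A))) = real d - real (card (nb y \<inter> A))" if "y \<in> Nb A" for y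
  proof -
    have y: "y \<in> Q" using that Nb_subset[OF assms] by auto
    have "nb y - A = nb y \<inter> (P - A)" using nb_Q[OF y] by blast
    then show ?thesis using card_nb_split[of y A] y by simp
  qed
  then have "(\<Sum>y\<in>Nb A. real (card (nb y \<inter> (P - A))))
      = (\<Sum>y\<in>Nb A. real d - real (card (nb y \<inter> A)))" by (intro sum.cong) auto
  also have "\<dots> = real d * card (Nb A) - real (\<Sum>y\<in>Nb A. card (nb y \<inter> A))"
    by (simp add: sum_subtractf mult.commute)
  also have "(\<Sum>y\<in>Nb A. card (nb y \<inter> A)) = d * card A"
    using sum_card_nb[of A "Nb A"] assms Nb_subset by simp
  finally show ?thesis by (simp add: algebra_simps)
qed

text \<open>Since \<open>\<psi> \<le> d / 2\<close>, a vertex of the container outside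
  \<open>cl C\<close> and a vertex of \<open>Nb C\<close> missed by \<open>cont_F\<close> each use
  up at least \<open>d / 2\<close> of the \<open>d * t\<close> edges between \<open>Nb C\<close> and
  \<open>P - cl C\<close>; hence there are at most \<open>2 * t\<close> of either kind. The last
  clause makes \<open>U\<close> and \<open>V\<close>, together with any part of \<open>Nb C\<close>,
  a set that can be counted by walks.\<close>

lemma container:
  fixes \<psi> t :: real
  assumes C: "C \<subseteq> P" "conn lnk C" and \<psi>: "0 < \<psi>" "\<psi> \<le> d / 2"
    and t: "t = real (card (Nb C)) - real (card (cl C))"
  obtains U V where "U \<subseteq> P" "V \<subseteq> Q - Nb C" "\<psi> * card U \<le> card (Nb C)" "\<psi> * card V \<le> 2 * t"
    "cont_F \<psi> U V \<subseteq> Nb C" "cl C \<subseteq> cont_S \<psi> U V"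
    "card (cont_S \<psi> U V) \<le> card (cont_F \<psi> U V) + 4 * \<psi> * t / d"
    "\<And>X. X \<subseteq> Nb C \<Longrightarrow> conn (step ^^ 6) (U \<union> V \<union> X)"
proof -
  define W where "W = cl C"
  define G where "G = Nb C"
  have WP: "W \<subseteq> P" and CW: "C \<subseteq> W" unfolding W_def using cl_subset subset_cl[OF C(1)] by auto
  have NW: "Nb W = G" unfolding W_def G_def by (rule Nb_cl[OF C(1)])
  have GQ: "G \<subseteq> Q" unfolding G_def by (rule Nb_subset[OF C(1)])
  have fin: "finite W" "finite G" using WP GQ finite_P finite_Q finite_subset by auto
  have finsub: "finite A" if "A \<subseteq> P" for A using that finite_P by (rule finite_subset)
  have finsubQ: "finite A" if "A \<subseteq> Q" for A using that finite_Q by (rule finite_subset)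
  have d: "real d > 0" using d_pos by simp
  have tt: "t = real (card G) - real (card W)" by (simp add: t G_def W_def)
  have edges: "(\<Sum>y\<in>G. real (card (nb y \<inter> (P - W)))) = d * t"
    using sum_card_nb_Diff[OF WP] unfolding NW tt .
  have WPQ: "W \<subseteq> P \<union> Q" using WP by auto
  obtain U where U: "U \<subseteq> W" "\<psi> * card U \<le> card (G \<inter> Nb U)"
    "\<And>v. v \<in> W \<Longrightarrow> card (nb v \<inter> (G - Nb U)) < \<psi>" "\<And>v. v \<in> U \<Longrightarrow> nb v \<inter> G \<noteq> {}"
    by (rule greedy_cover[OF fin(1) WPQ fin(2) \<psi>(1)]) (rule that)
  have UP: "U \<subseteq> P" using U(1) WP by simp
  have NU: "Nb U \<subseteq> G" using Nb_mono[OF U(1)] NW by simp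
  have Ucard: "\<psi> * card U \<le> card G" using U(2) NU card_mono[OF fin(2), of "G \<inter> Nb U"] by simp
  have S1P: "S1 \<psi> U \<subseteq> P" by (auto simp: S1_def)
  have WS1: "W \<subseteq> S1 \<psi> U"
  proof
    fix u assume u: "u \<in> W"
    then have uP: "u \<in> P" using WP by auto
    have nu: "nb u \<subseteq> G" using u NW by (auto simp: Nb_def)
    have "nb u - Nb U = nb u \<inter> (G - Nb U)" using nu by blast
    with U(3)[OF u] have "d - \<psi> \<le> card (nb u \<inter> Nb U)" using card_nb_split[of u "Nb U"] uP by simp
    with uP show "u \<in> S1 \<psi> U" by (simp add: S1_def)
  qed
  have small: "card (T - W) \<le> 2 * t" if T: "T \<subseteq> S1 \<psi> U" for T
  proof -
    have TP: "T - W \<subseteq> P" using T S1P by auto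
    have "(d - \<psi>) * card (T - W) = (\<Sum>u\<in>T - W. d - \<psi>)" by simp
    also have "\<dots> \<le> (\<Sum>u\<in>T - W. real (card (nb u \<inter> G)))"
    proof (rule sum_mono)
      fix u assume u: "u \<in> T - W"
      then have "d - \<psi> \<le> card (nb u \<inter> Nb U)" using T by (auto simp: S1_def)
      also have "card (nb u \<inter> Nb U) \<le> card (nb u \<inter> G)" using NU fin by (intro card_mono) auto
      finally show "d - \<psi> \<le> real (card (nb u \<inter> G))" by simp
    qed
    also have "\<dots> = (\<Sum>y\<in>G. real (card (nb y \<inter> (T - W))))"
      using double_count[OF TP GQ] by (simp flip: of_nat_sum)
    also have "\<dots> \<le> (\<Sum>y\<in>G. real (card (nb y \<inter> (P - W))))"
      using TP finite_P by (intro sum_mono of_nat_mono card_mono) auto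
    also have "\<dots> = d * t" by (rule edges)
    finally have "(d - \<psi>) * card (T - W) \<le> d * t" .
    moreover have "(d / 2) * card (T - W) \<le> (d - \<psi>) * card (T - W)"
      using \<psi> by (intro mult_right_mono) auto
    ultimately have "d * card (T - W) \<le> d * (2 * t)" by simp
    then show ?thesis using d by simp
  qed
  have QG: "finite (Q - G)" "Q - G \<subseteq> P \<union> Q" using finite_Q by auto
  obtain V where V: "V \<subseteq> Q - G" "\<psi> * card V \<le> card (S1 \<psi> U \<inter> Nb V)"
    "\<And>v. v \<in> Q - G \<Longrightarrow> card (nb v \<inter> (S1 \<psi> U - Nb V)) < \<psi>"
    "\<And>v. v \<in> V \<Longrightarrow> nb v \<inter> S1 \<psi> U \<noteq> {}"
    by (rule greedy_cover[OF QG finsub[OF S1P] \<psi>(1)]) (rule that)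
  have VW: "Nb V \<inter> W = {}"
  proof (rule ccontr)
    assume "Nb V \<inter> W \<noteq> {}"
    then obtain v w where vw: "v \<in> V" "w \<in> nb v" "w \<in> W" by (auto simp: Nb_def)
    then have "v \<in> nb w" using nb_sym V(1) WP by blast
    then have "v \<in> G" using NW vw by (auto simp: Nb_def)
    then show False using vw V(1) by auto
  qed
  have "card (S1 \<psi> U \<inter> Nb V) \<le> card (S1 \<psi> U - W)"
    using VW finsub[OF S1P] by (intro card_mono) auto
  then have Vcard: "\<psi> * card V \<le> 2 * t" using V(2) small[OF subset_refl] by linarith
  define S where "S = cont_S \<psi> U V"
  define F where "F = cont_F \<psi> U V"
  have SS1: "S \<subseteq> S1 \<psi> U" "S \<subseteq> P" using S1P by (auto simp: S_def cont_S_def)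
  have WS: "W \<subseteq> S" using WS1 VW by (auto simp: S_def cont_S_def)
  have FG: "F \<subseteq> G"
  proof
    fix v assume "v \<in> F"
    then consider "v \<in> Nb U" | "v \<in> Q" "card (nb v \<inter> S) \<ge> \<psi>" by (auto simp: F_def cont_F_def S_def)
    then show "v \<in> G"
    proof cases
      case 1
      then show ?thesis using NU by auto
    next
      case 2
      then show ?thesis using V(3)[of v] by (auto simp: S_def cont_S_def)
    qed
  qed
  have FQ: "F \<subseteq> Q" and GFQ: "G - F \<subseteq> Q" using FG GQ by auto
  have lowF: "card (nb y \<inter> S) < \<psi>" if "y \<in> Q - F" for y
    using that by (auto simp: F_def cont_F_def S_def)
  have GF: "card (G - F) \<le> 2 * t"
  proof -
    have "(d / 2) * card (G - F) = (\<Sum>y\<in>G - F. d / 2)" by simp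
    also have "\<dots> \<le> (\<Sum>y\<in>G - F. real (card (nb y \<inter> (P - W))))"
    proof (rule sum_mono)
      fix y assume y: "y \<in> G - F"
      then have yQ: "y \<in> Q" using GQ by auto
      have "card (nb y \<inter> W) \<le> card (nb y \<inter> S)" using WS finsub[OF SS1(2)] by (intro card_mono) auto
      with lowF[of y] y yQ have "card (nb y \<inter> W) < \<psi>" by auto
      have "nb y - W = nb y \<inter> (P - W)" using nb_Q[OF yQ] by blast
      then show "d / 2 \<le> real (card (nb y \<inter> (P - W)))"
        using \<open>card (nb y \<inter> W) < \<psi>\<close> \<psi>(2) card_nb_split[of y W] yQ by simp
    qed
    also have "\<dots> \<le> (\<Sum>y\<in>G. real (card (nb y \<inter> (P - W))))"
      using fin by (intro sum_mono2) auto
    also have "\<dots> = d * t" by (rule edges)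
    finally show ?thesis using d by (simp add: field_simps)
  qed
  have SW: "card (S - W) \<le> 2 * t" by (rule small[OF SS1(1)])
  \<comment> \<open>Count the edges at \<open>S\<close>. At most \<open>d\<close> of them end in
    each vertex of \<open>F\<close>; the others number at most \<open>\<psi>\<close> for each vertex
    of \<open>G - F\<close> and of \<open>S - W\<close>, so at most \<open>4 * \<psi> * t\<close> in
    all.\<close>
  have "card S \<le> card F + 4 * \<psi> * t / d"
  proof -
    have split: "real d = real (card (nb u \<inter> F)) + real (card (nb u \<inter> (Q - F)))" if "u \<in> P" for u
    proof -
      have "nb u - F = nb u \<inter> (Q - F)" using nb_P[OF that] by blast
      then show ?thesis using card_nb_split[of u F] that by simp
    qed
    have "d * card S = (\<Sum>u\<in>S. real d)" by simp
    also have "\<dots> = (\<Sum>u\<in>S. real (card (nb u \<inter> F)) + real (card (nb u \<inter> (Q - F))))"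
      using split SS1(2) by (intro sum.cong) auto
    also have "\<dots> = (\<Sum>u\<in>S. real (card (nb u \<inter> F))) + (\<Sum>u\<in>S. real (card (nb u \<inter> (Q - F))))"
      by (rule sum.distrib)
    also have "(\<Sum>u\<in>S. real (card (nb u \<inter> F))) = (\<Sum>y\<in>F. real (card (nb y \<inter> S)))"
      using double_count[OF SS1(2) FQ] by (simp flip: of_nat_sum)
    also have "\<dots> \<le> (\<Sum>y\<in>F. real d)"
      using FQ by (intro sum_mono of_nat_mono card_nb_Int_le) auto
    also have "(\<Sum>u\<in>S. real (card (nb u \<inter> (Q - F))))
        = (\<Sum>u\<in>W. real (card (nb u \<inter> (Q - F)))) + (\<Sum>u\<in>S - W. real (card (nb u \<inter> (Q - F))))"
      using WS finsub[OF SS1(2)] by (simp add: sum.subset_diff add.commute)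
    also have "(\<Sum>u\<in>W. real (card (nb u \<inter> (Q - F)))) = (\<Sum>u\<in>W. real (card (nb u \<inter> (G - F))))"
    proof (rule sum.cong)
      fix u assume "u \<in> W"
      then have "nb u \<subseteq> G" using NW by (auto simp: Nb_def)
      then have "nb u \<inter> (Q - F) = nb u \<inter> (G - F)" using GQ by blast
      then show "real (card (nb u \<inter> (Q - F))) = real (card (nb u \<inter> (G - F)))" by simp
    qed simp
    also have "\<dots> = (\<Sum>y\<in>G - F. real (card (nb y \<inter> W)))"
      using double_count[OF WP GFQ] by (simp flip: of_nat_sum)
    also have "\<dots> \<le> (\<Sum>y\<in>G - F. \<psi>)"
    proof (rule sum_mono)
      fix y assume y: "y \<in> G - F"
      have "card (nb y \<inter> W) \<le> card (nb y \<inter> S)" using WS finsub[OF SS1(2)] by (intro card_mono) auto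
      with lowF[of y] y GQ show "card (nb y \<inter> W) \<le> \<psi>" by auto
    qed
    also have "(\<Sum>y\<in>G - F. \<psi>) \<le> \<psi> * (2 * t)" using GF \<psi> by simp
    also have "(\<Sum>u\<in>S - W. real (card (nb u \<inter> (Q - F)))) \<le> (\<Sum>u\<in>S - W. \<psi>)"
    proof (rule sum_mono)
      fix u assume u: "u \<in> S - W"
      then have uP: "u \<in> P" using SS1 by auto
      have "d - \<psi> \<le> card (nb u \<inter> Nb U)" using u SS1(1) by (auto simp: S1_def)
      also have "card (nb u \<inter> Nb U) \<le> card (nb u \<inter> F)"
        using finsubQ[OF FQ] by (intro card_mono) (auto simp: F_def cont_F_def)
      finally show "card (nb u \<inter> (Q - F)) \<le> \<psi>" using split[OF uP] by simp
    qed
    also have "(\<Sum>u\<in>S - W. \<psi>) \<le> \<psi> * (2 * t)" using SW \<psi> by simp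
    finally have "d * card S \<le> d * card F + 4 * \<psi> * t" by (simp add: algebra_simps)
    then show ?thesis using d by (simp add: field_simps)
  qed
  moreover have "conn (step ^^ 6) (U \<union> V \<union> X)" if X: "X \<subseteq> G" for X
  proof (rule conn_relpow_of_conn[OF refl_step sym_step _ lnk_subset_step2])
    show "conn lnk W" unfolding W_def by (rule conn_cl[OF C])
    \<comment> \<open>Because \<open>d - \<psi> > 0\<close>, each vertex of
      \<open>S1 \<psi> U\<close> shares a neighbour with \<open>U\<close>. So \<open>W\<close> lies
      within distance 2 of \<open>U\<close>, and a vertex of \<open>V\<close>, which has a neighbour
      in \<open>S1 \<psi> U\<close>, within distance 3.\<close>
    have dom: "\<exists>u\<in>U. (s, u) \<in> step ^^ 2" if s: "s \<in> S1 \<psi> U" for s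
    proof -
      have "0 < real d - \<psi>" using \<psi> d by linarith
      also have "\<dots> \<le> card (nb s \<inter> Nb U)" using s by (simp add: S1_def)
      finally have "nb s \<inter> Nb U \<noteq> {}" by (metis card.empty of_nat_0 less_irrefl)
      then obtain q where "q \<in> nb s" "q \<in> Nb U" by auto
      then obtain u where "u \<in> U" "q \<in> nb u" by (auto simp: Nb_def)
      then have "(s, u) \<in> lnk" using s UP \<open>q \<in> nb s\<close> by (auto simp: lnk_def S1_def)
      then show ?thesis using \<open>u \<in> U\<close> lnk_subset_step2 by blast
    qed
    show "\<exists>y\<in>U \<union> V \<union> X. (w, y) \<in> step ^^ 2" if "w \<in> W" for w
      using dom[of w] WS1 that by blast
    show "\<exists>w\<in>W. (y, w) \<in> step ^^ 3" if y: "y \<in> U \<union> V \<union> X" for y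
    proof -
      consider "y \<in> U" | "y \<in> V" | "y \<in> X" using y by blast
      then show ?thesis
      proof cases
        case 1
        then have "(y, y) \<in> step ^^ 3" using refl_relpow[OF refl_step, of 3] by (auto simp: refl_on_def)
        then show ?thesis using 1 U(1) by blast
      next
        case 2
        then obtain s where s: "s \<in> nb y" "s \<in> S1 \<psi> U" using V(4) by blast
        then have "(y, s) \<in> step" using 2 V(1) by (auto simp: step_def)
        moreover obtain u where "u \<in> U" "(s, u) \<in> step ^^ 2" using dom s by blast
        ultimately have "(y, u) \<in> step ^^ Suc 2" using relpow_Suc_I2 by fast
        then show ?thesis using \<open>u \<in> U\<close> U(1) by (auto simp: numeral_3_eq_3 numeral_2_eq_2)
      next
        case 3
        then have "y \<in> Nb W" "y \<in> Q" using X NW GQ by auto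
        then obtain w where "w \<in> W" "y \<in> nb w" by (auto simp: Nb_def)
        then have "(y, w) \<in> step" using \<open>y \<in> Q\<close> WP nb_sym by (auto simp: step_def)
        then have "(y, w) \<in> step ^^ 3" using relpow_mono_refl[OF refl_step, of 1 3] by simp
        then show ?thesis using \<open>w \<in> W\<close> by blast
      qed
    qed
  qed
  ultimately show ?thesis
    using that[of U V] UP V(1) Ucard Vcard FG WS by (simp add: S_def F_def G_def W_def)
qed

definition fam :: "nat \<Rightarrow> nat \<Rightarrow> 'a set set" where
  "fam a g = {C. C \<subseteq> P \<and> conn lnk C \<and> card (cl C) = a \<and> card (Nb C) = g}"

lemma real_power_le_powr:
  assumes "D \<ge> 1" "s \<ge> 0"
  shows "D ^ nat \<lfloor>s\<rfloor> \<le> (D :: real) powr s"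
proof -
  have "D ^ nat \<lfloor>s\<rfloor> = D powr real (nat \<lfloor>s\<rfloor>)" using assms by (intro powr_realpow[symmetric]) auto
  also have "\<dots> \<le> D powr s" using assms by (intro powr_mono) auto
  finally show ?thesis .
qed

text \<open>Either \<open>cont_F\<close>, and with it the container \<open>cont_S\<close>, is well below \<open>g\<close> in size, or the part of
  \<open>Nb C\<close> that \<open>cont_F\<close> misses is so small that it can be listed, and \<open>Nb C\<close> determines \<open>cl C\<close>.\<close>

lemma fam_covered [consumes 4, case_names A B]:
  fixes \<gamma> \<psi> :: real and a g :: nat
  defines "t \<equiv> real g - real a"
  assumes \<psi>: "0 < \<psi>" "8 * \<psi> \<le> \<gamma> * d" "\<gamma> \<le> 1" and C: "C \<in> fam a g"
  obtains (A) Y where "Y \<subseteq> P \<union> Q" "conn (step ^^ 6) Y" "card Y \<le> 3 * g / \<psi>"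
      "card (cont_S \<psi> (Y \<inter> P) (Y \<inter> Q)) \<le> g - \<gamma> * t / 2" "C \<subseteq> cont_S \<psi> (Y \<inter> P) (Y \<inter> Q)"
  | (B) Y V where "Y \<subseteq> P \<union> Q" "conn (step ^^ 6) Y" "card Y \<le> 3 * g / \<psi> + \<gamma> * t" "V \<subseteq> Y"
      "card {x \<in> P. nb x \<subseteq> cont_F \<psi> (Y \<inter> P) V \<union> (Y \<inter> Q - V)} = a"
      "C \<subseteq> {x \<in> P. nb x \<subseteq> cont_F \<psi> (Y \<inter> P) V \<union> (Y \<inter> Q - V)}"
proof -
  have Cf: "C \<subseteq> P" "conn lnk C" "card (cl C) = a" "card (Nb C) = g" using C by (auto simp: fam_def)
  have d: "real d > 0" using d_pos by simp
  have "\<gamma> * d \<le> 1 * real d" using \<psi>(3) d by (intro mult_right_mono) auto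
  then have \<psi>d: "\<psi> \<le> real d / 2" using \<psi>(1,2) by simp
  have t: "t = real (card (Nb C)) - real (card (cl C))" using Cf by (simp add: t_def)
  have "card (cl C) \<le> card (Nb (cl C))" by (rule card_le_card_Nb[OF cl_subset])
  then have t0: "t \<ge> 0" "t \<le> g" using t Cf by (auto simp: Nb_cl)
  obtain U V where UV: "U \<subseteq> P" "V \<subseteq> Q - Nb C" "\<psi> * card U \<le> card (Nb C)" "\<psi> * card V \<le> 2 * t"
    "cont_F \<psi> U V \<subseteq> Nb C" "cl C \<subseteq> cont_S \<psi> U V"
    "card (cont_S \<psi> U V) \<le> card (cont_F \<psi> U V) + 4 * \<psi> * t / d"
    "\<And>X. X \<subseteq> Nb C \<Longrightarrow> conn (step ^^ 6) (U \<union> V \<union> X)"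
    by (rule container[OF Cf(1,2) \<psi>(1) \<psi>d t]) (rule that)
  have NQ: "Nb C \<subseteq> Q" by (rule Nb_subset[OF Cf(1)])
  have fin: "finite U" "finite V" "finite (Nb C)"
    using UV(1,2) NQ finite_P finite_Q by (auto intro: finite_subset)
  have "\<psi> * (real (card U) + real (card V)) \<le> 3 * g"
    using UV(3,4) t0 Cf(4) by (simp add: algebra_simps)
  then have UVcard: "real (card U) + real (card V) \<le> 3 * g / \<psi>"
    using \<psi>(1) by (simp add: field_simps)
  show ?thesis
  proof (cases "real (card (cont_F \<psi> U V)) \<le> g - \<gamma> * t")
    case True
    \<comment> \<open>It is enough to list the connected set \<open>U \<union> V\<close>, since
      \<open>U\<close> and \<open>V\<close> are its parts in \<open>P\<close> and in
      \<open>Q\<close>.\<close>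
    have YP: "(U \<union> V) \<inter> P = U" "(U \<union> V) \<inter> Q = V" using UV(1,2) PQ_disjoint by auto
    \<comment> \<open>The surplus of the container uses up at most half of the deficit
      \<open>\<gamma> * t\<close> of \<open>cont_F\<close>.\<close>
    have "4 * \<psi> * t / d \<le> \<gamma> * t / 2"
    proof -
      have "8 * \<psi> * t \<le> \<gamma> * d * t" using \<psi>(2) t0 by (intro mult_right_mono) auto
      then show ?thesis using d by (simp add: field_simps)
    qed
    then have "card (cont_S \<psi> U V) \<le> g - \<gamma> * t / 2" using UV(7) True by linarith
    moreover have "card (U \<union> V) \<le> 3 * g / \<psi>"
      using card_Un_le[of U V] UVcard by linarith
    moreover have "conn (step ^^ 6) (U \<union> V)" using UV(8)[of "{}"] by simp
    moreover have "U \<union> V \<subseteq> P \<union> Q" "C \<subseteq> cont_S \<psi> U V"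
      using UV(1,2,6) subset_cl[OF Cf(1)] by auto
    ultimately show ?thesis by (intro A[of "U \<union> V"]) (simp_all add: YP)
  next
    case False
    define X where "X = Nb C - cont_F \<psi> U V"
    have finF: "finite (cont_F \<psi> U V)" using UV(5) fin(3) by (rule finite_subset)
    have "real (card X) = real g - real (card (cont_F \<psi> U V))"
      unfolding X_def using card_mono[OF fin(3) UV(5)] Cf(4)
      by (simp add: card_Diff_subset[OF finF UV(5)])
    then have Xcard: "real (card X) \<le> \<gamma> * t" using False by simp
    have XN: "X \<subseteq> Nb C" by (auto simp: X_def)
    \<comment> \<open>\<open>V\<close> and \<open>X\<close> both lie in \<open>Q\<close>, so the
      listed set does not determine \<open>V\<close>. It is recorded as a subset, which is the
      origin of the factor 2 in \<open>2 * D\<close>.\<close>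
    have YP: "(U \<union> V \<union> X) \<inter> P = U" "(U \<union> V \<union> X) \<inter> Q - V = X"
      using UV(1,2) PQ_disjoint XN NQ by auto
    have FX: "cont_F \<psi> U V \<union> X = Nb C" using UV(5) by (auto simp: X_def)
    have clC: "{x \<in> P. nb x \<subseteq> cont_F \<psi> U V \<union> X} = cl C" unfolding FX cl_def ..
    have "card (U \<union> V \<union> X) \<le> card U + card V + card X"
      using card_Un_le[of U V] card_Un_le[of "U \<union> V" X] by linarith
    then have "card (U \<union> V \<union> X) \<le> 3 * g / \<psi> + \<gamma> * t" using UVcard Xcard by linarith
    moreover have "U \<union> V \<union> X \<subseteq> P \<union> Q" using UV(1,2) XN NQ by auto
    moreover have "V \<subseteq> U \<union> V \<union> X" by auto
    ultimately show ?thesis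
      using UV(8)[OF XN] subset_cl[OF Cf(1)] Cf(3)
      by (intro B[of "U \<union> V \<union> X" V]) (simp_all only: YP clC)
  qed
qed

text \<open>One summand for each kind of container: the number of descriptions times the total
  weight of the subsets of one container. A container with \<open>n\<close> elements contributes
  \<open>(1 + lam) powr (n - g)\<close>, where \<open>n\<close> is at most
  \<open>g - \<gamma> * t / 2\<close> for the first kind and equal to \<open>a\<close> for the
  second.\<close>

lemma container_sum:
  fixes lam \<gamma> \<psi> :: real and a g :: nat
  defines "t \<equiv> real g - real a" and "D \<equiv> real (Suc d) ^ 12"
  assumes lam: "lam > 0" and \<psi>: "0 < \<psi>" "8 * \<psi> \<le> \<gamma> * d" "\<gamma> \<le> 1" and t0: "t \<ge> 0"
  shows "(\<Sum>C\<in>fam a g. lam ^ card C / (1 + lam) ^ g)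
    \<le> card (P \<union> Q) * (D powr (3 * g / \<psi>) * (1 + lam) powr (- (\<gamma> * t / 2))
        + (2 * D) powr (3 * g / \<psi> + \<gamma> * t) * (1 + lam) powr (- t))"
proof -
  have d: "real d > 0" using d_pos by simp
  have \<gamma>: "\<gamma> > 0"
  proof (rule ccontr)
    assume "\<not> \<gamma> > 0"
    then have "\<gamma> * d \<le> 0" by (simp add: mult_nonpos_nonneg)
    then show False using \<psi> by linarith
  qed
  have D1: "D \<ge> 1" by (simp add: D_def)
  define Y where "Y s = {Y. Y \<subseteq> P \<union> Q \<and> conn (step ^^ 6) Y \<and> card Y \<le> nat \<lfloor>s\<rfloor>}" for s :: real
  have finY: "finite (Y s)" for s
    by (rule finite_subset[of _ "Pow (P \<union> Q)"]) (auto simp: Y_def finite_P finite_Q)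
  have Yfin: "finite Z" if "Z \<in> Y s" for Z s
    using that finite_P finite_Q by (auto simp: Y_def dest: finite_subset)
  have cardY: "real (card (Y s)) \<le> card (P \<union> Q) * D ^ nat \<lfloor>s\<rfloor>" for s
  proof -
    have "card (Y s) \<le> card (P \<union> Q) * (Suc d ^ 6) ^ (2 * nat \<lfloor>s\<rfloor>)"
      unfolding Y_def by (rule card_conn_step_le)
    then have "real (card (Y s)) \<le> real (card (P \<union> Q) * (Suc d ^ 6) ^ (2 * nat \<lfloor>s\<rfloor>))"
      by (rule of_nat_mono)
    then show ?thesis by (simp add: D_def power_mult flip: power_mult)
  qed
  have YI: "Z \<in> Y s" if "Z \<subseteq> P \<union> Q" "conn (step ^^ 6) Z" "real (card Z) \<le> s" for Z s
    using that by (auto simp: Y_def le_nat_floor)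
  let ?w = "\<lambda>C. lam ^ card C / (1 + lam) ^ g"
  have sumPow: "sum ?w (Pow K) = (1 + lam) powr (real (card K) - g)" if "finite K" for K :: "'a set"
  proof -
    have "sum ?w (Pow K) = (1 + lam) ^ card K / (1 + lam) ^ g"
      using sum_Pow_power[OF that, of lam] by (simp flip: sum_divide_distrib)
    then show ?thesis using lam by (simp add: powr_diff powr_realpow)
  qed
  define sA where "sA = 3 * g / \<psi>"
  define sB where "sB = 3 * g / \<psi> + \<gamma> * t"
  have s0: "sA \<ge> 0" "sB \<ge> 0" using \<psi> \<gamma> t0 by (auto simp: sA_def sB_def)
  define S where "S Z = cont_S \<psi> (Z \<inter> P) (Z \<inter> Q)" for Z
  define T where "T p = (case p of (Z, V) \<Rightarrow> {x \<in> P. nb x \<subseteq> cont_F \<psi> (Z \<inter> P) V \<union> (Z \<inter> Q - V)})" for p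
  have finS: "finite (S Z)" for Z
    by (rule finite_subset[OF _ finite_P]) (auto simp: S_def cont_S_def S1_def)
  have finT: "finite (T p)" for p
    by (rule finite_subset[OF _ finite_P]) (auto simp: T_def split: prod.splits)
  define KA where "KA = {Z \<in> Y sA. real (card (S Z)) \<le> g - \<gamma> * t / 2}"
  define KB where "KB = {p \<in> Sigma (Y sB) Pow. card (T p) = a}"
  have finSig: "finite (Sigma (Y sB) Pow)"
    using finY Yfin by (intro finite_SigmaI) auto
  have finK: "finite KA" "finite KB" using finY finSig by (auto simp: KA_def KB_def)
  define I where "I = Inl ` KA \<union> Inr ` KB"
  define W where "W i = (case i of Inl Z \<Rightarrow> Pow (S Z) | Inr p \<Rightarrow> Pow (T p))" for i
  have cover: "fam a g \<subseteq> (\<Union>i\<in>I. W i)"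
  proof
    fix C assume C: "C \<in> fam a g"
    show "C \<in> (\<Union>i\<in>I. W i)"
      using \<psi> C
    proof (cases rule: fam_covered)
      case (A Z)
      then have "Z \<in> KA" using YI by (auto simp: KA_def S_def sA_def t_def)
      moreover have "C \<in> W (Inl Z)" using A by (simp add: W_def S_def)
      ultimately show ?thesis unfolding I_def by blast
    next
      case (B Z V)
      then have "(Z, V) \<in> KB" using YI by (auto simp: KB_def T_def sB_def t_def)
      moreover have "C \<in> W (Inr (Z, V))" using B by (simp add: W_def T_def)
      ultimately show ?thesis unfolding I_def by blast
    qed
  qed
  have "sum ?w (fam a g) \<le> (\<Sum>i\<in>I. sum ?w (W i))"
    using finK finS finT lam cover
    by (intro sum_le_sum_UN) (auto simp: I_def W_def split: sum.splits)
  also have "\<dots> = (\<Sum>Z\<in>KA. sum ?w (Pow (S Z))) + (\<Sum>p\<in>KB. sum ?w (Pow (T p)))"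
    unfolding I_def using finK
    by (subst sum.union_disjoint) (auto simp: sum.reindex W_def)
  also have "(\<Sum>Z\<in>KA. sum ?w (Pow (S Z))) \<le> (\<Sum>Z\<in>KA. (1 + lam) powr (- (\<gamma> * t / 2)))"
    using lam by (intro sum_mono) (auto simp: sumPow finS KA_def intro!: powr_mono)
  also have "\<dots> \<le> card (P \<union> Q) * D powr sA * (1 + lam) powr (- (\<gamma> * t / 2))"
  proof -
    have "card KA \<le> card (Y sA)" using finY by (intro card_mono) (auto simp: KA_def)
    then have "real (card KA) \<le> card (P \<union> Q) * D ^ nat \<lfloor>sA\<rfloor>" using cardY[of sA] by linarith
    also have "\<dots> \<le> card (P \<union> Q) * D powr sA"
      using real_power_le_powr[OF D1 s0(1)] by (intro mult_left_mono) auto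
    finally show ?thesis using lam by (simp add: mult_right_mono)
  qed
  also have "(\<Sum>p\<in>KB. sum ?w (Pow (T p))) = (\<Sum>p\<in>KB. (1 + lam) powr (- t))"
    by (intro sum.cong) (auto simp: sumPow finT KB_def t_def)
  also have "\<dots> \<le> card (P \<union> Q) * (2 * D) powr sB * (1 + lam) powr (- t)"
  proof -
    have "card KB \<le> card (Sigma (Y sB) Pow)" using finSig by (intro card_mono) (auto simp: KB_def)
    also have "\<dots> = (\<Sum>Z\<in>Y sB. card (Pow Z))"
      using finY Yfin by (intro card_SigmaI) auto
    also have "\<dots> \<le> (\<Sum>Z\<in>Y sB. 2 ^ nat \<lfloor>sB\<rfloor>)"
    proof (rule sum_mono)
      fix Z assume Z: "Z \<in> Y sB"
      then have "card (Pow Z) = 2 ^ card Z" by (intro card_Pow Yfin)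
      also have "\<dots> \<le> 2 ^ nat \<lfloor>sB\<rfloor>" using Z by (intro power_increasing) (auto simp: Y_def)
      finally show "card (Pow Z) \<le> 2 ^ nat \<lfloor>sB\<rfloor>" .
    qed
    finally have "card KB \<le> card (Y sB) * 2 ^ nat \<lfloor>sB\<rfloor>" by simp
    then have "real (card KB) \<le> real (card (Y sB) * 2 ^ nat \<lfloor>sB\<rfloor>)" by (rule of_nat_mono)
    also have "\<dots> = real (card (Y sB)) * 2 ^ nat \<lfloor>sB\<rfloor>" by simp
    also have "\<dots> \<le> card (P \<union> Q) * D ^ nat \<lfloor>sB\<rfloor> * 2 ^ nat \<lfloor>sB\<rfloor>"
      by (intro mult_right_mono cardY) auto
    also have "\<dots> = card (P \<union> Q) * (2 * D) ^ nat \<lfloor>sB\<rfloor>" by (simp add: power_mult_distrib)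
    also have "\<dots> \<le> card (P \<union> Q) * (2 * D) powr sB"
      using real_power_le_powr[of "2 * D" sB] D1 s0(2) by (intro mult_left_mono) auto
    finally show ?thesis using lam by (simp add: mult_right_mono)
  qed
  finally show ?thesis by (simp add: algebra_simps sA_def sB_def)
qed

end

section \<open>The hard-core measure\<close>

locale hard_core_bipartite = regular_bipartite +
  fixes lam :: real
  assumes lam_pos: "lam > 0"
begin

definition Ind :: "'a set set" where
  "Ind = {I. I \<subseteq> P \<union> Q \<and> (\<forall>x\<in>I. nb x \<inter> I = {})}"

text \<open>Expectation as a quotient of finite sums, so that no measure theory enters the
  estimates; \<open>prob_cube\<close> connects it with \<open>hard_core\<close>.\<close>

definition EI :: "('a set \<Rightarrow> real) \<Rightarrow> real" where
  "EI h = (\<Sum>I\<in>Ind. h I * lam ^ card I) / (\<Sum>I\<in>Ind. lam ^ card I)"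

definition w :: "'a set \<Rightarrow> real" where
  "w C = lam ^ card C / (1 + lam) ^ card (Nb C)"

lemma finite_Ind: "finite Ind"
  by (rule finite_subset[of _ "Pow (P \<union> Q)"]) (auto simp: Ind_def finite_P finite_Q)

text \<open>Once the part \<open>A\<close> in \<open>P\<close> is fixed, the part in
  \<open>Q\<close> is an arbitrary subset of \<open>Q - Nb A\<close>.\<close>

lemma sum_Ind:
  fixes g :: "'a set \<Rightarrow> 'a set \<Rightarrow> real"
  shows "(\<Sum>I\<in>Ind. g (I \<inter> P) (I \<inter> Q)) = (\<Sum>A\<in>Pow P. \<Sum>B\<in>Pow (Q - Nb A). g A B)"
proof -
  have "(\<Sum>A\<in>Pow P. \<Sum>B\<in>Pow (Q - Nb A). g A B)
      = (\<Sum>(A, B)\<in>Sigma (Pow P) (\<lambda>A. Pow (Q - Nb A)). g A B)"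
    using finite_P finite_Q by (intro sum.Sigma) auto
  also have "\<dots> = (\<Sum>I\<in>Ind. g (I \<inter> P) (I \<inter> Q))"
  proof (rule sum.reindex_bij_witness[where i = "\<lambda>I. (I \<inter> P, I \<inter> Q)" and j = "\<lambda>(A, B). A \<union> B"])
    fix I assume I: "I \<in> Ind"
    then have IPQ: "I \<subseteq> P \<union> Q" by (simp add: Ind_def)
    then show "(case (I \<inter> P, I \<inter> Q) of (A, B) \<Rightarrow> A \<union> B) = I" by auto
    have "y \<notin> Nb (I \<inter> P)" if "y \<in> I" for y
      using that I by (auto simp: Ind_def Nb_def)
    then show "(I \<inter> P, I \<inter> Q) \<in> Sigma (Pow P) (\<lambda>A. Pow (Q - Nb A))" by auto
  next
    fix p assume "p \<in> Sigma (Pow P) (\<lambda>A. Pow (Q - Nb A))"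
    then obtain A B where p: "p = (A, B)" "A \<subseteq> P" "B \<subseteq> Q - Nb A" by auto
    have AB: "(A \<union> B) \<inter> P = A" "(A \<union> B) \<inter> Q = B" using p PQ_disjoint by auto
    then show "((case p of (A, B) \<Rightarrow> A \<union> B) \<inter> P, (case p of (A, B) \<Rightarrow> A \<union> B) \<inter> Q) = p"
      by (simp add: p(1))
    have 1: "nb x \<inter> (A \<union> B) = {}" if "x \<in> A" for x
    proof -
      have "nb x \<subseteq> Q" "nb x \<subseteq> Nb A" using that p nb_P by (auto simp: Nb_def)
      then show ?thesis using p PQ_disjoint by blast
    qed
    have 2: "nb y \<inter> (A \<union> B) = {}" if y: "y \<in> B" for y
    proof -
      have yQ: "y \<in> Q" using y p by auto
      have "x \<notin> A" if "x \<in> nb y" for x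
      proof
        assume "x \<in> A"
        then have "y \<in> nb x" using nb_sym[of x y] p yQ that by auto
        then show False using \<open>x \<in> A\<close> y p by (auto simp: Nb_def)
      qed
      then show ?thesis using nb_Q[OF yQ] p PQ_disjoint by blast
    qed
    show "(case p of (A, B) \<Rightarrow> A \<union> B) \<in> Ind"
      using 1 2 p by (auto simp: Ind_def)
    show "g ((case p of (A, B) \<Rightarrow> A \<union> B) \<inter> P) ((case p of (A, B) \<Rightarrow> A \<union> B) \<inter> Q)
        = (case p of (A, B) \<Rightarrow> g A B)"
      using AB by (simp add: p(1))
  qed
  finally show ?thesis ..
qed

lemma card_Ind:
  assumes "I \<in> Ind"
  shows "card I = card (I \<inter> P) + card (I \<inter> Q)"
proof -
  have "I = (I \<inter> P) \<union> (I \<inter> Q)" using assms by (auto simp: Ind_def)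
  moreover have "card ((I \<inter> P) \<union> (I \<inter> Q)) = card (I \<inter> P) + card (I \<inter> Q)"
    using finite_P finite_Q PQ_disjoint by (intro card_Un_disjoint) auto
  ultimately show ?thesis by simp
qed

text \<open>A separate fugacity on \<open>Q\<close> is needed in \<open>EI_unbalanced_le\<close>,
  where it is \<open>lam / 2\<close>; the choice \<open>\<kappa> = lam\<close> gives the marginal on
  \<open>P\<close>.\<close>

lemma sum_two_fugacities:
  "(\<Sum>I\<in>Ind. h (I \<inter> P) * lam ^ card (I \<inter> P) * (\<kappa> :: real) ^ card (I \<inter> Q))
    = (\<Sum>A\<in>Pow P. h A * lam ^ card A * (1 + \<kappa>) ^ (card Q - card (Nb A)))"
proof -
  have "(\<Sum>I\<in>Ind. h (I \<inter> P) * lam ^ card (I \<inter> P) * \<kappa> ^ card (I \<inter> Q))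
      = (\<Sum>A\<in>Pow P. \<Sum>B\<in>Pow (Q - Nb A). h A * lam ^ card A * \<kappa> ^ card B)"
    by (rule sum_Ind)
  also have "\<dots> = (\<Sum>A\<in>Pow P. h A * lam ^ card A * (1 + \<kappa>) ^ (card Q - card (Nb A)))"
  proof (rule sum.cong)
    fix A assume "A \<in> Pow P"
    then have A: "Nb A \<subseteq> Q" using Nb_subset by auto
    have "(\<Sum>B\<in>Pow (Q - Nb A). \<kappa> ^ card B) = (1 + \<kappa>) ^ card (Q - Nb A)"
      using finite_Q by (intro sum_Pow_power) auto
    also have "card (Q - Nb A) = card Q - card (Nb A)"
      using A finite_Q finite_subset by (intro card_Diff_subset) auto
    finally show "(\<Sum>B\<in>Pow (Q - Nb A). h A * lam ^ card A * \<kappa> ^ card B)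
        = h A * lam ^ card A * (1 + \<kappa>) ^ (card Q - card (Nb A))"
      by (simp flip: sum_distrib_left)
  qed simp
  finally show ?thesis .
qed

text \<open>Unnormalised marginal weight of the part in \<open>P\<close>; for
  \<open>A \<subseteq> P\<close> it is \<open>w A\<close> times the constant
  \<open>(1 + lam) ^ card Q\<close>.\<close>

definition wt :: "'a set \<Rightarrow> real" where
  "wt A = lam ^ card A * (1 + lam) ^ (card Q - card (Nb A))"

lemma sum_Ind_P: "(\<Sum>I\<in>Ind. h (I \<inter> P) * lam ^ card I) = (\<Sum>A\<in>Pow P. h A * wt A)"
proof -
  have "(\<Sum>I\<in>Ind. h (I \<inter> P) * lam ^ card I)
      = (\<Sum>I\<in>Ind. h (I \<inter> P) * lam ^ card (I \<inter> P) * lam ^ card (I \<inter> Q))"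
    by (intro sum.cong) (auto simp: card_Ind power_add)
  also have "\<dots> = (\<Sum>A\<in>Pow P. h A * wt A)"
    unfolding sum_two_fugacities by (simp add: wt_def mult.assoc)
  finally show ?thesis .
qed

lemma empty_Ind: "{} \<in> Ind"
  by (simp add: Ind_def)

lemma Z_pos: "(\<Sum>I\<in>Ind. lam ^ card I) > 0"
  using finite_Ind empty_Ind lam_pos by (intro sum_pos) auto

lemma EI_mono: "(\<And>I. I \<in> Ind \<Longrightarrow> h I \<le> k I) \<Longrightarrow> EI h \<le> EI k"
  unfolding EI_def using Z_pos lam_pos by (intro divide_right_mono sum_mono mult_right_mono) auto

lemma EI_cong: "(\<And>I. I \<in> Ind \<Longrightarrow> h I = k I) \<Longrightarrow> EI h = EI k"
  unfolding EI_def by (intro arg_cong2[where f = "(/)"] sum.cong) auto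

lemma EI_add: "EI (\<lambda>I. h I + k I) = EI h + EI k"
  by (simp add: EI_def sum.distrib add_divide_distrib algebra_simps)

lemma EI_diff: "EI (\<lambda>I. h I - k I) = EI h - EI k"
  by (simp add: EI_def sum_subtractf diff_divide_distrib algebra_simps)

lemma EI_cmult: "EI (\<lambda>I. c * h I) = c * EI h"
  by (simp add: EI_def sum_distrib_left algebra_simps)

lemma EI_sum: "EI (\<lambda>I. \<Sum>i\<in>S. h i I) = (\<Sum>i\<in>S. EI (h i))"
proof -
  have "(\<Sum>I\<in>Ind. (\<Sum>i\<in>S. h i I) * lam ^ card I) = (\<Sum>i\<in>S. \<Sum>I\<in>Ind. h i I * lam ^ card I)"
    by (simp add: sum_distrib_right sum.swap[of _ S Ind])
  then show ?thesis by (simp add: EI_def sum_divide_distrib)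
qed

lemma EI_const: "EI (\<lambda>I. c) = c"
  using Z_pos by (simp add: EI_def flip: sum_distrib_left)

lemma EI_le_1: "(\<And>I. I \<in> Ind \<Longrightarrow> h I \<le> 1) \<Longrightarrow> EI h \<le> 1"
  using EI_mono[of h "\<lambda>_. 1"] EI_const[of 1] by simp

lemma w_pos: "w C > 0"
  using lam_pos by (simp add: w_def)

lemma Nb_disjoint_imp:
  assumes "A \<subseteq> P" "C \<subseteq> P" "Nb A \<inter> Nb C = {}"
  shows "A \<inter> C = {}" "\<And>x y. x \<in> C \<Longrightarrow> y \<in> A \<Longrightarrow> (x, y) \<notin> lnk"
proof -
  have "nb x \<noteq> {}" if "x \<in> P" for x using card_nb[of x] d_pos that by auto
  then show "A \<inter> C = {}" using assms by (fastforce simp: Nb_def)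
  show "(x, y) \<notin> lnk" if "x \<in> C" "y \<in> A" for x y
    using that assms by (auto simp: Nb_def lnk_def)
qed

lemma Nb_disjoint_comp:
  assumes "A \<subseteq> P" "C \<in> comps lnk A"
  shows "Nb (A - C) \<inter> Nb C = {}"
proof (rule ccontr)
  assume "Nb (A - C) \<inter> Nb C \<noteq> {}"
  then obtain x y z where "x \<in> A - C" "y \<in> C" "z \<in> nb x" "z \<in> nb y" by (auto simp: Nb_def)
  moreover have "x \<in> P" "y \<in> P" using calculation assms(1) compsD(1)[OF assms(2)] by auto
  ultimately have "(y, x) \<in> lnk" by (auto simp: lnk_def)
  with comps_no_edge[OF sym_lnk assms(2) \<open>y \<in> C\<close> \<open>x \<in> A - C\<close>] show False by blast
qed

lemma wt_Un:
  assumes "A \<subseteq> P" "C \<subseteq> P" "Nb A \<inter> Nb C = {}"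
  shows "wt (A \<union> C) = w C * wt A"
proof -
  have fin: "finite A" "finite C" using assms(1,2) finite_P by (auto intro: finite_subset)
  have 1: "card (A \<union> C) = card A + card C"
    using fin Nb_disjoint_imp(1)[OF assms] by (intro card_Un_disjoint) auto
  have 2: "card (Nb (A \<union> C)) = card (Nb A) + card (Nb C)"
    unfolding Nb_Un using assms finite_Nb by (intro card_Un_disjoint) auto
  \<comment> \<open>Ensures that the natural subtraction in the exponent of \<open>wt\<close> does
    not truncate.\<close>
  have "card (Nb (A \<union> C)) \<le> card Q"
    using Nb_subset[of "A \<union> C"] assms finite_Q by (intro card_mono) auto
  then have "card Q - card (Nb A) = (card Q - card (Nb (A \<union> C))) + card (Nb C)" using 2 by simp
  then show ?thesis using lam_pos by (simp add: wt_def w_def 1 power_add)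
qed

text \<open>Deleting the component \<open>C\<close> of the \<open>P\<close>-part of an independent set frees exactly the
  vertices of \<open>Nb C\<close> on the other side.\<close>

lemma EI_comp:
  assumes "C \<subseteq> P" "conn lnk C"
  shows "EI (\<lambda>I. of_bool (C \<in> comps lnk (I \<inter> P)) * h (I \<inter> P))
    = w C * EI (\<lambda>I. of_bool (Nb (I \<inter> P) \<inter> Nb C = {}) * h (I \<inter> P \<union> C))"
proof -
  have "(\<Sum>A\<in>Pow P. of_bool (C \<in> comps lnk A) * h A * wt A)
      = (\<Sum>A\<in>{A \<in> Pow P. C \<in> comps lnk A}. h A * wt A)"
    using finite_P by (subst sum.inter_filter) (auto intro!: sum.cong)
  also have "\<dots> = (\<Sum>A\<in>{A \<in> Pow P. Nb A \<inter> Nb C = {}}. h (A \<union> C) * (w C * wt A))"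
  proof (rule sum.reindex_bij_witness[where i = "\<lambda>A. A \<union> C" and j = "\<lambda>A. A - C"])
    fix A assume A: "A \<in> {A \<in> Pow P. C \<in> comps lnk A}"
    then have AP: "A \<subseteq> P" and CA: "C \<in> comps lnk A" by auto
    have "C \<subseteq> A" by (rule compsD(1)[OF CA])
    then show eq: "A - C \<union> C = A" by blast
    have dis: "Nb (A - C) \<inter> Nb C = {}" by (rule Nb_disjoint_comp[OF AP CA])
    then show "A - C \<in> {A \<in> Pow P. Nb A \<inter> Nb C = {}}" using AP by auto
    have "wt (A - C \<union> C) = w C * wt (A - C)" using AP assms(1) dis by (intro wt_Un) auto
    then show "h (A - C \<union> C) * (w C * wt (A - C)) = h A * wt A" unfolding eq by simp
  next
    fix A assume "A \<in> {A \<in> Pow P. Nb A \<inter> Nb C = {}}"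
    then have AP: "A \<subseteq> P" and dis: "Nb A \<inter> Nb C = {}" by auto
    note imp = Nb_disjoint_imp[OF AP assms(1) dis]
    show "A \<union> C - C = A" using imp(1) by blast
    have "comps lnk (A \<union> C) = insert C (comps lnk A)"
      using imp finite_subset[OF AP finite_P] assms(2) by (intro comps_insert(1) sym_lnk)
    then show "A \<union> C \<in> {A \<in> Pow P. C \<in> comps lnk A}" using AP assms(1) by auto
  qed
  also have "\<dots> = (\<Sum>A\<in>Pow P. of_bool (Nb A \<inter> Nb C = {}) * h (A \<union> C) * (w C * wt A))"
    using finite_P by (subst sum.inter_filter) (auto intro!: sum.cong)
  also have "\<dots> = w C * (\<Sum>A\<in>Pow P. of_bool (Nb A \<inter> Nb C = {}) * h (A \<union> C) * wt A)"
    by (simp add: sum_distrib_left algebra_simps)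
  finally show ?thesis
    using sum_Ind_P[of "\<lambda>A. of_bool (C \<in> comps lnk A) * h A"]
      sum_Ind_P[of "\<lambda>A. of_bool (Nb A \<inter> Nb C = {}) * h (A \<union> C)"]
    by (simp add: EI_def)
qed

lemma EI_comp_le:
  assumes "C \<subseteq> P" "conn lnk C"
  shows "EI (\<lambda>I. of_bool (C \<in> comps lnk (I \<inter> P))) \<le> w C"
proof -
  have "EI (\<lambda>I. of_bool (C \<in> comps lnk (I \<inter> P)))
      = w C * EI (\<lambda>I. of_bool (Nb (I \<inter> P) \<inter> Nb C = {}))"
    using EI_comp[OF assms, of "\<lambda>_. 1"] by simp
  also have "\<dots> \<le> w C * 1" using w_pos[of C] by (intro mult_left_mono EI_le_1) auto
  finally show ?thesis by simp
qed

section \<open>Good sides, component sums and moments of the number of singletons\<close>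

definition good :: "nat \<Rightarrow> 'a set \<Rightarrow> bool" where
  "good m A \<longleftrightarrow> (\<forall>C\<in>comps lnk A. card C \<le> m)"

definition k1 :: "'a set \<Rightarrow> nat" where
  "k1 A = card {v \<in> P. {v} \<in> comps lnk A}"

definition small_sum :: "nat \<Rightarrow> real" where
  "small_sum m = (\<Sum>C | C \<subseteq> P \<and> conn lnk C \<and> 2 \<le> card C \<and> card C \<le> m. w C)"

text \<open>The restriction on \<open>cl C\<close> is the one under which the isoperimetric
  inequality is available.\<close>

definition bad_sum :: "nat \<Rightarrow> real" where
  "bad_sum m = (\<Sum>C | C \<subseteq> P \<and> conn lnk C \<and> 2 * card (cl C) \<le> card P \<and> m < card C. w C)"

definition w1 :: real where "w1 = lam / (1 + lam) ^ d"

definition mu :: real where "mu = card P * w1"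

lemma w_singleton: "v \<in> P \<Longrightarrow> w {v} = w1"
  using card_nb[of v] by (simp add: w_def w1_def Nb_def)

lemma w1_pos: "w1 > 0"
  using lam_pos by (simp add: w1_def)

lemma mu_nonneg: "mu \<ge> 0"
  using w1_pos by (simp add: mu_def)

lemma finite_conn: "finite {C. C \<subseteq> P \<and> \<Phi> C}"
  by (rule finite_subset[of _ "Pow P"]) (auto simp: finite_P)

lemma EI_bad_le:
  "EI (\<lambda>I. of_bool (2 * card (cl (I \<inter> P)) \<le> card P \<and> \<not> good m (I \<inter> P))) \<le> bad_sum m"
proof -
  let ?B = "{C. C \<subseteq> P \<and> conn lnk C \<and> 2 * card (cl C) \<le> card P \<and> m < card C}"
  have "EI (\<lambda>I. of_bool (2 * card (cl (I \<inter> P)) \<le> card P \<and> \<not> good m (I \<inter> P)))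
      \<le> EI (\<lambda>I. \<Sum>C\<in>?B. of_bool (C \<in> comps lnk (I \<inter> P)))"
  proof (rule EI_mono)
    fix I
    show "of_bool (2 * card (cl (I \<inter> P)) \<le> card P \<and> \<not> good m (I \<inter> P))
        \<le> (\<Sum>C\<in>?B. of_bool (C \<in> comps lnk (I \<inter> P)) :: real)"
    proof (cases "2 * card (cl (I \<inter> P)) \<le> card P \<and> \<not> good m (I \<inter> P)")
      case True
      then obtain C where C: "C \<in> comps lnk (I \<inter> P)" "m < card C" by (auto simp: good_def)
      \<comment> \<open>The closure is monotone, so each component inherits the bound by half of
        \<open>P\<close>.\<close>
      have "cl C \<subseteq> cl (I \<inter> P)"
        using Nb_mono[OF compsD(1)[OF C(1)]] by (auto simp: cl_def)
      then have "card (cl C) \<le> card (cl (I \<inter> P))"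
        by (intro card_mono finite_subset[OF cl_subset finite_P])
      then have "C \<in> ?B" using C True compsD[OF C(1)] by auto
      then have "(\<Sum>C\<in>{C}. of_bool (C \<in> comps lnk (I \<inter> P)))
          \<le> (\<Sum>C\<in>?B. of_bool (C \<in> comps lnk (I \<inter> P)) :: real)"
        by (intro sum_mono2 finite_conn) auto
      then show ?thesis using C by auto
    qed (auto intro: sum_nonneg)
  qed
  also have "\<dots> = (\<Sum>C\<in>?B. EI (\<lambda>I. of_bool (C \<in> comps lnk (I \<inter> P))))" by (rule EI_sum)
  also have "\<dots> \<le> (\<Sum>C\<in>?B. w C)" by (intro sum_mono EI_comp_le) auto
  finally show ?thesis by (simp add: bad_sum_def)
qed

lemma k1_eq_sum: "real (k1 A) = (\<Sum>v\<in>P. of_bool ({v} \<in> comps lnk A))"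
  using finite_P by (simp add: k1_def Int_def)

lemma good_insert:
  assumes "A \<subseteq> P" "v \<in> P" "Nb A \<inter> Nb {v} = {}" "m \<ge> 1"
  shows "good m (A \<union> {v}) \<longleftrightarrow> good m A" "k1 (A \<union> {v}) = Suc (k1 A)"
proof -
  have vP: "{v} \<subseteq> P" using assms(2) by simp
  note imp = Nb_disjoint_imp[OF assms(1) vP assms(3)]
  have fin: "finite A" by (rule finite_subset[OF assms(1) finite_P])
  have ins: "comps lnk (A \<union> {v}) = insert {v} (comps lnk A)" "{v} \<notin> comps lnk A"
    using comps_insert[OF sym_lnk fin conn_singleton, of v] imp by auto
  show "good m (A \<union> {v}) \<longleftrightarrow> good m A"
    using assms(4) by (simp add: good_def ins(1) del: Un_insert_right)
  have "{u \<in> P. {u} \<in> comps lnk (A \<union> {v})} = insert v {u \<in> P. {u} \<in> comps lnk A}"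
    unfolding ins(1) using assms(2) by auto
  then show "k1 (A \<union> {v}) = Suc (k1 A)"
    using ins(2) finite_P by (simp add: k1_def)
qed

text \<open>Without the indicator on the right-hand side this would be the Stein--Chen characterisation of
  the Poisson distribution with mean \<open>mu\<close>.\<close>

lemma stein_identity:
  assumes "m \<ge> 1"
  shows "EI (\<lambda>I. of_bool (good m (I \<inter> P)) * \<phi> (k1 (I \<inter> P)) * real (k1 (I \<inter> P)))
    = w1 * (\<Sum>v\<in>P. EI (\<lambda>I. of_bool (Nb (I \<inter> P) \<inter> Nb {v} = {}) *
        (of_bool (good m (I \<inter> P)) * \<phi> (Suc (k1 (I \<inter> P))))))"
proof -
  have "EI (\<lambda>I. of_bool (good m (I \<inter> P)) * \<phi> (k1 (I \<inter> P)) * real (k1 (I \<inter> P)))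
      = EI (\<lambda>I. \<Sum>v\<in>P. of_bool ({v} \<in> comps lnk (I \<inter> P)) * (of_bool (good m (I \<inter> P)) * \<phi> (k1 (I \<inter> P))))"
    by (intro EI_cong) (simp add: k1_eq_sum sum_distrib_left sum_distrib_right mult_ac)
  also have "\<dots> = (\<Sum>v\<in>P. EI (\<lambda>I. of_bool ({v} \<in> comps lnk (I \<inter> P)) * (of_bool (good m (I \<inter> P)) * \<phi> (k1 (I \<inter> P)))))"
    by (rule EI_sum)
  also have "\<dots> = (\<Sum>v\<in>P. w1 * EI (\<lambda>I. of_bool (Nb (I \<inter> P) \<inter> Nb {v} = {}) *
        (of_bool (good m (I \<inter> P)) * \<phi> (Suc (k1 (I \<inter> P))))))"
  proof (rule sum.cong)
    fix v assume v: "v \<in> P"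
    have "EI (\<lambda>I. of_bool ({v} \<in> comps lnk (I \<inter> P)) * (of_bool (good m (I \<inter> P)) * \<phi> (k1 (I \<inter> P))))
      = w {v} * EI (\<lambda>I. of_bool (Nb (I \<inter> P) \<inter> Nb {v} = {}) *
        (of_bool (good m (I \<inter> P \<union> {v})) * \<phi> (k1 (I \<inter> P \<union> {v}))))"
      using v by (intro EI_comp conn_singleton) auto
    also have "EI (\<lambda>I. of_bool (Nb (I \<inter> P) \<inter> Nb {v} = {}) *
        (of_bool (good m (I \<inter> P \<union> {v})) * \<phi> (k1 (I \<inter> P \<union> {v}))))
      = EI (\<lambda>I. of_bool (Nb (I \<inter> P) \<inter> Nb {v} = {}) *
        (of_bool (good m (I \<inter> P)) * \<phi> (Suc (k1 (I \<inter> P)))))"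
    proof (rule EI_cong)
      fix I
      show "of_bool (Nb (I \<inter> P) \<inter> Nb {v} = {}) * (of_bool (good m (I \<inter> P \<union> {v})) * \<phi> (k1 (I \<inter> P \<union> {v})))
        = of_bool (Nb (I \<inter> P) \<inter> Nb {v} = {}) * (of_bool (good m (I \<inter> P)) * \<phi> (Suc (k1 (I \<inter> P))))"
        using good_insert[of "I \<inter> P" v m] v assms by (cases "Nb (I \<inter> P) \<inter> Nb {v} = {}") auto
    qed
    finally show "EI (\<lambda>I. of_bool ({v} \<in> comps lnk (I \<inter> P)) * (of_bool (good m (I \<inter> P)) * \<phi> (k1 (I \<inter> P))))
      = w1 * EI (\<lambda>I. of_bool (Nb (I \<inter> P) \<inter> Nb {v} = {}) *
        (of_bool (good m (I \<inter> P)) * \<phi> (Suc (k1 (I \<inter> P)))))"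
      by (simp add: w_singleton[OF v])
  qed simp
  finally show ?thesis by (simp add: sum_distrib_left)
qed

text \<open>A vertex that shares a neighbour with \<open>A\<close> is reached from \<open>A\<close>
  in two steps with at most \<open>d\<close> choices each.\<close>

lemma near_count:
  assumes "A \<subseteq> P"
  shows "(\<Sum>v\<in>P. of_bool (Nb A \<inter> Nb {v} \<noteq> {})) \<le> real d ^ 2 * card A"
proof -
  let ?T = "{v \<in> P. Nb A \<inter> Nb {v} \<noteq> {}}"
  have sub: "?T \<subseteq> (\<Union>y\<in>Nb A. nb y)"
  proof
    fix v assume "v \<in> ?T"
    then obtain y where y: "v \<in> P" "y \<in> Nb A" "y \<in> nb v" by (auto simp: Nb_def)
    then have "v \<in> nb y" using nb_sym[of v y] Nb_subset[OF assms] by auto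
    then show "v \<in> (\<Union>y\<in>Nb A. nb y)" using y by auto
  qed
  have fin: "finite (\<Union>y\<in>Nb A. nb y)"
    using finite_Nb[OF assms] finite_nb Nb_subset[OF assms] by auto
  have "card ?T \<le> card (\<Union>y\<in>Nb A. nb y)" by (rule card_mono[OF fin sub])
  also have "\<dots> \<le> (\<Sum>y\<in>Nb A. card (nb y))" by (rule card_UN_le[OF finite_Nb[OF assms]])
  also have "\<dots> = (\<Sum>y\<in>Nb A. d)" using Nb_subset[OF assms] card_nb by (intro sum.cong) auto
  also have "\<dots> = d * card (Nb A)" by simp
  also have "\<dots> \<le> d * (d * card A)" by (intro mult_left_mono card_Nb_le[OF assms]) auto
  finally have "real (card ?T) \<le> real (d * (d * card A))" by (rule of_nat_mono)
  then show ?thesis using finite_P by (simp add: Int_def power2_eq_square algebra_simps)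
qed

definition size_sum :: "nat \<Rightarrow> real" where "size_sum m = mu + m * small_sum m"

text \<open>The size is summed over components: singletons contribute at most \<open>mu\<close>, and
  the others have at most \<open>m\<close> elements on the good event.\<close>

lemma EI_size_le:
  "EI (\<lambda>I. of_bool (good m (I \<inter> P)) * real (card (I \<inter> P))) \<le> size_sum m"
proof -
  let ?A = "{C. C \<subseteq> P \<and> conn lnk C \<and> card C \<le> m}"
  let ?B = "{C. C \<subseteq> P \<and> conn lnk C \<and> 2 \<le> card C \<and> card C \<le> m}"
  let ?S = "(\<lambda>v. {v}) ` P"
  have "EI (\<lambda>I. of_bool (good m (I \<inter> P)) * real (card (I \<inter> P)))
      \<le> EI (\<lambda>I. \<Sum>C\<in>?A. real (card C) * of_bool (C \<in> comps lnk (I \<inter> P)))"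
  proof (rule EI_mono)
    fix I
    show "of_bool (good m (I \<inter> P)) * real (card (I \<inter> P))
        \<le> (\<Sum>C\<in>?A. real (card C) * of_bool (C \<in> comps lnk (I \<inter> P)))"
    proof (cases "good m (I \<inter> P)")
      case True
      have fin: "finite (I \<inter> P)" using finite_P by simp
      have "real (card (I \<inter> P)) = (\<Sum>C\<in>comps lnk (I \<inter> P). real (card C))"
        using card_eq_sum_comps[OF sym_lnk fin] by simp
      also have "\<dots> = (\<Sum>C\<in>comps lnk (I \<inter> P). real (card C) * of_bool (C \<in> comps lnk (I \<inter> P)))"
        by (intro sum.cong) auto
      also have "\<dots> \<le> (\<Sum>C\<in>?A. real (card C) * of_bool (C \<in> comps lnk (I \<inter> P)))"
      proof (rule sum_mono2)
        show "finite ?A" by (rule finite_conn)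
        show "comps lnk (I \<inter> P) \<subseteq> ?A"
          using True compsD[of _ lnk "I \<inter> P"] by (auto simp: good_def)
      qed auto
      finally show ?thesis using True by simp
    qed (auto intro: sum_nonneg)
  qed
  also have "\<dots> = (\<Sum>C\<in>?A. real (card C) * EI (\<lambda>I. of_bool (C \<in> comps lnk (I \<inter> P))))"
    by (simp add: EI_sum EI_cmult)
  also have "\<dots> \<le> (\<Sum>C\<in>?A. real (card C) * w C)" by (intro sum_mono mult_left_mono EI_comp_le) auto
  also have "\<dots> \<le> (\<Sum>C\<in>?S \<union> ?B. real (card C) * w C)"
  proof (rule sum_mono2)
    show "finite (?S \<union> ?B)" using finite_P finite_conn by auto
    show "?A \<subseteq> ?S \<union> ?B"
    proof
      fix C assume C: "C \<in> ?A"
      then have "finite C" "C \<noteq> {}" using finite_P by (auto simp: conn_def dest: finite_subset)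
      then have "card C \<ge> 1" by (simp add: Suc_le_eq card_gt_0_iff)
      then consider "card C = 1" | "card C \<ge> 2" by linarith
      then show "C \<in> ?S \<union> ?B"
        using C by cases (auto simp: card_1_singleton_iff)
    qed
  qed (auto simp: w_pos intro: less_imp_le)
  also have "\<dots> \<le> (\<Sum>C\<in>?S. real (card C) * w C) + (\<Sum>C\<in>?B. real (card C) * w C)"
    using finite_P finite_conn w_pos
    by (subst sum.union_disjoint) (auto simp: card_1_singleton_iff intro!: finite_conn)
  also have "(\<Sum>C\<in>?S. real (card C) * w C) = mu"
    by (subst sum.reindex) (auto simp: inj_on_def w_singleton mu_def)
  also have "(\<Sum>C\<in>?B. real (card C) * w C) \<le> (\<Sum>C\<in>?B. real m * w C)"
    using w_pos by (intro sum_mono mult_right_mono) (auto intro: less_imp_le)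
  also have "\<dots> = m * small_sum m" by (simp add: small_sum_def sum_distrib_left)
  finally show ?thesis by (simp add: size_sum_def)
qed

lemma stein_upper:
  assumes "m \<ge> 1" "\<And>k. \<phi> k \<ge> 0"
  shows "EI (\<lambda>I. of_bool (good m (I \<inter> P)) * \<phi> (k1 (I \<inter> P)) * real (k1 (I \<inter> P)))
    \<le> mu * EI (\<lambda>I. of_bool (good m (I \<inter> P)) * \<phi> (Suc (k1 (I \<inter> P))))"
proof -
  have "(\<Sum>v\<in>P. EI (\<lambda>I. of_bool (Nb (I \<inter> P) \<inter> Nb {v} = {}) *
        (of_bool (good m (I \<inter> P)) * \<phi> (Suc (k1 (I \<inter> P))))))
      \<le> (\<Sum>v\<in>P. EI (\<lambda>I. of_bool (good m (I \<inter> P)) * \<phi> (Suc (k1 (I \<inter> P)))))"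
    using assms(2) by (intro sum_mono EI_mono) auto
  then have "w1 * (\<Sum>v\<in>P. EI (\<lambda>I. of_bool (Nb (I \<inter> P) \<inter> Nb {v} = {}) *
        (of_bool (good m (I \<inter> P)) * \<phi> (Suc (k1 (I \<inter> P))))))
      \<le> w1 * (card P * EI (\<lambda>I. of_bool (good m (I \<inter> P)) * \<phi> (Suc (k1 (I \<inter> P)))))"
    using w1_pos by (intro mult_left_mono) auto
  then show ?thesis
    unfolding stein_identity[OF assms(1), of \<phi>] mu_def by (simp only: mult_ac)
qed

text \<open>The indicator in \<open>stein_identity\<close> fails for at most
  \<open>d ^ 2 * card (I \<inter> P)\<close> vertices, a quantity controlled on average by
  \<open>EI_size_le\<close>. The bound \<open>\<phi> \<le> 1\<close> makes the loss independent of
  \<open>\<phi>\<close>.\<close>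

lemma stein_lower:
  assumes "m \<ge> 1" "\<And>k. \<phi> k \<ge> 0" "\<And>k. \<phi> k \<le> 1"
  shows "EI (\<lambda>I. of_bool (good m (I \<inter> P)) * \<phi> (k1 (I \<inter> P)) * real (k1 (I \<inter> P)))
    \<ge> mu * EI (\<lambda>I. of_bool (good m (I \<inter> P)) * \<phi> (Suc (k1 (I \<inter> P)))) - w1 * d ^ 2 * size_sum m"
proof -
  let ?g = "\<lambda>I. of_bool (good m (I \<inter> P)) * \<phi> (Suc (k1 (I \<inter> P)))"
  have "(\<Sum>v\<in>P. EI ?g) - (\<Sum>v\<in>P. EI (\<lambda>I. of_bool (Nb (I \<inter> P) \<inter> Nb {v} = {}) * ?g I))
      = EI (\<lambda>I. \<Sum>v\<in>P. ?g I - of_bool (Nb (I \<inter> P) \<inter> Nb {v} = {}) * ?g I)"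
    by (simp only: EI_sum EI_diff sum_subtractf)
  also have "\<dots> \<le> EI (\<lambda>I. real d ^ 2 * (of_bool (good m (I \<inter> P)) * real (card (I \<inter> P))))"
  proof (rule EI_mono)
    fix I
    have "(\<Sum>v\<in>P. ?g I - of_bool (Nb (I \<inter> P) \<inter> Nb {v} = {}) * ?g I)
        \<le> (\<Sum>v\<in>P. of_bool (good m (I \<inter> P)) * of_bool (Nb (I \<inter> P) \<inter> Nb {v} \<noteq> {}))"
      using assms(2,3) by (intro sum_mono) auto
    also have "\<dots> = of_bool (good m (I \<inter> P)) * (\<Sum>v\<in>P. of_bool (Nb (I \<inter> P) \<inter> Nb {v} \<noteq> {}))"
      by (simp only: sum_distrib_left)
    also have "\<dots> \<le> of_bool (good m (I \<inter> P)) * (real d ^ 2 * real (card (I \<inter> P)))"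
      by (intro mult_left_mono near_count) auto
    finally show "(\<Sum>v\<in>P. ?g I - of_bool (Nb (I \<inter> P) \<inter> Nb {v} = {}) * ?g I)
        \<le> real d ^ 2 * (of_bool (good m (I \<inter> P)) * real (card (I \<inter> P)))" by (simp only: mult_ac)
  qed
  also have "\<dots> \<le> real d ^ 2 * size_sum m"
    unfolding EI_cmult by (intro mult_left_mono EI_size_le) auto
  finally have "w1 * ((\<Sum>v\<in>P. EI ?g) - (\<Sum>v\<in>P. EI (\<lambda>I. of_bool (Nb (I \<inter> P) \<inter> Nb {v} = {}) * ?g I)))
      \<le> w1 * (real d ^ 2 * size_sum m)" using w1_pos by (intro mult_left_mono) auto
  then show ?thesis
    unfolding stein_identity[OF assms(1), of \<phi>] mu_def by (simp add: algebra_simps)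
qed

lemma EI_markov:
  assumes "s > 0" "\<And>I. I \<in> Ind \<Longrightarrow> h I \<ge> 0" "\<And>I. I \<in> Ind \<Longrightarrow> \<Phi> I \<Longrightarrow> h I \<ge> s"
  shows "EI (\<lambda>I. of_bool (\<Phi> I)) \<le> EI h / s"
proof -
  have "EI (\<lambda>I. of_bool (\<Phi> I)) \<le> EI (\<lambda>I. (1 / s) * h I)"
    using assms by (intro EI_mono) (auto simp: field_simps)
  then show ?thesis by (simp only: EI_cmult) simp
qed

text \<open>The second moment comes from \<open>stein_upper\<close> with
  \<open>\<phi> = real\<close>, the first moment from \<open>stein_lower\<close> with
  \<open>\<phi> = 1\<close>. The unknown probability \<open>G\<close> of the good event multiplies
  all main terms, so those of order \<open>mu ^ 2\<close> cancel.\<close>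

lemma EI_k1_variance:
  assumes "m \<ge> 1"
  shows "EI (\<lambda>I. of_bool (good m (I \<inter> P)) * (real (k1 (I \<inter> P)) - mu)\<^sup>2)
    \<le> mu + 2 * mu * (w1 * d ^ 2 * size_sum m)"
proof -
  let ?g = "\<lambda>I. of_bool (good m (I \<inter> P)) :: real"
  let ?k = "\<lambda>I. real (k1 (I \<inter> P))"
  define G where "G = EI ?g"
  have G: "G \<le> 1" unfolding G_def by (intro EI_le_1) auto
  have k_le: "EI (\<lambda>I. ?g I * ?k I) \<le> mu * G"
    using stein_upper[OF assms, of "\<lambda>_. 1"] by (simp add: G_def)
  have k_ge: "EI (\<lambda>I. ?g I * ?k I) \<ge> mu * G - w1 * d ^ 2 * size_sum m"
    using stein_lower[OF assms, of "\<lambda>_. 1"] by (simp add: G_def)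
  have "EI (\<lambda>I. ?g I * ?k I * ?k I) \<le> mu * EI (\<lambda>I. ?g I * real (Suc (k1 (I \<inter> P))))"
    by (rule stein_upper[OF assms, of real]) simp
  also have "EI (\<lambda>I. ?g I * real (Suc (k1 (I \<inter> P)))) = EI (\<lambda>I. ?g I * ?k I) + G"
    unfolding G_def by (simp add: algebra_simps flip: EI_add)
  also have "mu * (EI (\<lambda>I. ?g I * ?k I) + G) \<le> mu * (mu * G + G)"
    using k_le mu_nonneg by (intro mult_left_mono) auto
  finally have k2: "EI (\<lambda>I. ?g I * ?k I * ?k I) \<le> mu * (mu * G + G)" .
  have "EI (\<lambda>I. ?g I * (?k I - mu)\<^sup>2)
      = EI (\<lambda>I. ?g I * ?k I * ?k I - (2 * mu) * (?g I * ?k I) + mu\<^sup>2 * ?g I)"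
    by (intro EI_cong) (simp add: power2_eq_square algebra_simps)
  also have "\<dots> = EI (\<lambda>I. ?g I * ?k I * ?k I) - 2 * mu * EI (\<lambda>I. ?g I * ?k I) + mu\<^sup>2 * G"
    unfolding G_def by (simp only: EI_add EI_diff EI_cmult)
  also have "\<dots> \<le> mu * (mu * G + G) - 2 * mu * (mu * G - w1 * d ^ 2 * size_sum m) + mu\<^sup>2 * G"
    using k2 k_ge mu_nonneg by (intro add_mono diff_mono mult_left_mono) auto
  also have "\<dots> = mu * G + 2 * mu * (w1 * d ^ 2 * size_sum m)"
    by (simp add: power2_eq_square algebra_simps)
  also have "mu * G \<le> mu * 1" using G mu_nonneg by (intro mult_left_mono)
  finally show ?thesis by simp
qed

lemma EI_k1_chebyshev:
  assumes "m \<ge> 1" "s > 0"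
  shows "EI (\<lambda>I. of_bool (good m (I \<inter> P) \<and> s < \<bar>real (k1 (I \<inter> P)) - mu\<bar>))
    \<le> (mu + 2 * mu * (w1 * d ^ 2 * size_sum m)) / s\<^sup>2"
proof -
  have "EI (\<lambda>I. of_bool (good m (I \<inter> P) \<and> s < \<bar>real (k1 (I \<inter> P)) - mu\<bar>))
      \<le> EI (\<lambda>I. of_bool (good m (I \<inter> P)) * (real (k1 (I \<inter> P)) - mu)\<^sup>2) / s\<^sup>2"
  proof (rule EI_markov)
    show "of_bool (good m (I \<inter> P)) * (real (k1 (I \<inter> P)) - mu)\<^sup>2 \<ge> s\<^sup>2"
      if "good m (I \<inter> P) \<and> s < \<bar>real (k1 (I \<inter> P)) - mu\<bar>" for I
      using that assms(2) power_mono[of s "\<bar>real (k1 (I \<inter> P)) - mu\<bar>" 2] by simp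
  qed (use assms(2) in auto)
  also have "\<dots> \<le> (mu + 2 * mu * (w1 * d ^ 2 * size_sum m)) / s\<^sup>2"
    by (intro divide_right_mono EI_k1_variance assms) auto
  finally show ?thesis .
qed

lemma k1_eq_card_comps: "k1 A = card {C \<in> comps lnk A. card C = 1}" if "A \<subseteq> P"
proof -
  have "{C \<in> comps lnk A. card C = 1} = (\<lambda>v. {v}) ` {v \<in> P. {v} \<in> comps lnk A}"
    using that by (auto simp: card_1_singleton_iff dest: compsD(1))
  then show ?thesis by (simp add: k1_def card_image inj_on_def)
qed

lemma card_comps_split:
  assumes "A \<subseteq> P"
  shows "card (comps lnk A) = k1 A + card {C \<in> comps lnk A. card C \<ge> 2}"
proof -
  have fin: "finite (comps lnk A)"
    by (rule finite_comps[OF finite_subset[OF assms finite_P]])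
  have "comps lnk A = {C \<in> comps lnk A. card C = 1} \<union> {C \<in> comps lnk A. card C \<ge> 2}"
  proof -
    have "card C \<noteq> 0" if "C \<in> comps lnk A" for C
      using compsD[OF that] assms finite_P finite_subset by (metis card_0_eq)
    then show ?thesis by (auto simp: numeral_2_eq_2) (metis Suc_leI le_neq_implies_less not_gr_zero)
  qed
  then have "card (comps lnk A) = card ({C \<in> comps lnk A. card C = 1} \<union> {C \<in> comps lnk A. card C \<ge> 2})"
    by simp
  also have "\<dots> = card {C \<in> comps lnk A. card C = 1} + card {C \<in> comps lnk A. card C \<ge> 2}"
    using fin by (intro card_Un_disjoint) auto
  finally show ?thesis by (simp add: k1_eq_card_comps[OF assms])
qed

lemma EI_larger_comps_le:
  "EI (\<lambda>I. of_bool (good m (I \<inter> P)) * real (card {C \<in> comps lnk (I \<inter> P). card C \<ge> 2})) \<le> small_sum m"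
proof -
  let ?B = "{C. C \<subseteq> P \<and> conn lnk C \<and> 2 \<le> card C \<and> card C \<le> m}"
  have "EI (\<lambda>I. of_bool (good m (I \<inter> P)) * real (card {C \<in> comps lnk (I \<inter> P). card C \<ge> 2}))
      \<le> EI (\<lambda>I. \<Sum>C\<in>?B. of_bool (C \<in> comps lnk (I \<inter> P)))"
  proof (rule EI_mono)
    fix I
    show "of_bool (good m (I \<inter> P)) * real (card {C \<in> comps lnk (I \<inter> P). card C \<ge> 2})
        \<le> (\<Sum>C\<in>?B. of_bool (C \<in> comps lnk (I \<inter> P)) :: real)"
    proof (cases "good m (I \<inter> P)")
      case True
      then have "{C \<in> comps lnk (I \<inter> P). card C \<ge> 2} \<subseteq> ?B \<inter> {C. C \<in> comps lnk (I \<inter> P)}"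
        using compsD[of _ lnk "I \<inter> P"] by (auto simp: good_def)
      then have "card {C \<in> comps lnk (I \<inter> P). card C \<ge> 2} \<le> card (?B \<inter> {C. C \<in> comps lnk (I \<inter> P)})"
        by (intro card_mono finite_Int disjI1 finite_conn)
      then show ?thesis using True finite_conn by simp
    qed (auto intro: sum_nonneg)
  qed
  also have "\<dots> = (\<Sum>C\<in>?B. EI (\<lambda>I. of_bool (C \<in> comps lnk (I \<inter> P))))" by (rule EI_sum)
  also have "\<dots> \<le> (\<Sum>C\<in>?B. w C)" by (intro sum_mono EI_comp_le) auto
  finally show ?thesis by (simp add: small_sum_def)
qed

text \<open>On this event the factor \<open>2 ^ card (I \<inter> P) / 2 ^ card (I \<inter> Q)\<close> is at least 1, and it turns the
  fugacity on \<open>Q\<close> into \<open>lam / 2\<close>.\<close>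

lemma EI_unbalanced_le:
  fixes s :: real
  assumes "s \<ge> 0"
  shows "EI (\<lambda>I. of_bool (card (I \<inter> P) \<le> s \<and> card (I \<inter> Q) \<le> card (I \<inter> P)))
    \<le> 2 powr s * ((1 + lam / 2) / (1 + lam)) powr (real (card P) - d * s)"
proof -
  define q where "q = (1 + lam / 2) / (1 + lam)"
  have q: "0 < q" "q < 1" using lam_pos by (auto simp: q_def field_simps)
  let ?Z = "\<Sum>I\<in>Ind. lam ^ card I"
  let ?c = "2 powr s * q powr (real (card P) - d * s)"
  have Zf: "?Z = (\<Sum>A\<in>Pow P. wt A)" using sum_Ind_P[of "\<lambda>_. 1"] by simp
  have "(\<Sum>I\<in>Ind. of_bool (card (I \<inter> P) \<le> s \<and> card (I \<inter> Q) \<le> card (I \<inter> P)) * lam ^ card I)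
      \<le> (\<Sum>I\<in>Ind. (of_bool (card (I \<inter> P) \<le> s) * 2 ^ card (I \<inter> P)) * lam ^ card (I \<inter> P) * (lam / 2) ^ card (I \<inter> Q))"
  proof (rule sum_mono)
    fix I assume I: "I \<in> Ind"
    show "of_bool (card (I \<inter> P) \<le> s \<and> card (I \<inter> Q) \<le> card (I \<inter> P)) * lam ^ card I
        \<le> (of_bool (card (I \<inter> P) \<le> s) * 2 ^ card (I \<inter> P)) * lam ^ card (I \<inter> P) * (lam / 2) ^ card (I \<inter> Q)"
    proof (cases "card (I \<inter> P) \<le> s \<and> card (I \<inter> Q) \<le> card (I \<inter> P)")
      case True
      have "lam ^ card (I \<inter> Q) = 2 ^ card (I \<inter> Q) * (lam / 2) ^ card (I \<inter> Q)"
        by (simp flip: power_mult_distrib)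
      also have "\<dots> \<le> 2 ^ card (I \<inter> P) * (lam / 2) ^ card (I \<inter> Q)"
        using True lam_pos by (intro mult_right_mono power_increasing) auto
      finally have "lam ^ card (I \<inter> P) * lam ^ card (I \<inter> Q)
          \<le> lam ^ card (I \<inter> P) * (2 ^ card (I \<inter> P) * (lam / 2) ^ card (I \<inter> Q))"
        using lam_pos by (intro mult_left_mono) auto
      then show ?thesis using True by (simp add: card_Ind[OF I] power_add mult_ac)
    qed (use lam_pos in auto)
  qed
  also have "\<dots> = (\<Sum>A\<in>Pow P. (of_bool (card A \<le> s) * 2 ^ card A) * lam ^ card A * (1 + lam / 2) ^ (card Q - card (Nb A)))"
    by (rule sum_two_fugacities)
  also have "\<dots> \<le> (\<Sum>A\<in>Pow P. ?c * wt A)"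
  proof (rule sum_mono)
    fix A assume "A \<in> Pow P"
    then have A: "A \<subseteq> P" by simp
    show "(of_bool (card A \<le> s) * 2 ^ card A) * lam ^ card A * (1 + lam / 2) ^ (card Q - card (Nb A)) \<le> ?c * wt A"
    proof (cases "card A \<le> s")
      case True
      have "card (Nb A) \<le> card Q" using Nb_subset[OF A] finite_Q by (intro card_mono)
      then have k: "real (card Q - card (Nb A)) = real (card P) - card (Nb A)"
        by (simp add: card_P_eq_card_Q)
      \<comment> \<open>A set of at most \<open>s\<close> vertices blocks at most
        \<open>d * s\<close> vertices of \<open>Q\<close>; each of the others gains a factor
        \<open>q < 1\<close>.\<close>
      have "real (card (Nb A)) \<le> real (d * card A)" using card_Nb_le[OF A] by (rule of_nat_mono)
      also have "\<dots> \<le> d * s" using True by (simp add: mult_left_mono)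
      finally have "q ^ (card Q - card (Nb A)) \<le> q powr (real (card P) - d * s)"
        using q by (simp add: powr_mono' k flip: powr_realpow)
      moreover have "(2 :: real) ^ card A \<le> 2 powr s"
        using True by (simp add: powr_mono flip: powr_realpow)
      ultimately have "2 ^ card A * q ^ (card Q - card (Nb A)) \<le> ?c"
        using q by (intro mult_mono) auto
      then have "2 ^ card A * q ^ (card Q - card (Nb A)) * wt A \<le> ?c * wt A"
        using lam_pos by (intro mult_right_mono) (auto simp: wt_def)
      moreover have "(1 + lam / 2) ^ (card Q - card (Nb A))
          = q ^ (card Q - card (Nb A)) * (1 + lam) ^ (card Q - card (Nb A))"
        using lam_pos by (simp add: q_def power_divide)
      ultimately show ?thesis using True by (simp add: wt_def mult_ac)
    next
      case False
      then show ?thesis using lam_pos by (simp add: wt_def)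
    qed
  qed
  also have "\<dots> = ?c * ?Z" by (simp only: Zf sum_distrib_left)
  finally show ?thesis
    unfolding EI_def q_def[symmetric] using Z_pos by (simp add: pos_divide_le_eq)
qed

text \<open>A vertex in both \<open>Nb (I \<inter> P)\<close> and the closure of
  \<open>I \<inter> Q\<close> would yield an edge inside \<open>I\<close>. So these two subsets of
  \<open>Q\<close> are disjoint, and the first has at least as many elements as
  \<open>cl (I \<inter> P)\<close>.\<close>

lemma cl_small:
  assumes "I \<in> Ind"
  shows "2 * card (cl (I \<inter> P)) \<le> card P \<or> 2 * card (regular_bipartite.cl Q nb (I \<inter> Q)) \<le> card Q"
proof -
  interpret sw: regular_bipartite Q P nb d by (rule swap)
  have disj: "Nb (cl (I \<inter> P)) \<inter> sw.cl (I \<inter> Q) = {}"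
  proof (rule ccontr)
    assume "\<not> ?thesis"
    then obtain y where y: "y \<in> Nb (cl (I \<inter> P))" "y \<in> sw.cl (I \<inter> Q)" by blast
    have "y \<in> Nb (I \<inter> P)" using y(1) Nb_cl[of "I \<inter> P"] by simp
    moreover have "y \<in> Q" "nb y \<subseteq> Nb (I \<inter> Q)"
      using y(2) by (auto simp: sw.cl_def Nb_def)
    ultimately have y: "y \<in> Nb (I \<inter> P)" "y \<in> Q" "nb y \<subseteq> Nb (I \<inter> Q)" by auto
    then obtain x where x: "x \<in> I" "x \<in> P" "y \<in> nb x" by (auto simp: Nb_def)
    then have "x \<in> nb y" using nb_sym y by auto
    then obtain z where "z \<in> I" "z \<in> Q" "x \<in> nb z" using y by (auto simp: Nb_def)
    then have "x \<in> nb z \<inter> I" "z \<in> I" using x by auto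
    then show False using assms by (auto simp: Ind_def)
  qed
  have "card (cl (I \<inter> P)) + card (sw.cl (I \<inter> Q)) \<le> card (Nb (cl (I \<inter> P))) + card (sw.cl (I \<inter> Q))"
    using card_le_card_Nb[OF cl_subset] by simp
  also have "\<dots> = card (Nb (cl (I \<inter> P)) \<union> sw.cl (I \<inter> Q))"
    using disj finite_Nb[OF cl_subset] finite_subset[OF sw.cl_subset finite_Q]
    by (intro card_Un_disjoint[symmetric]) auto
  also have "\<dots> \<le> card Q"
    using Nb_subset[OF cl_subset] sw.cl_subset finite_Q by (intro card_mono) auto
  finally show ?thesis using card_P_eq_card_Q by linarith
qed

end

section \<open>Bounds on the component sums\<close>

lemma sum_power_tail_le:
  fixes r :: real
  assumes "0 \<le> r" "r \<le> 1 / 2"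
  shows "(\<Sum>j\<in>{Suc m..N}. r ^ j) \<le> 2 * r ^ Suc m"
proof (cases "Suc m \<le> N")
  case True
  \<comment> \<open>The subtracted \<open>r ^ N\<close> makes the induction close.\<close>
  then have "(\<Sum>j\<in>{Suc m..N}. r ^ j) \<le> 2 * r ^ Suc m - r ^ N"
  proof (induction N rule: dec_induct)
    case (step N)
    have "2 * r ^ Suc N \<le> r ^ N" using assms mult_right_mono[of "2 * r" 1 "r ^ N"] by simp
    moreover have "(\<Sum>j\<in>{Suc m..Suc N}. r ^ j) = (\<Sum>j\<in>{Suc m..N}. r ^ j) + r ^ Suc N"
      using step by simp
    ultimately show ?case using step by linarith
  qed simp
  moreover have "r ^ N \<ge> 0" using assms by simp
  ultimately show ?thesis by linarith
qed (use assms in auto)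

text \<open>Two features of the cube besides regularity: \<open>codegree\<close> controls sets of
  size up to a small multiple of \<open>d\<close>, \<open>expansion\<close> the larger ones.\<close>

locale expanding_bipartite = hard_core_bipartite +
  assumes codegree: "\<And>x y. x \<in> P \<Longrightarrow> y \<in> P \<Longrightarrow> x \<noteq> y \<Longrightarrow> card (nb x \<inter> nb y) \<le> 2"
    and expansion: "\<And>A. A \<subseteq> P \<Longrightarrow> 2 * card A \<le> card P \<Longrightarrow>
      (1 + 1 / (2 * sqrt d)) * card A \<le> card (Nb A)"
begin

text \<open>Add the vertices one at a time. A new vertex shares at most \<open>2 * card A\<close>
  neighbours with the earlier ones, which is less than the increment of the square.\<close>

lemma card_Nb_lower:
  assumes "A \<subseteq> P"
  shows "d * card A \<le> card (Nb A) + card A ^ 2"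
proof -
  have "finite A" using assms finite_P by (rule finite_subset)
  then show ?thesis using assms
  proof (induction A)
    case (insert x A)
    have x: "x \<in> P \<union> Q" "x \<in> P" and A: "A \<subseteq> P" using insert by auto
    have "card (nb x \<inter> Nb A) = card (\<Union>y\<in>A. nb x \<inter> nb y)"
      unfolding Nb_def by (rule arg_cong[where f = card]) blast
    also have "\<dots> \<le> (\<Sum>y\<in>A. card (nb x \<inter> nb y))" by (rule card_UN_le[OF insert(1)])
    also have "\<dots> \<le> (\<Sum>y\<in>A. 2)" using insert A x(2) by (intro sum_mono codegree) auto
    finally have "card (nb x \<inter> Nb A) \<le> 2 * card A" by simp
    moreover have "card (nb x) + card (Nb A) = card (nb x \<union> Nb A) + card (nb x \<inter> Nb A)"
      using finite_nb[OF x(1)] finite_Nb[OF A] by (rule card_Un_Int)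
    moreover have "Nb (insert x A) = nb x \<union> Nb A" by (auto simp: Nb_def)
    ultimately have "d + card (Nb A) \<le> card (Nb (insert x A)) + 2 * card A"
      using card_nb[OF x(1)] by simp
    then show ?case using insert A by (simp add: power2_eq_square)
  qed simp
qed

lemma card_conn_size_le:
  "real (card {C. C \<subseteq> P \<and> conn lnk C \<and> card C \<le> j}) \<le> card (P \<union> Q) * (real (Suc d) ^ 12) ^ j"
proof -
  have "real (card {C. C \<subseteq> P \<and> conn lnk C \<and> card C \<le> j})
      \<le> real (card (P \<union> Q) * (Suc d ^ 6) ^ (2 * j))"
    by (intro of_nat_mono card_conn_lnk_le)
  then show ?thesis by (simp add: power_mult flip: power_mult)
qed

text \<open>Already two vertices have nearly \<open>2 * d\<close> neighbours; \<open>m ^ 2\<close>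
  is the correction from \<open>card_Nb_lower\<close>, and the remaining \<open>m\<close> in the
  exponent bounds \<open>lam ^ card C\<close>.\<close>

lemma small_sum_le:
  "small_sum m \<le> card (P \<union> Q) * (real (Suc d) ^ 12) ^ m * (1 + lam) ^ (m + m ^ 2) / (1 + lam) ^ (2 * d)"
proof -
  let ?B = "{C. C \<subseteq> P \<and> conn lnk C \<and> 2 \<le> card C \<and> card C \<le> m}"
  let ?c = "(1 + lam) ^ (m + m ^ 2) / (1 + lam) ^ (2 * d)"
  have c: "?c \<ge> 0" using lam_pos by simp
  have "w C \<le> ?c" if C: "C \<in> ?B" for C
  proof -
    have "d * 2 \<le> d * card C" using C by simp
    also have "\<dots> \<le> card (Nb C) + card C ^ 2" using C by (intro card_Nb_lower) auto
    also have "card C ^ 2 \<le> m ^ 2" using C by (intro power_mono) auto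
    finally have dm: "2 * d \<le> card (Nb C) + m ^ 2" by simp
    have "lam ^ card C * (1 + lam) ^ (2 * d) \<le> (1 + lam) ^ card C * (1 + lam) ^ (card (Nb C) + m ^ 2)"
      using lam_pos dm by (intro mult_mono power_mono power_increasing) auto
    also have "\<dots> \<le> (1 + lam) ^ m * (1 + lam) ^ (card (Nb C) + m ^ 2)"
      using lam_pos C by (intro mult_right_mono power_increasing) auto
    also have "\<dots> = (1 + lam) ^ (m + m ^ 2) * (1 + lam) ^ card (Nb C)"
      by (simp add: power_add mult_ac)
    finally show ?thesis using lam_pos by (simp add: w_def field_simps)
  qed
  then have "small_sum m \<le> (\<Sum>C\<in>?B. ?c)" unfolding small_sum_def by (intro sum_mono)
  also have "\<dots> = card ?B * ?c" by simp
  also have "\<dots> \<le> (card (P \<union> Q) * (real (Suc d) ^ 12) ^ m) * ?c"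
  proof (rule mult_right_mono[OF _ c])
    have "card ?B \<le> card {C. C \<subseteq> P \<and> conn lnk C \<and> card C \<le> m}"
      by (intro card_mono finite_conn) auto
    then show "real (card ?B) \<le> card (P \<union> Q) * (real (Suc d) ^ 12) ^ m"
      using card_conn_size_le[of m] by linarith
  qed
  finally show ?thesis by simp
qed

text \<open>Up to size \<open>\<eta> * d\<close> the quadratic correction in
  \<open>card_Nb_lower\<close> costs only a fraction \<open>\<eta>\<close> of the edges. Each vertex
  then contributes a factor \<open>r\<close>, counting included, and a geometric series
  remains.\<close>

lemma small_bad_sum_le:
  fixes \<eta> r :: real
  defines "r \<equiv> real (Suc d) ^ 12 * (1 + lam) powr (1 - (1 - \<eta>) * d)"
  assumes r: "r \<le> 1 / 2"
  shows "(\<Sum>C | C \<subseteq> P \<and> conn lnk C \<and> m < card C \<and> card C \<le> \<eta> * d. w C)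
    \<le> card (P \<union> Q) * (2 * r ^ Suc m)"
proof -
  define q where "q = (1 + lam) powr (1 - (1 - \<eta>) * d)"
  define D where "D = real (Suc d) ^ 12"
  let ?B = "{C. C \<subseteq> P \<and> conn lnk C \<and> m < card C \<and> card C \<le> \<eta> * d}"
  let ?J = "\<lambda>j. {C. C \<subseteq> P \<and> conn lnk C \<and> card C = j}"
  have q: "q > 0" using lam_pos by (simp add: q_def)
  have rq: "r = D * q" by (simp add: r_def D_def q_def)
  have r0: "r \<ge> 0" by (simp add: r_def)
  have w_le: "w C \<le> q ^ card C" if C: "C \<in> ?B" for C
  proof -
    define j where "j = real (card C)"
    have "real (d * card C) \<le> real (card (Nb C) + card C ^ 2)"
      using C by (intro of_nat_mono card_Nb_lower) auto
    then have "d * j \<le> card (Nb C) + j * j" by (simp add: j_def power2_eq_square)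
    also have "j * j \<le> (\<eta> * d) * j" using C by (intro mult_right_mono) (auto simp: j_def)
    finally have N: "(1 - \<eta>) * d * j \<le> card (Nb C)" by (simp add: algebra_simps)
    have "w C \<le> (1 + lam) ^ card C / (1 + lam) ^ card (Nb C)"
      unfolding w_def using lam_pos by (intro divide_right_mono power_mono) auto
    also have "\<dots> = (1 + lam) powr (j - card (Nb C))"
      using lam_pos by (simp add: powr_diff powr_realpow j_def)
    also have "\<dots> \<le> (1 + lam) powr (j - (1 - \<eta>) * d * j)"
      using lam_pos N by (intro powr_mono) auto
    also have "\<dots> = (1 + lam) powr ((1 - (1 - \<eta>) * d) * card C)" by (simp add: j_def algebra_simps)
    also have "\<dots> = q ^ card C" using q by (simp add: q_def powr_powr flip: powr_realpow)
    finally show ?thesis .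
  qed
  have "(\<Sum>C\<in>?B. w C) \<le> (\<Sum>C\<in>?B. q ^ card C)" by (intro sum_mono w_le)
  also have "\<dots> \<le> (\<Sum>j\<in>{Suc m..card P}. \<Sum>C\<in>?J j. q ^ card C)"
  proof (rule sum_le_sum_UN)
    show "?B \<subseteq> (\<Union>j\<in>{Suc m..card P}. ?J j)"
      using finite_P by (auto intro: card_mono simp: Suc_le_eq)
  qed (use q finite_conn in auto)
  also have "\<dots> \<le> (\<Sum>j\<in>{Suc m..card P}. card (P \<union> Q) * r ^ j)"
  proof (rule sum_mono)
    fix j
    have "(\<Sum>C\<in>?J j. q ^ card C) = card (?J j) * q ^ j" by simp
    also have "\<dots> \<le> (card (P \<union> Q) * D ^ j) * q ^ j"
    proof (rule mult_right_mono)
      have "card (?J j) \<le> card {C. C \<subseteq> P \<and> conn lnk C \<and> card C \<le> j}"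
        by (intro card_mono finite_conn) auto
      then show "real (card (?J j)) \<le> card (P \<union> Q) * D ^ j"
        unfolding D_def using card_conn_size_le[of j] by linarith
    qed (use q in auto)
    also have "\<dots> = card (P \<union> Q) * r ^ j" by (simp add: rq power_mult_distrib)
    finally show "(\<Sum>C\<in>?J j. q ^ card C) \<le> card (P \<union> Q) * r ^ j" .
  qed
  also have "\<dots> = card (P \<union> Q) * (\<Sum>j\<in>{Suc m..card P}. r ^ j)" by (simp add: sum_distrib_left)
  also have "\<dots> \<le> card (P \<union> Q) * (2 * r ^ Suc m)"
    using r0 r by (intro mult_left_mono sum_power_tail_le) auto
  finally show ?thesis .
qed

text \<open>The bound of \<open>card_Nb_lower\<close> degenerates for large sets. It is applied to a
  subset of about \<open>\<eta> * d\<close> elements, where it is of order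
  \<open>d ^ 2\<close>.\<close>

lemma large_card_Nb:
  fixes \<eta> :: real
  assumes "C \<subseteq> P" "\<eta> * d < card C" "0 < \<eta>" "\<eta> \<le> 1 / 2" "2 \<le> \<eta> * d"
  shows "\<eta> * d ^ 2 / 4 \<le> card (Nb C)"
proof -
  define k where "k = nat \<lfloor>\<eta> * d\<rfloor>"
  have k: "real k \<le> \<eta> * d" "\<eta> * d - 1 < real k" using assms(3) by (auto simp: k_def)
  then have "k \<le> card C" using assms(2) by linarith
  then obtain C' where C': "C' \<subseteq> C" "card C' = k" by (metis obtain_subset_with_card_n)
  have "real (d * k) \<le> real (card (Nb C') + k ^ 2)"
    using card_Nb_lower[of C'] C' assms(1) by (intro of_nat_mono) auto
  then have "real k * (real d - real k) \<le> card (Nb C')" by (simp add: power2_eq_square algebra_simps)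
  moreover have "card (Nb C') \<le> card (Nb C)"
    using C' assms(1) by (intro card_mono finite_Nb Nb_mono) auto
  moreover have "(\<eta> * d / 2) * (d / 2) \<le> real k * (real d - real k)"
  proof (rule mult_mono)
    show "\<eta> * d / 2 \<le> real k" using k(2) assms(5) by linarith
    have "\<eta> * d \<le> 1 / 2 * d" using assms(4) by (intro mult_right_mono) auto
    then show "d / 2 \<le> real d - k" using k(1) by linarith
  qed auto
  ultimately show ?thesis by (simp add: power2_eq_square)
qed

text \<open>Isoperimetry of the closure, solved for the excess. The constant 4 in place of 2 absorbs
  the passage from \<open>a\<close> to \<open>g\<close>, as \<open>sqrt d \<ge> 1\<close>.\<close>

lemma fam_excess:
  assumes "C \<in> fam a g" "2 * a \<le> card P"
  shows "real g / (4 * sqrt d) \<le> real g - real a"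
proof -
  have C: "C \<subseteq> P" "card (cl C) = a" "card (Nb C) = g" using assms(1) by (auto simp: fam_def)
  have d1: "sqrt d \<ge> 1" using d_pos by simp
  have "(1 + 1 / (2 * sqrt d)) * a \<le> g"
    using expansion[OF cl_subset, of C] assms(2) C Nb_cl[OF C(1)] by simp
  moreover have "a \<le> g" using card_le_card_Nb[OF cl_subset, of C] C Nb_cl[OF C(1)] by simp
  ultimately have "2 * sqrt d * a + a \<le> 2 * sqrt d * g" using d1 by (simp add: field_simps)
  then have "g \<le> (2 * sqrt d + 1) * (real g - a)" by (simp add: algebra_simps)
  also have "\<dots> \<le> (4 * sqrt d) * (real g - a)"
  proof (rule mult_right_mono)
    show "2 * sqrt d + 1 \<le> 4 * sqrt d" using d1 by linarith
  qed (use \<open>a \<le> g\<close> in simp)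
  finally show ?thesis using d1 by (simp add: field_simps)
qed

text \<open>\<open>H1\<close> and \<open>H2\<close> say, for the two kinds of containers, that
  listing costs at most half of what is saved. Both leave a saving of at least
  \<open>\<gamma> * L * t / 4\<close> in the exponent; 64 is this 4 times the 16 in
  \<open>t \<ge> \<eta> * d ^ 2 / (16 * sqrt d)\<close>.\<close>

lemma fam_sum_le:
  fixes \<gamma> \<psi> \<eta> D L :: real
  defines "D \<equiv> real (Suc d) ^ 12" and "L \<equiv> ln (1 + lam)"
  assumes \<psi>: "0 < \<psi>" "8 * \<psi> \<le> \<gamma> * d" "\<gamma> \<le> 1"
    and H1: "12 * sqrt d * ln D / \<psi> \<le> \<gamma> * L / 4"
    and H2: "(12 * sqrt d / \<psi> + \<gamma>) * ln (2 * D) \<le> L / 2"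
    and a: "2 * a \<le> card P" and g: "\<eta> * d ^ 2 / 4 \<le> g" and \<eta>: "\<eta> > 0"
  shows "(\<Sum>C\<in>fam a g. w C) \<le> 2 * card (P \<union> Q) * exp (- (\<gamma> * L * \<eta> * d ^ 2 / (64 * sqrt d)))"
proof (cases "fam a g = {}")
  case False
  define t where "t = real g - real a"
  have d1: "sqrt d \<ge> 1" using d_pos by simp
  have gt: "g \<le> 4 * sqrt d * t"
    using False fam_excess[OF _ a] d1 by (auto simp: t_def field_simps)
  have t0: "t \<ge> 0"
  proof -
    have "0 \<le> 4 * sqrt d * t" using gt by (meson of_nat_0_le_iff order_trans)
    then show ?thesis using d1 by (simp add: zero_le_mult_iff)
  qed
  have L: "L > 0" using lam_pos by (simp add: L_def)
  have D1: "D \<ge> 1" by (simp add: D_def)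
  have \<gamma>: "\<gamma> \<ge> 0"
  proof (rule ccontr)
    assume "\<not> \<gamma> \<ge> 0"
    then have "\<gamma> * d \<le> 0" by (simp add: mult_nonpos_nonneg)
    then show False using \<psi> by linarith
  qed
  have gp: "3 * g / \<psi> \<le> 12 * sqrt d / \<psi> * t"
    using gt \<psi>(1) by (simp add: field_simps)
  have A: "D powr (3 * g / \<psi>) * (1 + lam) powr (- (\<gamma> * t / 2)) \<le> exp (- (\<gamma> * L * t / 4))"
  proof -
    have "D powr (3 * g / \<psi>) \<le> D powr (12 * sqrt d / \<psi> * t)"
      using gp D1 by (intro powr_mono) auto
    also have "\<dots> = exp (12 * sqrt d * ln D / \<psi> * t)" using D1 by (simp add: powr_def mult_ac)
    also have "\<dots> \<le> exp (\<gamma> * L / 4 * t)" using mult_right_mono[OF H1 t0] by (simp only: exp_le_cancel_iff)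
    finally have "D powr (3 * g / \<psi>) * (1 + lam) powr (- (\<gamma> * t / 2))
        \<le> exp (\<gamma> * L / 4 * t) * (1 + lam) powr (- (\<gamma> * t / 2))"
      by (intro mult_right_mono) auto
    also have "\<dots> = exp (- (\<gamma> * L * t / 4))"
      using lam_pos by (simp add: powr_def L_def algebra_simps flip: exp_add)
    finally show ?thesis .
  qed
  have B: "(2 * D) powr (3 * g / \<psi> + \<gamma> * t) * (1 + lam) powr (- t) \<le> exp (- (\<gamma> * L * t / 4))"
  proof -
    have "(2 * D) powr (3 * g / \<psi> + \<gamma> * t) \<le> (2 * D) powr ((12 * sqrt d / \<psi> + \<gamma>) * t)"
      using gp D1 by (intro powr_mono) (auto simp: algebra_simps)
    also have "\<dots> = exp ((12 * sqrt d / \<psi> + \<gamma>) * ln (2 * D) * t)" using D1 by (simp add: powr_def mult_ac)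
    also have "\<dots> \<le> exp (L / 2 * t)" using mult_right_mono[OF H2 t0] by (simp only: exp_le_cancel_iff)
    finally have "(2 * D) powr (3 * g / \<psi> + \<gamma> * t) * (1 + lam) powr (- t)
        \<le> exp (L / 2 * t) * (1 + lam) powr (- t)"
      by (intro mult_right_mono) auto
    also have "\<dots> = exp (- (L * t / 2))"
      using lam_pos by (simp add: powr_def L_def algebra_simps flip: exp_add)
    also have "\<dots> \<le> exp (- (\<gamma> * L * t / 4))"
    proof -
      have "\<gamma> * (L * t) \<le> 1 * (L * t)" using \<psi>(3) L t0 by (intro mult_right_mono) auto
      moreover have "L * t \<ge> 0" using L t0 by simp
      ultimately have "\<gamma> * (L * t) / 4 \<le> L * t / 2" by linarith
      then have "\<gamma> * L * t / 4 \<le> L * t / 2" by (simp only: mult.assoc)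
      then show ?thesis by simp
    qed
    finally show ?thesis .
  qed
  have "(\<Sum>C\<in>fam a g. w C) = (\<Sum>C\<in>fam a g. lam ^ card C / (1 + lam) ^ g)"
    by (intro sum.cong) (auto simp: fam_def w_def)
  also have "\<dots> \<le> card (P \<union> Q) * (D powr (3 * g / \<psi>) * (1 + lam) powr (- (\<gamma> * t / 2))
        + (2 * D) powr (3 * g / \<psi> + \<gamma> * t) * (1 + lam) powr (- t))"
    using container_sum[OF lam_pos \<psi>, of g a] t0 by (simp add: t_def D_def)
  also have "\<dots> \<le> card (P \<union> Q) * (exp (- (\<gamma> * L * t / 4)) + exp (- (\<gamma> * L * t / 4)))"
    using A B by (intro mult_left_mono add_mono) auto
  also have "\<dots> = 2 * card (P \<union> Q) * exp (- (\<gamma> * L * t / 4))" by simp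
  also have "\<dots> \<le> 2 * card (P \<union> Q) * exp (- (\<gamma> * L * \<eta> * d ^ 2 / (64 * sqrt d)))"
  proof -
    have "\<eta> * d ^ 2 / 4 \<le> 4 * sqrt d * t" using g gt by linarith
    then have "\<eta> * d ^ 2 / (16 * sqrt d) \<le> t" using d1 by (simp add: field_simps)
    then have "(\<gamma> * L / 4) * (\<eta> * d ^ 2 / (16 * sqrt d)) \<le> (\<gamma> * L / 4) * t"
      using \<gamma> L by (intro mult_left_mono) auto
    then show ?thesis by (intro mult_left_mono) (auto simp: mult_ac)
  qed
  finally show ?thesis .
qed simp

text \<open>Sets up to size \<open>\<eta> * d\<close> are counted directly, the others are sorted
  into the families \<open>fam a g\<close>. There are at most \<open>card (P \<union> Q) ^ 2\<close>
  pairs \<open>(a, g)\<close>, which explains the cube.\<close>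

lemma bad_sum_le:
  fixes \<gamma> \<psi> \<eta> D L r :: real
  defines "D \<equiv> real (Suc d) ^ 12" and "L \<equiv> ln (1 + lam)"
    and "r \<equiv> real (Suc d) ^ 12 * (1 + lam) powr (1 - (1 - \<eta>) * d)"
  assumes \<psi>: "0 < \<psi>" "8 * \<psi> \<le> \<gamma> * d" "\<gamma> \<le> 1"
    and H1: "12 * sqrt d * ln D / \<psi> \<le> \<gamma> * L / 4"
    and H2: "(12 * sqrt d / \<psi> + \<gamma>) * ln (2 * D) \<le> L / 2"
    and \<eta>: "0 < \<eta>" "\<eta> \<le> 1 / 2" "2 \<le> \<eta> * d" and r: "r \<le> 1 / 2"
  shows "bad_sum m \<le> 2 * card (P \<union> Q) * r ^ Suc m
    + 2 * card (P \<union> Q) ^ 3 * exp (- (\<gamma> * L * \<eta> * d ^ 2 / (64 * sqrt d)))"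
proof -
  let ?B = "{C. C \<subseteq> P \<and> conn lnk C \<and> 2 * card (cl C) \<le> card P \<and> m < card C}"
  let ?S = "{C. C \<subseteq> P \<and> conn lnk C \<and> m < card C \<and> card C \<le> \<eta> * d}"
  let ?V = "real (card (P \<union> Q))"
  let ?e = "exp (- (\<gamma> * L * \<eta> * d ^ 2 / (64 * sqrt d)))"
  define T where "T = {(a, g). 2 * a \<le> card P \<and> g \<le> card Q \<and> \<eta> * d ^ 2 / 4 \<le> real g}"
  have subT: "T \<subseteq> {..card P} \<times> {1..card Q}"
  proof
    fix p assume p: "p \<in> T"
    then obtain a g where ag: "p = (a, g)" "2 * a \<le> card P" "g \<le> card Q" "\<eta> * d ^ 2 / 4 \<le> real g"
      by (auto simp: T_def)
    have "0 < \<eta> * d ^ 2 / 4" using \<eta>(1) d_pos by simp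
    then have "real g > 0" using ag(4) by linarith
    then show "p \<in> {..card P} \<times> {1..card Q}" using ag by auto
  qed
  then have finT: "finite T" by (rule finite_subset) auto
  have PQ: "card (P \<union> Q) = card P + card Q"
    using finite_P finite_Q PQ_disjoint by (rule card_Un_disjoint)
  have w0: "w C \<ge> 0" for C using w_pos[of C] by simp
  have "bad_sum m \<le> (\<Sum>b\<in>{True, False}. sum w (if b then ?S else \<Union>(a, g)\<in>T. fam a g))"
    unfolding bad_sum_def
  proof (rule sum_le_sum_UN)
    show "?B \<subseteq> (\<Union>b\<in>{True, False}. if b then ?S else \<Union>(a, g)\<in>T. fam a g)"
    proof
      fix C assume C: "C \<in> ?B"
      show "C \<in> (\<Union>b\<in>{True, False}. if b then ?S else \<Union>(a, g)\<in>T. fam a g)"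
      proof (cases "card C \<le> \<eta> * d")
        case False
        then have "\<eta> * d ^ 2 / 4 \<le> card (Nb C)" using C \<eta> by (intro large_card_Nb) auto
        moreover have "card (Nb C) \<le> card Q" using C Nb_subset finite_Q by (intro card_mono) auto
        ultimately have "(card (cl C), card (Nb C)) \<in> T" using C by (simp add: T_def)
        moreover have "C \<in> fam (card (cl C)) (card (Nb C))" using C by (simp add: fam_def)
        ultimately have "C \<in> (\<Union>(a, g)\<in>T. fam a g)" by blast
        then show ?thesis by simp
      qed (use C in simp)
    qed
    have "finite (fam a g)" for a g unfolding fam_def by (rule finite_conn)
    then show "finite (if b then ?S else \<Union>(a, g)\<in>T. fam a g)" for b
      using finT finite_conn by (cases b) auto
  qed (use w0 in auto)
  also have "\<dots> = sum w ?S + sum w (\<Union>(a, g)\<in>T. fam a g)" by simp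
  also have "sum w ?S \<le> ?V * (2 * r ^ Suc m)"
    unfolding r_def using r by (intro small_bad_sum_le) (simp add: r_def)
  also have "sum w (\<Union>(a, g)\<in>T. fam a g) \<le> (\<Sum>p\<in>T. sum w (case p of (a, g) \<Rightarrow> fam a g))"
    using finT w0 finite_conn by (intro sum_le_sum_UN) (auto simp: fam_def)
  also have "\<dots> \<le> (\<Sum>p\<in>T. 2 * ?V * ?e)"
  proof (rule sum_mono)
    fix p assume "p \<in> T"
    then obtain a g where p: "p = (a, g)" "2 * a \<le> card P" "\<eta> * d ^ 2 / 4 \<le> real g" by (auto simp: T_def)
    show "sum w (case p of (a, g) \<Rightarrow> fam a g) \<le> 2 * ?V * ?e"
      using fam_sum_le[OF \<psi> _ _ p(2,3) \<eta>(1)] H1 H2 by (simp add: p(1) D_def L_def)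
  qed
  also have "\<dots> = card T * (2 * ?V * ?e)" by simp
  also have "\<dots> \<le> ?V ^ 2 * (2 * ?V * ?e)"
  proof (rule mult_right_mono)
    have "card T \<le> card ({..card P} \<times> {1..card Q})" using subT by (intro card_mono) auto
    also have "\<dots> = Suc (card P) * card Q" by (simp add: card_cartesian_product)
    also have "\<dots> \<le> (2 * card P) * (2 * card P)"
      unfolding card_P_eq_card_Q[symmetric] by (cases "card P") auto
    also have "\<dots> = card (P \<union> Q) ^ 2" by (simp add: PQ power2_eq_square algebra_simps flip: card_P_eq_card_Q)
    finally have "real (card T) \<le> real (card (P \<union> Q) ^ 2)" by (rule of_nat_mono)
    then show "real (card T) \<le> ?V ^ 2" by simp
  qed auto
  finally show ?thesis by (simp add: algebra_simps power2_eq_square power3_eq_cube)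
qed

end

section \<open>The hypercube\<close>

definition flip :: "nat \<Rightarrow> bool list \<Rightarrow> bool list" where
  "flip i x = x[i := \<not> x ! i]"

definition cube_nb :: "bool list \<Rightarrow> bool list set" where
  "cube_nb x = (\<lambda>i. flip i x) ` {..<length x}"

lemma length_flip [simp]: "length (flip i x) = length x"
  by (simp add: flip_def)

lemma nth_flip: "j < length x \<Longrightarrow> flip i x ! j = (if j = i then \<not> x ! j else x ! j)"
  by (simp add: flip_def nth_list_update)

lemma flip_flip: "flip i (flip i x) = x"
  by (rule nth_equalityI) (simp_all add: nth_flip)

lemma flip_Cons [simp]: "flip 0 (b # y) = (\<not> b) # y" "flip (Suc i) (b # y) = b # flip i y"
  by (simp_all add: flip_def)

lemma inj_on_flip: "inj_on (\<lambda>i. flip i x) {..<length x}"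
proof (rule inj_onI)
  fix i j assume "i \<in> {..<length x}" and eq: "flip i x = flip j x"
  then have "flip i x ! i = flip j x ! i" "i < length x" by auto
  then show "i = j" by (auto simp: nth_flip split: if_splits)
qed

lemma card_cube_nb: "card (cube_nb x) = length x"
  by (simp add: cube_nb_def card_image inj_on_flip)

lemma finite_cube_nb: "finite (cube_nb x)"
  by (simp add: cube_nb_def)

lemma length_cube_nb: "y \<in> cube_nb x \<Longrightarrow> length y = length x"
  by (auto simp: cube_nb_def)

lemma cube_nb_sym: "y \<in> cube_nb x \<longleftrightarrow> x \<in> cube_nb y"
proof -
  have "x \<in> cube_nb y" if y: "y \<in> cube_nb x" for x y
  proof -
    obtain i where "i < length x" "y = flip i x" using y by (auto simp: cube_nb_def)
    then show ?thesis unfolding cube_nb_def by (intro image_eqI[of _ _ i]) (auto simp: flip_flip)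
  qed
  then show ?thesis by blast
qed

lemma parity_flip: "i < length x \<Longrightarrow> even (count_list (flip i x) True) \<longleftrightarrow> odd (count_list x True)"
proof (induction x arbitrary: i)
  case (Cons b x)
  then show ?case by (cases i) auto
qed simp

lemma parcs_hypercube_iff: "(x, y) \<in> parcs (hypercube d) \<longleftrightarrow> length x = d \<and> y \<in> cube_nb x"
proof
  assume "(x, y) \<in> parcs (hypercube d)"
  then have l: "length x = d" "length y = d" and c: "card {i. i < d \<and> x ! i \<noteq> y ! i} = 1"
    by (auto simp: hypercube_def)
  then obtain i where i: "{i. i < d \<and> x ! i \<noteq> y ! i} = {i}" by (auto simp: card_1_singleton_iff)
  have "y = flip i x"
  proof (rule nth_equalityI)
    fix j assume j: "j < length y"
    have "j \<in> {i. i < d \<and> x ! i \<noteq> y ! i} \<longleftrightarrow> j = i" unfolding i by simp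
    then show "y ! j = flip i x ! j" using j l by (auto simp: nth_flip)
  qed (use l in simp)
  moreover have "i < d" using i by blast
  ultimately show "length x = d \<and> y \<in> cube_nb x" using l by (auto simp: cube_nb_def)
next
  assume "length x = d \<and> y \<in> cube_nb x"
  then obtain i where i: "length x = d" "i < d" "y = flip i x" by (auto simp: cube_nb_def)
  then have "{j. j < d \<and> x ! j \<noteq> y ! j} = {i}" by (auto simp: nth_flip split: if_splits)
  then show "(x, y) \<in> parcs (hypercube d)" using i by (simp add: hypercube_def)
qed

text \<open>A common neighbour arises from \<open>x\<close> by flipping \<open>i\<close> and from
  \<open>y\<close> by flipping \<open>j\<close>, so \<open>x\<close> and \<open>y\<close> differ
  exactly in positions \<open>i\<close> and \<open>j\<close>. Hence only two values of
  \<open>i\<close> are possible.\<close>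

lemma codegree_cube:
  assumes "length x = length y" "x \<noteq> y"
  shows "card (cube_nb x \<inter> cube_nb y) \<le> 2"
proof (cases "cube_nb x \<inter> cube_nb y = {}")
  case False
  define D where "D = {i. i < length x \<and> x ! i \<noteq> y ! i}"
  have *: "\<exists>j. i < length x \<and> D = {i, j}" if "flip i x = flip j y" "i < length x" "j < length y" for i j
  proof -
    have ij: "i \<noteq> j" using that(1) assms(2) by (metis flip_flip)
    have "k \<in> D \<longleftrightarrow> k = i \<or> k = j" for k
    proof (cases "k < length x")
      case True
      have "flip i x ! k = flip j y ! k" using that(1) by simp
      then show ?thesis using True assms(1) ij by (auto simp: D_def nth_flip split: if_splits)
    qed (use that assms(1) in \<open>auto simp: D_def\<close>)
    then have "D = {i, j}" by blast
    then show ?thesis using that(2) by blast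
  qed
  have sub: "cube_nb x \<inter> cube_nb y \<subseteq> (\<lambda>i. flip i x) ` D"
  proof
    fix z assume "z \<in> cube_nb x \<inter> cube_nb y"
    then have "z \<in> cube_nb x" "z \<in> cube_nb y" by auto
    then obtain i j where ij: "z = flip i x" "i < length x" "z = flip j y" "j < length y"
      unfolding cube_nb_def by blast
    then have "i \<in> D" using *[of i j] by auto
    then show "z \<in> (\<lambda>i. flip i x) ` D" using ij(1) by blast
  qed
  obtain z where "z \<in> cube_nb x" "z \<in> cube_nb y" using False by auto
  then obtain i j where "flip i x = flip j y" "i < length x" "j < length y"
    unfolding cube_nb_def by fastforce
  then obtain j' where "D = {i, j'}" using * by blast
  then have "card D \<le> 2" by (simp add: card_insert_if)
  moreover have "card (cube_nb x \<inter> cube_nb y) \<le> card D"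
    by (rule surj_card_le[OF _ sub]) (simp add: D_def)
  ultimately show ?thesis by linarith
qed simp

subsection \<open>Isoperimetry\<close>

text \<open>Minkowski's inequality in the plane, read off from the triangle inequality for complex
  numbers.\<close>

lemma sqrt_sum_le:
  fixes u v :: "'a \<Rightarrow> real"
  shows "sqrt ((\<Sum>x\<in>A. u x)\<^sup>2 + (\<Sum>x\<in>A. v x)\<^sup>2) \<le> (\<Sum>x\<in>A. sqrt ((u x)\<^sup>2 + (v x)\<^sup>2))"
proof -
  have "norm (\<Sum>x\<in>A. Complex (u x) (v x)) \<le> (\<Sum>x\<in>A. norm (Complex (u x) (v x)))"
    by (rule norm_sum)
  moreover have "(\<Sum>x\<in>A. Complex (u x) (v x)) = Complex (\<Sum>x\<in>A. u x) (\<Sum>x\<in>A. v x)"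
    by (simp add: complex_eq_iff)
  ultimately show ?thesis by (simp add: cmod_def)
qed

definition bdeg :: "nat \<Rightarrow> bool list set \<Rightarrow> bool list \<Rightarrow> real" where
  "bdeg n B x = card {i. i < n \<and> flip i x \<notin> B}"

lemma bdeg_nonneg: "bdeg n B x \<ge> 0"
  by (simp add: bdeg_def)

lemma bdeg_Suc:
  "bdeg (Suc n) B (b # y) = bdeg n {z. b # z \<in> B} y + of_bool ((\<not> b) # y \<notin> B)"
proof -
  have "{i. i < Suc n \<and> flip i (b # y) \<notin> B}
      = (if (\<not> b) # y \<notin> B then {0} else {}) \<union> Suc ` {i. i < n \<and> b # flip i y \<notin> B}"
  proof (rule set_eqI)
    fix i show "i \<in> {i. i < Suc n \<and> flip i (b # y) \<notin> B} \<longleftrightarrow>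
      i \<in> (if (\<not> b) # y \<notin> B then {0} else {}) \<union> Suc ` {i. i < n \<and> b # flip i y \<notin> B}"
      by (cases i) auto
  qed
  also have "card \<dots> = card (if (\<not> b) # y \<notin> B then {0 :: nat} else {}) + card (Suc ` {i. i < n \<and> b # flip i y \<notin> B})"
    by (intro card_Un_disjoint) auto
  finally show ?thesis by (simp add: bdeg_def card_image)
qed

text \<open>Here \<open>N = 2 ^ n\<close>, \<open>a\<close> and \<open>b\<close> are the sizes of
  the two halves of a set in dimension \<open>n + 1\<close>, and \<open>SX\<close>,
  \<open>SY\<close> are their boundary sums. The left-hand side is
  \<open>2 * a * (N - a) + 2 * b * (N - b) + (a - b)\<^sup>2\<close>; the last term is paid by the
  larger half through \<open>sqrt (J\<^sup>2 + D\<^sup>2) \<ge> J + D\<^sup>2 / (2 * N)\<close>,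
  which holds because \<open>J \<le> N / 4\<close> and \<open>D \<le> N\<close>.\<close>

lemma two_point_inequality:
  fixes a b N SX SY :: real
  assumes "0 \<le> b" "b \<le> a" "a \<le> N" "N > 0" "N * SX \<ge> a * (N - a)" "N * SY \<ge> b * (N - b)"
  shows "(a + b) * (2 * N - (a + b)) \<le> 2 * N * (sqrt (SX\<^sup>2 + (a - b)\<^sup>2) + SY)"
proof -
  define J where "J = a * (N - a) / N"
  define D where "D = a - b"
  have J0: "J \<ge> 0" using assms by (simp add: J_def)
  have J: "J \<le> SX" "N * J = a * (N - a)" using assms by (auto simp: J_def field_simps)
  have D: "0 \<le> D" "D \<le> N" using assms by (auto simp: D_def)
  have "(J + D\<^sup>2 / (2 * N))\<^sup>2 \<le> SX\<^sup>2 + D\<^sup>2"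
  proof -
    have "a * (N - a) \<le> N\<^sup>2 / 4"
    proof -
      have "0 \<le> (N / 2 - a)\<^sup>2" by simp
      then show ?thesis by (simp add: power2_eq_square algebra_simps)
    qed
    moreover have "D\<^sup>2 \<le> N\<^sup>2" using D by (intro power_mono) auto
    ultimately have "N * J + D\<^sup>2 / 4 \<le> N\<^sup>2" using J(2) zero_le_power2[of N] by linarith
    then have "D\<^sup>2 * (N * J + D\<^sup>2 / 4) \<le> D\<^sup>2 * N\<^sup>2" by (intro mult_left_mono) auto
    moreover have "(J + D\<^sup>2 / (2 * N))\<^sup>2 = J\<^sup>2 + D\<^sup>2 * (N * J + D\<^sup>2 / 4) / N\<^sup>2"
      using assms(4) by (simp add: power2_eq_square field_simps)
    ultimately have "(J + D\<^sup>2 / (2 * N))\<^sup>2 \<le> J\<^sup>2 + D\<^sup>2"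
      using assms(4) by (simp add: pos_divide_le_eq)
    moreover have "J\<^sup>2 \<le> SX\<^sup>2" using J0 J(1) by (intro power_mono) auto
    ultimately show ?thesis by linarith
  qed
  then have "J + D\<^sup>2 / (2 * N) \<le> sqrt (SX\<^sup>2 + D\<^sup>2)" by (rule real_le_rsqrt)
  then have "2 * N * (J + D\<^sup>2 / (2 * N)) \<le> 2 * N * sqrt (SX\<^sup>2 + D\<^sup>2)"
    using assms(4) by (intro mult_left_mono) auto
  moreover have "2 * N * (J + D\<^sup>2 / (2 * N)) = 2 * (a * (N - a)) + D\<^sup>2"
    using assms(4) J(2) by (simp add: algebra_simps)
  ultimately have "2 * (a * (N - a)) + D\<^sup>2 + 2 * (b * (N - b))
      \<le> 2 * N * sqrt (SX\<^sup>2 + D\<^sup>2) + 2 * (N * SY)"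
    using assms(6) by linarith
  moreover have "(a + b) * (2 * N - (a + b)) = 2 * (a * (N - a)) + D\<^sup>2 + 2 * (b * (N - b))"
    by (simp add: D_def power2_eq_square algebra_simps)
  ultimately show ?thesis by (simp add: D_def algebra_simps)
qed

text \<open>Talagrand's inequality for the square root of the boundary degree, by Bobkov's induction
  on the dimension; the two-point inequality above is what makes the induction step close.\<close>

lemma sqrt_bdeg_isoperimetry:
  assumes "B \<subseteq> {x. length x = n}"
  shows "real (card B) * (2 ^ n - real (card B)) \<le> 2 ^ n * (\<Sum>x\<in>B. sqrt (bdeg n B x))"
  using assms
proof (induction n arbitrary: B)
  case 0
  then have "B = {} \<or> B = {[]}" by auto
  then show ?case by (auto simp: bdeg_nonneg)
next
  case (Suc n)
  define S where "S b = {y. b # y \<in> B}" for b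
  have Sn: "S b \<subseteq> {x. length x = n}" for b using Suc.prems by (auto simp: S_def)
  have fin_len: "finite {x :: bool list. length x = k}" for k
    using finite_lists_length_eq[of "UNIV :: bool set" k] by simp
  have finS: "finite (S b)" for b using Sn fin_len by (rule finite_subset)
  have B: "B = (#) True ` S True \<union> (#) False ` S False"
  proof (rule set_eqI)
    fix x show "x \<in> B \<longleftrightarrow> x \<in> (#) True ` S True \<union> (#) False ` S False"
    proof (cases x)
      case Nil
      then show ?thesis using Suc.prems by auto
    next
      case (Cons a y)
      then show ?thesis by (cases a) (auto simp: S_def image_iff)
    qed
  qed
  have dis: "(#) True ` S True \<inter> (#) False ` S False = {}" by auto
  have cardB: "card B = card (S True) + card (S False)"
    unfolding B using finS dis by (subst card_Un_disjoint) (auto simp: card_image)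
  define T where "T b = (\<Sum>y\<in>S b. sqrt (bdeg n (S b) y + of_bool (y \<notin> S (\<not> b))))" for b
  have sumB: "(\<Sum>x\<in>B. sqrt (bdeg (Suc n) B x)) = T True + T False"
  proof -
    have "(\<Sum>x\<in>B. sqrt (bdeg (Suc n) B x))
        = (\<Sum>x\<in>(#) True ` S True. sqrt (bdeg (Suc n) B x)) + (\<Sum>x\<in>(#) False ` S False. sqrt (bdeg (Suc n) B x))"
      using sum.union_disjoint[of "(#) True ` S True" "(#) False ` S False"] finS dis B by auto
    then show ?thesis by (simp add: sum.reindex bdeg_Suc T_def S_def)
  qed
  have le: "card (S b) \<le> (2 :: real) ^ n" for b
  proof -
    have "card (S b) \<le> card {x :: bool list. length x = n}" by (rule card_mono[OF fin_len Sn])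
    also have "\<dots> = 2 ^ n" using card_lists_length_eq[of "UNIV :: bool set" n] by simp
    finally show ?thesis by (metis of_nat_le_iff of_nat_numeral of_nat_power)
  qed
  \<comment> \<open>The edges in the new direction are exploited in the larger half only; the
    variable \<open>b\<close> covers both orders of the halves.\<close>
  have main: "(real (card (S b)) + card (S (\<not> b))) * (2 * 2 ^ n - (real (card (S b)) + card (S (\<not> b))))
      \<le> 2 * 2 ^ n * (T b + T (\<not> b))" if ge: "card (S (\<not> b)) \<le> card (S b)" for b
  proof -
    define SX where "SX = (\<Sum>y\<in>S b. sqrt (bdeg n (S b) y))"
    define SY where "SY = (\<Sum>y\<in>S (\<not> b). sqrt (bdeg n (S (\<not> b)) y))"
    have SX0: "SX \<ge> 0" unfolding SX_def by (intro sum_nonneg) (simp add: bdeg_nonneg)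
    have "SY \<le> T (\<not> b)" unfolding SY_def T_def by (intro sum_mono real_sqrt_le_mono) auto
    moreover have "sqrt (SX\<^sup>2 + (real (card (S b)) - card (S (\<not> b)))\<^sup>2) \<le> T b"
    proof -
      have "real (card (S b)) - card (S (\<not> b)) \<le> card (S b - S (\<not> b))"
        using diff_card_le_card_Diff[OF finS[of "\<not> b"], of "S b"] by linarith
      also have "\<dots> = (\<Sum>y\<in>S b. of_bool (y \<notin> S (\<not> b)))"
        using finS by (simp add: Diff_eq Int_def Compl_eq)
      finally have "(real (card (S b)) - card (S (\<not> b)))\<^sup>2 \<le> (\<Sum>y\<in>S b. of_bool (y \<notin> S (\<not> b)))\<^sup>2"
        using ge by (intro power_mono) auto
      then have "sqrt (SX\<^sup>2 + (real (card (S b)) - card (S (\<not> b)))\<^sup>2)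
          \<le> sqrt (SX\<^sup>2 + (\<Sum>y\<in>S b. of_bool (y \<notin> S (\<not> b)))\<^sup>2)" by simp
      also have "\<dots> \<le> (\<Sum>y\<in>S b. sqrt ((sqrt (bdeg n (S b) y))\<^sup>2 + (of_bool (y \<notin> S (\<not> b)))\<^sup>2))"
        unfolding SX_def by (rule sqrt_sum_le)
      also have "\<dots> = T b" unfolding T_def by (intro sum.cong) (auto simp: bdeg_nonneg)
      finally show ?thesis .
    qed
    moreover have "(real (card (S b)) + card (S (\<not> b))) * (2 * 2 ^ n - (real (card (S b)) + card (S (\<not> b))))
        \<le> 2 * 2 ^ n * (sqrt (SX\<^sup>2 + (real (card (S b)) - card (S (\<not> b)))\<^sup>2) + SY)"
      unfolding SX_def SY_def
      by (rule two_point_inequality) (use ge le Suc.IH[OF Sn] in auto)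
    moreover have "2 * 2 ^ n * (sqrt (SX\<^sup>2 + (real (card (S b)) - card (S (\<not> b)))\<^sup>2) + SY)
        \<le> 2 * 2 ^ n * (T b + T (\<not> b))" using calculation(1,2) by (intro mult_left_mono) auto
    ultimately show ?thesis by linarith
  qed
  have "card (S False) \<le> card (S True) \<or> card (S True) \<le> card (S False)" by linarith
  then show ?case
  proof
    assume "card (S False) \<le> card (S True)"
    then show ?thesis using main[of True] by (simp add: cardB sumB)
  next
    assume "card (S True) \<le> card (S False)"
    then show ?thesis using main[of False] by (simp add: cardB sumB add.commute)
  qed
qed

text \<open>The inequality is applied to the complement \<open>B\<close>, whose vertices with an
  edge into \<open>A\<close> form the boundary in question. Their boundary degree is at most
  \<open>n\<close>, hence \<open>sqrt n\<close>, and \<open>B\<close> fills at least half of the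
  cube, hence the 2.\<close>

lemma vertex_isoperimetry:
  assumes "A \<subseteq> {x. length x = n}" "2 * card A \<le> 2 ^ n"
  shows "card A \<le> 2 * sqrt n * card {x. length x = n \<and> x \<notin> A \<and> (\<exists>i<n. flip i x \<in> A)}"
proof -
  let ?V = "{x :: bool list. length x = n}"
  define B where "B = ?V - A"
  define bd where "bd = {x. length x = n \<and> x \<notin> A \<and> (\<exists>i<n. flip i x \<in> A)}"
  have fin: "finite ?V" using finite_lists_length_eq[of "UNIV :: bool set" n] by simp
  have cV: "card ?V = 2 ^ n" using card_lists_length_eq[of "UNIV :: bool set" n] by simp
  have finA: "finite A" using assms(1) fin by (rule finite_subset)
  have "card B = 2 ^ n - card A" unfolding B_def using card_Diff_subset[OF finA assms(1)] cV by simp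
  then have cB: "real (card B) = 2 ^ n - real (card A)"
    using card_mono[OF fin assms(1)] cV by simp
  have "real (card B) * (2 ^ n - real (card B)) \<le> 2 ^ n * (\<Sum>x\<in>B. sqrt (bdeg n B x))"
    by (rule sqrt_bdeg_isoperimetry) (auto simp: B_def)
  also have "(\<Sum>x\<in>B. sqrt (bdeg n B x)) = (\<Sum>x\<in>bd. sqrt (bdeg n B x))"
  proof (rule sum.mono_neutral_right)
    show "finite B" using fin by (simp add: B_def)
    show "bd \<subseteq> B" by (auto simp: bd_def B_def)
    show "\<forall>x\<in>B - bd. sqrt (bdeg n B x) = 0"
    proof
      fix x assume "x \<in> B - bd"
      then have "{i. i < n \<and> flip i x \<notin> B} = {}" by (auto simp: B_def bd_def)
      then show "sqrt (bdeg n B x) = 0" by (simp only: bdeg_def) simp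
    qed
  qed
  also have "\<dots> \<le> (\<Sum>x\<in>bd. sqrt n)"
  proof (intro sum_mono real_sqrt_le_mono)
    fix x
    have "card {i. i < n \<and> flip i x \<notin> B} \<le> card {..<n}" by (intro card_mono) auto
    then show "bdeg n B x \<le> n" by (simp add: bdeg_def)
  qed
  also have "\<dots> = sqrt n * card bd" by simp
  finally have "(2 ^ n - real (card A)) * card A \<le> 2 ^ n * (sqrt n * card bd)" by (simp add: cB)
  moreover have "(2 ^ n / 2) * card A \<le> (2 ^ n - real (card A)) * card A"
  proof (rule mult_right_mono)
    have "real (2 * card A) \<le> real (2 ^ n)" using assms(2) by (rule of_nat_mono)
    then show "2 ^ n / 2 \<le> (2 ^ n - real (card A))" by simp
  qed simp
  ultimately have "2 ^ n * real (card A) \<le> 2 ^ n * (2 * (sqrt n * card bd))" by linarith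
  then show ?thesis by (simp add: bd_def)
qed

subsection \<open>The two sides of the hypercube\<close>

text \<open>The Boolean (\<open>True\<close> for even) lets one argument serve both sides.\<close>

definition side :: "nat \<Rightarrow> bool \<Rightarrow> bool list set" where
  "side d b = {x. length x = d \<and> even (count_list x True) = b}"

lemma even_verts_eq: "even_verts d = side d True"
  and odd_verts_eq: "odd_verts d = side d False"
  by (auto simp: even_verts_def odd_verts_def side_def hypercube_def)

lemma finite_side: "finite (side d b)"
  by (rule finite_subset[OF _ finite_pverts_hypercube[of d]]) (auto simp: side_def hypercube_def)

lemma side_Un: "side d b \<union> side d (\<not> b) = {x. length x = d}"
  by (auto simp: side_def)

text \<open>Parity recovers the deleted bit.\<close>

lemma inj_on_tl_side: "inj_on tl (side (Suc n) b)"
proof (rule inj_onI)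
  fix x y assume x: "x \<in> side (Suc n) b" and y: "y \<in> side (Suc n) b" and eq: "tl x = tl y"
  obtain u where u: "x = u # tl x" using x by (cases x) (auto simp: side_def)
  obtain v where v: "y = v # tl y" using y by (cases y) (auto simp: side_def)
  have "even (count_list (u # tl x) True) = b" "even (count_list (v # tl x) True) = b"
    using x y u v eq by (auto simp: side_def)
  then have "u = v" by (auto split: if_splits)
  then show "x = y" using u v eq by simp
qed

text \<open>Deleting the first coordinate maps a side injectively into the cube of dimension
  \<open>d - 1\<close>. Flipping the first bit of \<open>A\<close> projects to the image of
  \<open>A\<close>, flipping later bits reaches its vertex boundary, so \<open>Nb A\<close> covers
  both after projection.\<close>

lemma side_expansion:
  assumes A: "A \<subseteq> side d b" "2 * card A \<le> card (side d b)" and d: "d > 0" and card: "2 * card (side d b) = 2 ^ d"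
  shows "(1 + 1 / (2 * sqrt d)) * card A \<le> card (\<Union>x\<in>A. cube_nb x)"
proof -
  obtain n where n: "d = Suc n" using d by (cases d) auto
  define N where "N = (\<Union>x\<in>A. cube_nb x)"
  define A' where "A' = tl ` A"
  define bd where "bd = {x. length x = n \<and> x \<notin> A' \<and> (\<exists>i<n. flip i x \<in> A')}"
  have finA: "finite A" using A(1) finite_side by (rule finite_subset)
  have finN: "finite N" using finA finite_cube_nb by (simp add: N_def)
  have len: "length x = Suc n" if "x \<in> A" for x using A(1) that n by (auto simp: side_def)
  have cA: "card A' = card A"
    unfolding A'_def using inj_on_subset[OF inj_on_tl_side A(1)[unfolded n]] by (rule card_image)
  have Alen: "A' \<subseteq> {x. length x = n}" using len by (auto simp: A'_def)
  have finbd: "finite bd"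
    by (rule finite_subset[OF _ finite_pverts_hypercube[of n]]) (auto simp: bd_def hypercube_def)
  have sub: "A' \<union> bd \<subseteq> tl ` N"
  proof
    fix z assume "z \<in> A' \<union> bd"
    then show "z \<in> tl ` N"
    proof
      assume "z \<in> A'"
      then obtain x where x: "x \<in> A" "z = tl x" by (auto simp: A'_def)
      then obtain u where u: "x = u # z" using len[OF x(1)] by (cases x) auto
      have "flip 0 x = (\<not> u) # z" unfolding u by simp
      moreover have "flip 0 x \<in> cube_nb x"
        unfolding cube_nb_def using len[OF x(1)] by (intro imageI) auto
      then have "flip 0 x \<in> N" using x(1) by (auto simp: N_def)
      ultimately show ?thesis by (metis imageI list.sel(3))
    next
      assume "z \<in> bd"
      then obtain i where i: "i < n" "length z = n" "flip i z \<in> A'" by (auto simp: bd_def)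
      then obtain x where x: "x \<in> A" "flip i z = tl x" by (auto simp: A'_def)
      then obtain u where u: "x = u # flip i z" using len[OF x(1)] by (cases x) auto
      then have "flip (Suc i) x = u # z" by (simp add: flip_flip)
      moreover have "flip (Suc i) x \<in> cube_nb x"
        unfolding cube_nb_def using len[OF x(1)] i(1) by (intro imageI) auto
      then have "flip (Suc i) x \<in> N" using x(1) by (auto simp: N_def)
      ultimately show ?thesis by (metis imageI list.sel(3))
    qed
  qed
  have "A' \<inter> bd = {}" "finite A'" using finA by (auto simp: bd_def A'_def)
  then have "card A + card bd = card (A' \<union> bd)"
    using finbd by (simp add: card_Un_disjoint cA)
  also have "\<dots> \<le> card (tl ` N)" using sub finN by (intro card_mono) auto
  also have "\<dots> \<le> card N" by (rule card_image_le[OF finN])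
  finally have N: "card A + card bd \<le> card N" .
  have "card A' \<le> 2 * sqrt n * card bd"
    unfolding bd_def by (rule vertex_isoperimetry[OF Alen]) (use A(2) card n cA in simp)
  also have "\<dots> \<le> 2 * sqrt d * card bd" by (intro mult_right_mono) (auto simp: n)
  finally have "card A / (2 * sqrt d) \<le> card bd" using d by (simp add: cA field_simps)
  moreover have "real (card A) + card bd \<le> card N" using N by (simp flip: of_nat_add)
  ultimately show ?thesis by (simp add: N_def algebra_simps)
qed

lemma regular_bipartite_cube:
  assumes "d > 0"
  shows "regular_bipartite (side d b) (side d (\<not> b)) cube_nb d"
proof
  have nb: "cube_nb x \<subseteq> side d (\<not> b)" if "x \<in> side d b" for x b
  proof
    fix y assume "y \<in> cube_nb x"
    then obtain i where "i < length x" "y = flip i x" by (auto simp: cube_nb_def)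
    then show "y \<in> side d (\<not> b)" using that parity_flip[of i x] by (auto simp: side_def)
  qed
  show "cube_nb x \<subseteq> side d (\<not> b)" if "x \<in> side d b" for x by (rule nb[OF that])
  show "cube_nb x \<subseteq> side d b" if "x \<in> side d (\<not> b)" for x using nb[OF that] by simp
  show "y \<in> cube_nb x \<longleftrightarrow> x \<in> cube_nb y" for x y by (rule cube_nb_sym)
  show "side d b \<inter> side d (\<not> b) = {}" by (auto simp: side_def)
  show "card (cube_nb x) = d" if "x \<in> side d b \<union> side d (\<not> b)" for x
    using that by (auto simp: card_cube_nb side_def)
qed (simp_all add: finite_side assms)

lemma card_side:
  assumes "d > 0"
  shows "2 * card (side d b) = 2 ^ d"
proof -
  interpret regular_bipartite "side d b" "side d (\<not> b)" cube_nb d by (rule regular_bipartite_cube[OF assms])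
  have "card (side d b) + card (side d (\<not> b)) = card (side d b \<union> side d (\<not> b))"
    using finite_P finite_Q PQ_disjoint by (simp add: card_Un_disjoint)
  also have "\<dots> = 2 ^ d" unfolding side_Un using card_lists_length_eq[of "UNIV :: bool set" d] by simp
  finally show ?thesis using card_P_eq_card_Q by simp
qed

lemma expanding_bipartite_cube:
  assumes "d > 0" "lam > 0"
  shows "expanding_bipartite (side d b) (side d (\<not> b)) cube_nb d lam"
proof -
  interpret regular_bipartite "side d b" "side d (\<not> b)" cube_nb d by (rule regular_bipartite_cube[OF assms(1)])
  show ?thesis
  proof
    show "card (cube_nb x \<inter> cube_nb y) \<le> 2" if "x \<in> side d b" "y \<in> side d b" "x \<noteq> y" for x y
      using that by (intro codegree_cube) (auto simp: side_def)
    show "(1 + 1 / (2 * sqrt d)) * card A \<le> card (Nb A)"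
      if "A \<subseteq> side d b" "2 * card A \<le> card (side d b)" for A
      using side_expansion[OF that assms(1) card_side[OF assms(1)]] by (simp add: Nb_def)
  qed (rule assms(2))
qed

subsection \<open>2-linked sets\<close>

lemma rtrancl_on_Restr: "a \<in> S \<Longrightarrow> (a, b) \<in> rtrancl_on S (Restr r S) \<longleftrightarrow> (a, b) \<in> (Restr r S)\<^sup>*"
proof
  assume "a \<in> S" "(a, b) \<in> (Restr r S)\<^sup>*"
  from this(2,1) show "(a, b) \<in> rtrancl_on S (Restr r S)"
    by induction (auto intro: rtrancl_on_into_rtrancl_on)
qed (rule rtrancl_on_rtranclI)

text \<open>The library defines connectedness through the symmetric closure, which changes nothing
  when the arcs are symmetric.\<close>

lemma connected_induce_subgraph_iff:
  assumes "sym (parcs H)"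
  shows "Digraph_Component.connected (induce_subgraph (with_proj H) S) \<longleftrightarrow> conn (parcs H) S"
proof -
  have "parcs (mk_symmetric (induce_subgraph (with_proj H) S)) = Restr (parcs H) S"
    using assms by (auto simp: parcs_mk_symmetric dest: symD)
  then show ?thesis
    unfolding Digraph_Component.connected_def strongly_connected_def conn_def reachable_def
    by (simp add: rtrancl_on_Restr)
qed

text \<open>Both directions move cuts. A cut of \<open>C\<close> is enlarged by its neighbourhood; a
  cut of \<open>C \<union> Nb C\<close> is crossed either between a vertex and its neighbour, or on
  the way from one of two linked vertices to the other through a common neighbour.\<close>

lemma (in regular_bipartite) conn_Nb_iff:
  assumes C: "C \<subseteq> P"
  shows "conn {(x, y). x \<in> P \<union> Q \<and> y \<in> nb x} (C \<union> Nb C) \<longleftrightarrow> conn lnk C"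
proof
  let ?r = "{(x, y). x \<in> P \<union> Q \<and> y \<in> nb x}"
  have NC: "Nb C \<subseteq> Q" by (rule Nb_subset[OF C])
  {
    assume L: "conn ?r (C \<union> Nb C)"
    show "conn lnk C"
    proof (rule connI_cut)
      show "C \<noteq> {}" using L by (auto simp: conn_def Nb_def)
      fix T assume T: "T \<subseteq> C" "T \<noteq> {}" "T \<noteq> C"
      have T': "T \<union> Nb T \<subseteq> C \<union> Nb C" "T \<union> Nb T \<noteq> {}" using T by (auto simp: Nb_def)
      have T'': "T \<union> Nb T \<noteq> C \<union> Nb C"
      proof -
        obtain c where c: "c \<in> C" "c \<notin> T" using T by auto
        have "Nb T \<subseteq> Q" using NC Nb_mono[OF T(1)] by auto
        then have "c \<notin> Nb T" using c C PQ_disjoint by auto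
        then show ?thesis using c by auto
      qed
      obtain x y where xy: "x \<in> T \<union> Nb T" "y \<in> C \<union> Nb C - (T \<union> Nb T)" "(x, y) \<in> ?r"
        by (rule conn_cut[OF L T' T''])
      have "x \<notin> T" using xy by (auto simp: Nb_def)
      then have x: "x \<in> Nb T" using xy by blast
      then have "x \<in> Q" using NC Nb_mono[OF T(1)] by blast
      then have "y \<in> P" using xy(3) nb_Q by auto
      then have y: "y \<in> C - T" using xy(2) NC PQ_disjoint by auto
      obtain z where z: "z \<in> T" "x \<in> nb z" using x by (auto simp: Nb_def)
      have "x \<in> nb y" using nb_sym[OF \<open>y \<in> P\<close> \<open>x \<in> Q\<close>] xy(3) by auto
      then have "(z, y) \<in> lnk" using z T C \<open>y \<in> P\<close> by (auto simp: lnk_def)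
      then show "\<exists>x\<in>T. \<exists>y\<in>C - T. (x, y) \<in> lnk" using z y by blast
    qed
  }
  {
    assume R: "conn lnk C"
    show "conn ?r (C \<union> Nb C)"
    proof (rule connI_cut)
      show "C \<union> Nb C \<noteq> {}" using R by (auto simp: conn_def)
      fix T assume T: "T \<subseteq> C \<union> Nb C" "T \<noteq> {}" "T \<noteq> C \<union> Nb C"
      consider "T \<inter> C = {}" | "C \<subseteq> T" | "T \<inter> C \<noteq> {}" "T \<inter> C \<noteq> C" by blast
      then show "\<exists>x\<in>T. \<exists>y\<in>C \<union> Nb C - T. (x, y) \<in> ?r"
      proof cases
        case 1
        then obtain y where y: "y \<in> T" "y \<in> Nb C" using T by blast
        then obtain c where c: "c \<in> C" "y \<in> nb c" by (auto simp: Nb_def)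
        then have "c \<in> nb y" using nb_sym[of c y] C NC y by auto
        then have "(y, c) \<in> ?r" using y NC by auto
        then show ?thesis using y c 1 by blast
      next
        case 2
        then obtain y where y: "y \<notin> T" "y \<in> Nb C" using T by blast
        then obtain c where c: "c \<in> C" "y \<in> nb c" by (auto simp: Nb_def)
        then have "(c, y) \<in> ?r" using C by auto
        then show ?thesis using y c 2 by blast
      next
        case 3
        obtain c c' where cc: "c \<in> T \<inter> C" "c' \<in> C - T \<inter> C" "(c, c') \<in> lnk"
          by (rule conn_cut[OF R inf_le2 3])
        then obtain z where z: "z \<in> nb c" "z \<in> nb c'" by (auto simp: lnk_def)
        have zN: "z \<in> Nb C" using z cc by (auto simp: Nb_def)
        have "c' \<in> nb z" using nb_sym[of c' z] z cc C zN NC by auto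
        then have r: "(c, z) \<in> ?r" "(z, c') \<in> ?r" using z cc C zN NC by auto
        show ?thesis
        proof (cases "z \<in> T")
          case True
          then show ?thesis using r(2) cc by blast
        next
          case False
          then show ?thesis using r(1) cc zN by blast
        qed
      qed
    qed
  }
qed

lemma two_components_eq:
  assumes d: "d > 0" and A: "A \<subseteq> side d b"
  shows "two_components d A = comps (regular_bipartite.lnk (side d b) cube_nb) A"
proof -
  interpret regular_bipartite "side d b" "side d (\<not> b)" cube_nb d by (rule regular_bipartite_cube[OF d])
  have sym: "sym (parcs (hypercube d))"
    using cube_nb_sym length_cube_nb by (fastforce simp: sym_def parcs_hypercube_iff)
  have par: "parcs (hypercube d) = {(x, y). x \<in> side d b \<union> side d (\<not> b) \<and> y \<in> cube_nb x}"
    unfolding side_Un by (auto simp: parcs_hypercube_iff)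
  have iff: "two_linked d C \<longleftrightarrow> conn lnk C" if C: "C \<subseteq> side d b" for C
  proof -
    have "neighbourhood (hypercube d) C = Nb C"
    proof -
      have "Nb C \<subseteq> pverts (hypercube d)" "Nb C \<inter> C = {}"
        using Nb_subset[OF C] C by (auto simp: hypercube_def side_def)
      moreover have "(\<exists>x\<in>C. (x, y) \<in> parcs (hypercube d)) \<longleftrightarrow> y \<in> Nb C" for y
        using C by (auto simp: Nb_def parcs_hypercube_iff side_def)
      ultimately show ?thesis unfolding neighbourhood_def by auto
    qed
    moreover have "C \<subseteq> even_verts d \<or> C \<subseteq> odd_verts d"
      using C by (cases b) (auto simp: even_verts_eq odd_verts_eq)
    ultimately show ?thesis
      unfolding two_linked_def connected_induce_subgraph_iff[OF sym]
      using conn_Nb_iff[OF C] by (simp add: par)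
  qed
  have "C \<in> two_components d A \<longleftrightarrow> C \<in> comps lnk A" for C
  proof
    assume "C \<in> two_components d A"
    then have C: "C \<subseteq> A" "two_linked d C"
      "\<And>C'. C \<subseteq> C' \<Longrightarrow> C' \<subseteq> A \<Longrightarrow> two_linked d C' \<Longrightarrow> C' = C" by (auto simp: two_components_def)
    show "C \<in> comps lnk A"
      by (rule compsI) (use C iff A in \<open>meson order_trans\<close>)+
  next
    assume C: "C \<in> comps lnk A"
    have "C' = C" if "C \<subseteq> C'" "C' \<subseteq> A" "two_linked d C'" for C'
    proof (rule comps_maximal[OF C that(1,2)])
      show "conn lnk C'" using iff[of C'] that A by auto
    qed
    then show "C \<in> two_components d A"
      using compsD[OF C] iff[of C] A unfolding two_components_def by auto
  qed
  then show ?thesis by blast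
qed

lemma Ind_cube:
  fixes lam :: real
  assumes "d > 0" "lam > 0"
  shows "hard_core_bipartite.Ind (side d b) (side d (\<not> b)) cube_nb = independent_sets (hypercube d)"
proof -
  interpret expanding_bipartite "side d b" "side d (\<not> b)" cube_nb d lam
    by (rule expanding_bipartite_cube[OF assms])
  show ?thesis
    unfolding Ind_def side_Un independent_sets_def
    by (auto simp: parcs_hypercube_iff) (auto simp: hypercube_def)
qed

lemma prob_cube:
  fixes lam :: real
  assumes "d > 0" "lam > 0"
  shows "measure_pmf.prob (hard_core (hypercube d) lam) {I. \<Phi> I}
    = hard_core_bipartite.EI (side d b) (side d (\<not> b)) cube_nb lam (\<lambda>I. of_bool (\<Phi> I))"
proof -
  interpret expanding_bipartite "side d b" "side d (\<not> b)" cube_nb d lam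
    by (rule expanding_bipartite_cube[OF assms])
  let ?p = "hard_core (hypercube d) lam"
  have pmf: "pmf ?p I = (if I \<in> Ind then lam ^ card I / (\<Sum>J\<in>Ind. lam ^ card J) else 0)" for I
    unfolding Ind_cube[OF assms] using pmf_hard_core[OF finite_pverts_hypercube assms(2)] by simp
  have "set_pmf ?p \<subseteq> Ind" by (auto simp: set_pmf_iff pmf split: if_splits)
  then have "measure_pmf.prob ?p {I. \<Phi> I} = measure_pmf.prob ?p {I \<in> Ind. \<Phi> I}"
    by (intro measure_pmf.finite_measure_eq_AE) (auto simp: AE_measure_pmf_iff)
  also have "\<dots> = (\<Sum>I\<in>{I \<in> Ind. \<Phi> I}. pmf ?p I)"
    using finite_Ind by (intro measure_measure_pmf_finite) auto
  also have "\<dots> = (\<Sum>I\<in>{I \<in> Ind. \<Phi> I}. lam ^ card I / (\<Sum>J\<in>Ind. lam ^ card J))"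
    by (intro sum.cong) (auto simp: pmf)
  also have "\<dots> = (\<Sum>I\<in>Ind. of_bool (\<Phi> I) * lam ^ card I / (\<Sum>J\<in>Ind. lam ^ card J))"
    using finite_Ind by (subst sum.inter_filter) (auto intro!: sum.cong)
  also have "\<dots> = EI (\<lambda>I. of_bool (\<Phi> I))" by (simp add: EI_def sum_divide_distrib)
  finally show ?thesis .
qed

section \<open>Asymptotics\<close>

definition hc_prob :: "real \<Rightarrow> nat \<Rightarrow> (bool list set \<Rightarrow> bool) \<Rightarrow> real" where
  "hc_prob lam d \<Phi> = measure_pmf.prob (hard_core (hypercube d) lam) {I. \<Phi> I}"

text \<open>Formulated without the locale constants, so that the dimension can vary and both sides
  can occur in one event.\<close>

definition comps_le :: "nat \<Rightarrow> nat \<Rightarrow> bool \<Rightarrow> bool list set \<Rightarrow> bool" where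
  "comps_le m d b I \<longleftrightarrow> (\<forall>C\<in>two_components d (I \<inter> side d b). card C \<le> m)"

definition singletons :: "nat \<Rightarrow> bool \<Rightarrow> bool list set \<Rightarrow> nat" where
  "singletons d b I = card {C \<in> two_components d (I \<inter> side d b). card C = 1}"

definition hc_mean :: "real \<Rightarrow> nat \<Rightarrow> real" where
  "hc_mean lam d = lam / 2 * (2 / (1 + lam)) ^ d"

text \<open>The bound of \<open>small_sum_le\<close> for a graph with \<open>2 ^ d\<close>
  vertices.\<close>

definition larger_bound :: "real \<Rightarrow> nat \<Rightarrow> nat \<Rightarrow> real" where
  "larger_bound lam m d = 2 ^ d * (real (Suc d) ^ 12) ^ m * (1 + lam) ^ (m + m ^ 2) / (1 + lam) ^ (2 * d)"

lemma hc_prob_nonneg: "hc_prob lam d \<Phi> \<ge> 0" and hc_prob_le_1: "hc_prob lam d \<Phi> \<le> 1"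
  by (simp_all add: hc_prob_def)

lemma set_hard_core:
  assumes "lam > 0"
  shows "set_pmf (hard_core (hypercube d) lam) \<subseteq> independent_sets (hypercube d)"
  using pmf_hard_core[OF finite_pverts_hypercube assms] by (auto simp: set_pmf_iff split: if_splits)

lemma hc_prob_mono:
  assumes "lam > 0" "\<And>I. I \<in> independent_sets (hypercube d) \<Longrightarrow> \<Phi> I \<Longrightarrow> \<Psi> I"
  shows "hc_prob lam d \<Phi> \<le> hc_prob lam d \<Psi>"
  unfolding hc_prob_def
  by (intro measure_pmf.finite_measure_mono_AE AE_pmfI) (use assms set_hard_core in auto)

lemma hc_prob_not: "hc_prob lam d (\<lambda>I. \<not> \<Phi> I) = 1 - hc_prob lam d \<Phi>"
proof -
  have "{I. \<not> \<Phi> I} = space (measure_pmf (hard_core (hypercube d) lam)) - {I. \<Phi> I}" by auto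
  then show ?thesis unfolding hc_prob_def by (simp only: measure_pmf.prob_compl sets_measure_pmf UNIV_I)
qed

lemma hc_prob_disj_conj: "hc_prob lam d (\<lambda>I. \<Phi> I \<or> \<Psi> I) + hc_prob lam d (\<lambda>I. \<Phi> I \<and> \<Psi> I) = hc_prob lam d \<Phi> + hc_prob lam d \<Psi>"
proof -
  have "measure_pmf.prob (hard_core (hypercube d) lam) ({I. \<Phi> I} \<union> {I. \<Psi> I})
      = hc_prob lam d \<Phi> + hc_prob lam d \<Psi> - measure_pmf.prob (hard_core (hypercube d) lam) ({I. \<Phi> I} \<inter> {I. \<Psi> I})"
    unfolding hc_prob_def by (intro measure_Un3) (simp_all add: measure_pmf.fmeasurable_eq_sets)
  then show ?thesis by (simp add: hc_prob_def Collect_disj_eq Collect_conj_eq)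
qed

lemma hc_prob_disj_le: "hc_prob lam d (\<lambda>I. \<Phi> I \<or> \<Psi> I) \<le> hc_prob lam d \<Phi> + hc_prob lam d \<Psi>"
  using hc_prob_disj_conj[of lam d \<Phi> \<Psi>] hc_prob_nonneg[of lam d "\<lambda>I. \<Phi> I \<and> \<Psi> I"] by linarith

section \<open>The estimates for one side of the hypercube\<close>

locale hypercube_hard_core =
  fixes lam :: real and d :: nat and b :: bool
  assumes d0: "d > 0" and lam0: "lam > 0"

sublocale hypercube_hard_core \<subseteq> expanding_bipartite "side d b" "side d (\<not> b)" cube_nb d lam
  by (rule expanding_bipartite_cube[OF d0 lam0])

context hypercube_hard_core
begin

lemma hc_prob_eq_EI: "hc_prob lam d \<Phi> = EI (\<lambda>I. of_bool (\<Phi> I))"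
  unfolding hc_prob_def by (rule prob_cube[OF d0 lam0])

lemma two_components_Int: "two_components d (I \<inter> side d b) = comps lnk (I \<inter> side d b)"
  by (rule two_components_eq[OF d0]) simp

lemma comps_le_iff: "comps_le m d b I \<longleftrightarrow> good m (I \<inter> side d b)"
  by (simp add: comps_le_def good_def two_components_Int)

lemma singletons_eq: "singletons d b I = k1 (I \<inter> side d b)"
  by (simp add: singletons_def two_components_Int k1_eq_card_comps)

lemma card_side_real: "real (card (side d b)) = 2 ^ d / 2"
proof -
  have "real (2 * card (side d b)) = real (2 ^ d)" by (simp only: card_side[OF d0])
  then show ?thesis by simp
qed

lemma card_both: "card (side d b \<union> side d (\<not> b)) = 2 ^ d"
  unfolding side_Un using card_lists_length_eq[of "UNIV :: bool set" d] by simp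

lemma mu_eq: "mu = hc_mean lam d"
  by (simp add: mu_def hc_mean_def w1_def card_side_real power_divide)

lemma small_sum_le_larger: "small_sum m \<le> larger_bound lam m d"
  using small_sum_le[of m] by (simp add: larger_bound_def card_both)

lemma size_sum_le: "size_sum m \<le> hc_mean lam d + m * larger_bound lam m d"
  unfolding size_sum_def mu_eq using small_sum_le_larger[of m] by (simp add: mult_left_mono)

lemma hc_prob_singletons_deviation:
  assumes "m \<ge> 1" "s > 0"
  shows "hc_prob lam d (\<lambda>I. comps_le m d b I \<and> s < \<bar>real (singletons d b I) - hc_mean lam d\<bar>)
    \<le> (hc_mean lam d + 2 * hc_mean lam d * (w1 * d ^ 2 * size_sum m)) / s\<^sup>2"
  using EI_k1_chebyshev[OF assms] by (simp add: hc_prob_eq_EI comps_le_iff singletons_eq mu_eq)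

lemma hc_prob_larger_comps:
  assumes "s > 0"
  shows "hc_prob lam d (\<lambda>I. comps_le m d b I \<and> real (singletons d b I) + s < card (two_components d (I \<inter> side d b)))
    \<le> larger_bound lam m d / s"
proof -
  have "hc_prob lam d (\<lambda>I. comps_le m d b I \<and> real (singletons d b I) + s < card (two_components d (I \<inter> side d b)))
      \<le> EI (\<lambda>I. of_bool (good m (I \<inter> side d b)) * real (card {C \<in> comps lnk (I \<inter> side d b). card C \<ge> 2})) / s"
    unfolding hc_prob_eq_EI
    by (rule EI_markov[OF assms])
      (auto simp: comps_le_iff singletons_eq two_components_Int card_comps_split)
  also have "\<dots> \<le> larger_bound lam m d / s"
    using EI_larger_comps_le[of m] small_sum_le_larger[of m] assms by (intro divide_right_mono) auto
  finally show ?thesis .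
qed

lemma hc_prob_unbalanced:
  "hc_prob lam d (\<lambda>I. comps_le m d b I \<and> card (I \<inter> side d (\<not> b)) \<le> card (I \<inter> side d b))
    \<le> (hc_mean lam d + m * larger_bound lam m d) / (2 ^ d / (4 * d))
      + 2 powr (2 ^ d / (4 * d)) * ((1 + lam / 2) / (1 + lam)) powr (2 ^ d / 4)"
proof -
  \<comment> \<open>Chosen such that \<open>d * s = 2 ^ d / 4\<close>: a part of this size blocks at
    most half of the opposite side.\<close>
  define s :: real where "s = 2 ^ d / (4 * d)"
  have s: "s > 0" using d0 by (simp add: s_def)
  have "hc_prob lam d (\<lambda>I. comps_le m d b I \<and> card (I \<inter> side d (\<not> b)) \<le> card (I \<inter> side d b))
      \<le> hc_prob lam d (\<lambda>I. (comps_le m d b I \<and> s \<le> card (I \<inter> side d b))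
        \<or> (card (I \<inter> side d b) \<le> s \<and> card (I \<inter> side d (\<not> b)) \<le> card (I \<inter> side d b)))"
    by (rule hc_prob_mono[OF lam0]) auto
  also have "\<dots> \<le> hc_prob lam d (\<lambda>I. comps_le m d b I \<and> s \<le> card (I \<inter> side d b))
      + hc_prob lam d (\<lambda>I. card (I \<inter> side d b) \<le> s \<and> card (I \<inter> side d (\<not> b)) \<le> card (I \<inter> side d b))"
    by (rule hc_prob_disj_le)
  also have "hc_prob lam d (\<lambda>I. comps_le m d b I \<and> s \<le> card (I \<inter> side d b))
      \<le> EI (\<lambda>I. of_bool (good m (I \<inter> side d b)) * real (card (I \<inter> side d b))) / s"
    unfolding hc_prob_eq_EI by (rule EI_markov[OF s]) (auto simp: comps_le_iff)
  also have "\<dots> \<le> (hc_mean lam d + m * larger_bound lam m d) / s"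
    using EI_size_le[of m] size_sum_le[of m] s by (intro divide_right_mono) auto
  also have "hc_prob lam d (\<lambda>I. card (I \<inter> side d b) \<le> s \<and> card (I \<inter> side d (\<not> b)) \<le> card (I \<inter> side d b))
      \<le> 2 powr s * ((1 + lam / 2) / (1 + lam)) powr (real (card (side d b)) - d * s)"
    unfolding hc_prob_eq_EI using EI_unbalanced_le[of s] s by simp
  also have "real (card (side d b)) - d * s = 2 ^ d / 4"
    using d0 by (simp add: card_side_real s_def field_simps)
  finally show ?thesis by (simp add: s_def)
qed

lemma hc_prob_bad_side:
  "hc_prob lam d (\<lambda>I. 2 * card (cl (I \<inter> side d b)) \<le> card (side d b) \<and> \<not> comps_le m d b I) \<le> bad_sum m"
  using EI_bad_le[of m] by (simp add: hc_prob_eq_EI comps_le_iff)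

lemma comps_le_0_imp_empty:
  assumes "comps_le 0 d b I"
  shows "I \<inter> side d b = {}"
proof -
  have fin: "finite (I \<inter> side d b)" using finite_side by simp
  have "card (I \<inter> side d b) = (\<Sum>C\<in>comps lnk (I \<inter> side d b). card C)"
    by (rule card_eq_sum_comps[OF sym_lnk fin])
  also have "\<dots> = 0" using assms by (simp add: comps_le_iff good_def)
  finally show ?thesis using fin by simp
qed

lemma singletons_comps_le_1:
  assumes "comps_le 1 d b I"
  shows "(\<forall>C\<in>two_components d (I \<inter> side d b). card C = 1) \<and>
    card (two_components d (I \<inter> side d b)) = singletons d b I"
proof -
  have "card C = 1" if C: "C \<in> two_components d (I \<inter> side d b)" for C
  proof -
    have "C \<subseteq> side d b" "C \<noteq> {}" using C compsD[of C lnk "I \<inter> side d b"] by (auto simp: two_components_Int)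
    then have "card C \<noteq> 0" using finite_side[of d b] by (auto dest: finite_subset)
    moreover have "card C \<le> 1" using assms C by (simp add: comps_le_def)
    ultimately show ?thesis by linarith
  qed
  then show ?thesis unfolding singletons_def by (metis (mono_tags, lifting) Collect_cong Collect_mem_eq)
qed

lemma size_sum_1: "size_sum 1 = hc_mean lam d"
proof -
  have "{C. C \<subseteq> side d b \<and> conn lnk C \<and> 2 \<le> card C \<and> card C \<le> 1} = {}" by auto
  then have "small_sum 1 = 0" unfolding small_sum_def by (simp only: sum.empty)
  then show ?thesis by (simp add: size_sum_def mu_eq)
qed

text \<open>With the indicator of \<open>Suc j\<close> as \<open>\<phi>\<close>, the Stein bounds
  become, up to an error, the recursion \<open>(j + 1) * p (j + 1) = mu * p j\<close> that
  characterises the Poisson distribution.\<close>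

lemma hc_prob_singletons_upper: "real (Suc j) * hc_prob lam d (\<lambda>I. comps_le 1 d b I \<and> singletons d b I = Suc j)
    \<le> hc_mean lam d * hc_prob lam d (\<lambda>I. comps_le 1 d b I \<and> singletons d b I = j)"
  and hc_prob_singletons_lower: "hc_mean lam d * hc_prob lam d (\<lambda>I. comps_le 1 d b I \<and> singletons d b I = j) - w1 * d ^ 2 * hc_mean lam d
    \<le> real (Suc j) * hc_prob lam d (\<lambda>I. comps_le 1 d b I \<and> singletons d b I = Suc j)"
proof -
  have 1: "EI (\<lambda>I. of_bool (good 1 (I \<inter> side d b)) * of_bool (k1 (I \<inter> side d b) = Suc j) * real (k1 (I \<inter> side d b)))
      = real (Suc j) * hc_prob lam d (\<lambda>I. comps_le 1 d b I \<and> singletons d b I = Suc j)"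
    unfolding hc_prob_eq_EI EI_cmult[symmetric] by (intro EI_cong) (auto simp: comps_le_iff singletons_eq)
  have 2: "EI (\<lambda>I. of_bool (good 1 (I \<inter> side d b)) * of_bool (Suc (k1 (I \<inter> side d b)) = Suc j))
      = hc_prob lam d (\<lambda>I. comps_le 1 d b I \<and> singletons d b I = j)"
    unfolding hc_prob_eq_EI by (intro EI_cong) (auto simp: comps_le_iff singletons_eq)
  show "real (Suc j) * hc_prob lam d (\<lambda>I. comps_le 1 d b I \<and> singletons d b I = Suc j)
    \<le> hc_mean lam d * hc_prob lam d (\<lambda>I. comps_le 1 d b I \<and> singletons d b I = j)"
    using stein_upper[of 1 "\<lambda>k. of_bool (k = Suc j)"] unfolding 1 2 mu_eq by simp
  show "hc_mean lam d * hc_prob lam d (\<lambda>I. comps_le 1 d b I \<and> singletons d b I = j) - w1 * d ^ 2 * hc_mean lam d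
    \<le> real (Suc j) * hc_prob lam d (\<lambda>I. comps_le 1 d b I \<and> singletons d b I = Suc j)"
    using stein_lower[of 1 "\<lambda>k. of_bool (k = Suc j)"] unfolding 1 2 mu_eq size_sum_1 by simp
qed

lemma hc_prob_singletons_tail: "hc_prob lam d (\<lambda>I. comps_le 1 d b I \<and> J < singletons d b I) \<le> hc_mean lam d / (real J + 1)"
proof -
  have "hc_prob lam d (\<lambda>I. comps_le 1 d b I \<and> J < singletons d b I)
      \<le> EI (\<lambda>I. of_bool (good 1 (I \<inter> side d b)) * real (k1 (I \<inter> side d b))) / (real J + 1)"
    unfolding hc_prob_eq_EI by (rule EI_markov) (auto simp: comps_le_iff singletons_eq)
  also have "EI (\<lambda>I. of_bool (good 1 (I \<inter> side d b)) * real (k1 (I \<inter> side d b)))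
      \<le> mu * EI (\<lambda>I. of_bool (good 1 (I \<inter> side d b)))"
    using stein_upper[of 1 "\<lambda>_. 1"] by simp
  also have "\<dots> \<le> mu * 1" using mu_nonneg by (intro mult_left_mono EI_le_1) auto
  finally show ?thesis by (simp add: mu_eq divide_right_mono)
qed

end

lemma hc_prob_no_good_side:
  assumes d0: "d > 0" and lam0: "lam > 0"
    and B: "\<And>b. hard_core_bipartite.bad_sum (side d b) cube_nb lam m \<le> B"
  shows "hc_prob lam d (\<lambda>I. \<forall>b. \<not> comps_le m d b I) \<le> 2 * B"
proof -
  interpret E: hypercube_hard_core lam d True using d0 lam0 by unfold_locales
  interpret O': hypercube_hard_core lam d False using d0 lam0 by unfold_locales
  have "hc_prob lam d (\<lambda>I. \<forall>b. \<not> comps_le m d b I)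
      \<le> hc_prob lam d (\<lambda>I. (2 * card (E.cl (I \<inter> side d True)) \<le> card (side d True) \<and> \<not> comps_le m d True I) \<or>
        (2 * card (O'.cl (I \<inter> side d False)) \<le> card (side d False) \<and> \<not> comps_le m d False I))"
  proof (rule hc_prob_mono[OF lam0])
    fix I assume "I \<in> independent_sets (hypercube d)" and g: "\<forall>b. \<not> comps_le m d b I"
    then have "I \<in> E.Ind" using Ind_cube[OF d0 lam0, of True] by simp
    from E.cl_small[OF this] g
    show "(2 * card (E.cl (I \<inter> side d True)) \<le> card (side d True) \<and> \<not> comps_le m d True I) \<or>
        (2 * card (O'.cl (I \<inter> side d False)) \<le> card (side d False) \<and> \<not> comps_le m d False I)" by simp
  qed
  also have "\<dots> \<le> E.bad_sum m + O'.bad_sum m"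
    using hc_prob_disj_le E.hc_prob_bad_side[of m] O'.hc_prob_bad_side[of m] by (meson add_mono order_trans)
  also have "\<dots> \<le> B + B" using B[of True] B[of False] by (intro add_mono) auto
  finally show ?thesis by simp
qed

section \<open>Error terms that vanish in the limit\<close>

lemma exp_poly_tendsto_0:
  fixes A B c :: real
  assumes "c > 0"
  shows "(\<lambda>d::nat. exp (A + B * ln (real d + 1) - c * real d)) \<longlonglongrightarrow> 0"
  using assms by real_asymp

lemma poly_over_exp_tendsto_0:
  fixes x :: real
  assumes "x > 1"
  shows "(\<lambda>d. real (Suc d) ^ k / x ^ d) \<longlonglongrightarrow> 0"
proof -
  have "real (Suc d) ^ k / x ^ d = exp (0 + real k * ln (real d + 1) - ln x * real d)" for d
  proof -
    have "real (Suc d) ^ k = exp (real k * ln (real d + 1))"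
      by (simp add: exp_of_nat_mult add.commute)
    moreover have "x ^ d = exp (ln x * real d)"
      using assms by (simp add: mult.commute exp_of_nat_mult)
    ultimately show ?thesis by (simp add: exp_diff)
  qed
  then show ?thesis using exp_poly_tendsto_0[of "ln x" 0 k] assms by simp
qed

text \<open>The hypothesis on \<open>m\<close> acts on the smaller components, where it makes
  \<open>2 ^ d * r d ^ Suc m\<close> decay. The container term tends to 0 for every
  \<open>lam > 0\<close>.\<close>

lemma bad_sum_tendsto_0:
  fixes lam :: real
  assumes lam: "lam > 0" and m: "(1 + lam) ^ Suc m > 2"
  shows "\<exists>B. B \<longlonglongrightarrow> 0 \<and>
    (\<forall>\<^sub>F d in sequentially. \<forall>b. hard_core_bipartite.bad_sum (side d b) cube_nb lam m \<le> B d)"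
proof -
  define L where "L = ln (1 + lam)"
  define k where "k = real (Suc m)"
  have L: "L > 0" using lam by (simp add: L_def)
  have k: "k > 0" by (simp add: k_def)
  have "ln 2 < ln ((1 + lam) ^ Suc m)" using m by (subst ln_less_cancel_iff) auto
  also have "\<dots> = k * L" using lam by (simp only: ln_realpow k_def L_def)
  finally have kL: "ln 2 < k * L" .
  \<comment> \<open>This is the loss for which \<open>(1 - \<delta>) * k * L = ln 2\<close>; any
    smaller \<open>\<eta>\<close> keeps the rate \<open>c\<close> positive.\<close>
  define \<delta> where "\<delta> = 1 - ln 2 / (k * L)"
  have \<delta>: "\<delta> > 0" using kL k L by (simp add: \<delta>_def)
  define \<eta> where "\<eta> = min (1 / 2) (\<delta> / 2)"
  have \<eta>: "0 < \<eta>" "\<eta> \<le> 1 / 2" "\<eta> < \<delta>" using \<delta> by (auto simp: \<eta>_def min_def)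
  define c where "c = k * ((1 - \<eta>) * L) - ln 2"
  have c: "c > 0"
  proof -
    have "k * L * (1 - \<delta>) < k * L * (1 - \<eta>)" using \<eta>(3) k L by (intro mult_strict_left_mono) auto
    moreover have "k * L * (1 - \<delta>) = ln 2" using k L by (simp add: \<delta>_def)
    ultimately show ?thesis by (simp add: c_def algebra_simps)
  qed
  \<comment> \<open>any exponent strictly between \<open>- 1 / 4\<close> and \<open>0\<close> would do\<close>
  define \<gamma> where "\<gamma> d = real d powr (- 1 / 8)" for d :: nat
  define \<psi> where "\<psi> d = \<gamma> d * d / 8" for d :: nat
  define r where "r d = real (Suc d) ^ 12 * (1 + lam) powr (1 - (1 - \<eta>) * d)" for d :: nat
  define B where "B d = 2 * 2 ^ d * r d ^ Suc m
    + 2 * (2 ^ d) ^ 3 * exp (- (\<gamma> d * L * \<eta> * d ^ 2 / (64 * sqrt d)))" for d :: nat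
  have r_exp: "r d = exp (L + 12 * ln (real d + 1) - (1 - \<eta>) * L * d)" for d
  proof -
    have "real (Suc d) ^ 12 = exp (12 * ln (real d + 1))"
      using exp_of_nat_mult[of 12 "ln (real d + 1)"] by (simp add: add.commute)
    moreover have "(1 + lam) powr (1 - (1 - \<eta>) * d) = exp (L - (1 - \<eta>) * L * d)"
      using lam by (simp add: powr_def L_def algebra_simps)
    ultimately show ?thesis by (simp add: r_def algebra_simps flip: exp_add)
  qed
  have r0: "r \<longlonglongrightarrow> 0"
    unfolding r_exp using \<eta> L by (intro exp_poly_tendsto_0) auto
  have "(\<lambda>d. 2 * exp (k * L + (12 * k) * ln (real d + 1) - c * real d)) \<longlonglongrightarrow> 0"
    using tendsto_mult_left[OF exp_poly_tendsto_0[OF c], of 2] by simp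
  also have "(\<lambda>d. 2 * exp (k * L + (12 * k) * ln (real d + 1) - c * real d)) = (\<lambda>d. 2 * 2 ^ d * r d ^ Suc m)"
  proof
    fix d
    have "(2 :: real) ^ d = exp (ln 2 * real d)"
      by (simp add: mult.commute exp_of_nat_mult)
    moreover have "r d ^ Suc m = exp (k * (L + 12 * ln (real d + 1) - (1 - \<eta>) * L * d))"
      unfolding r_exp k_def by (rule exp_of_nat_mult[symmetric])
    ultimately have "2 ^ d * r d ^ Suc m
        = exp (ln 2 * real d + k * (L + 12 * ln (real d + 1) - (1 - \<eta>) * L * d))"
      by (simp only: exp_add)
    also have "ln 2 * real d + k * (L + 12 * ln (real d + 1) - (1 - \<eta>) * L * d)
        = k * L + (12 * k) * ln (real d + 1) - c * real d"
      by (simp add: c_def algebra_simps)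
    finally show "2 * exp (k * L + (12 * k) * ln (real d + 1) - c * real d) = 2 * 2 ^ d * r d ^ Suc m"
      by simp
  qed
  finally have lim1: "(\<lambda>d. 2 * 2 ^ d * r d ^ Suc m) \<longlonglongrightarrow> 0" .
  define K where "K = L * \<eta>"
  have "K > 0" using L \<eta> by (simp add: K_def)
  \<comment> \<open>The saving in the exponent is of order \<open>d powr (11 / 8)\<close>, against a
    cost linear in \<open>d\<close>.\<close>
  then have "(\<lambda>d::nat. 2 * exp (real d * ln 8 - (real d powr (- 1 / 8)) * K * real d ^ 2 / (64 * sqrt (real d)))) \<longlonglongrightarrow> 0"
    by real_asymp
  also have "(\<lambda>d::nat. 2 * exp (real d * ln 8 - (real d powr (- 1 / 8)) * K * real d ^ 2 / (64 * sqrt (real d))))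
      = (\<lambda>d. 2 * (2 ^ d) ^ 3 * exp (- (\<gamma> d * L * \<eta> * d ^ 2 / (64 * sqrt d))))"
  proof
    fix d :: nat
    have "((2 :: real) ^ d) ^ 3 = (2 ^ 3) ^ d" by (simp only: power_mult[symmetric] mult.commute)
    also have "\<dots> = 8 ^ d" by simp
    also have "\<dots> = exp (real d * ln 8)" by (simp add: exp_of_nat_mult)
    finally show "2 * exp (real d * ln 8 - (real d powr (- 1 / 8)) * K * real d ^ 2 / (64 * sqrt (real d)))
        = 2 * (2 ^ d) ^ 3 * exp (- (\<gamma> d * L * \<eta> * d ^ 2 / (64 * sqrt d)))"
      by (simp add: \<gamma>_def K_def exp_diff exp_minus field_simps)
  qed
  finally have lim2: "(\<lambda>d. 2 * (2 ^ d) ^ 3 * exp (- (\<gamma> d * L * \<eta> * d ^ 2 / (64 * sqrt d)))) \<longlonglongrightarrow> 0" .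
  have "B \<longlonglongrightarrow> 0 + 0" unfolding B_def by (intro tendsto_add lim1 lim2)
  moreover have "\<forall>\<^sub>F d in sequentially. \<forall>b. hard_core_bipartite.bad_sum (side d b) cube_nb lam m \<le> B d"
  proof -
    have e1: "\<forall>\<^sub>F d in sequentially. r d \<le> 1 / 2"
      using order_tendstoD(2)[OF r0, of "1 / 2"] by (auto elim: eventually_mono)
    have e2: "\<forall>\<^sub>F d in sequentially. 0 < \<psi> d" unfolding \<psi>_def \<gamma>_def by real_asymp
    have e3: "\<forall>\<^sub>F d in sequentially. \<gamma> d \<le> 1" unfolding \<gamma>_def by real_asymp
    have e4: "\<forall>\<^sub>F d in sequentially. 2 \<le> \<eta> * real d" using \<eta>(1) by real_asymp
    have e5: "\<forall>\<^sub>F d in sequentially. 12 * sqrt (real d) * ln (real (Suc d) ^ 12) / \<psi> d \<le> \<gamma> d * L / 4"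
      unfolding \<psi>_def \<gamma>_def using L by real_asymp
    have e6: "\<forall>\<^sub>F d in sequentially. (12 * sqrt (real d) / \<psi> d + \<gamma> d) * ln (2 * real (Suc d) ^ 12) \<le> L / 2"
      unfolding \<psi>_def \<gamma>_def using L by real_asymp
    show ?thesis
      using e1 e2 e3 e4 e5 e6 eventually_gt_at_top[of 0]
    proof eventually_elim
      case (elim d)
      show ?case
      proof
        fix b
        interpret hypercube_hard_core lam d b using elim lam by unfold_locales
        show "bad_sum m \<le> B d"
          using bad_sum_le[of "\<psi> d" "\<gamma> d" \<eta> m] elim \<eta>(1,2)
          unfolding card_both by (simp add: B_def \<psi>_def r_def L_def)
      qed
    qed
  qed
  ultimately show ?thesis by auto
qed

lemma hc_prob_tendsto_0I:
  assumes "\<forall>\<^sub>F d in sequentially. hc_prob lam d (\<Phi> d) \<le> g d" "g \<longlonglongrightarrow> 0"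
  shows "(\<lambda>d. hc_prob lam d (\<Phi> d)) \<longlonglongrightarrow> 0"
  by (rule tendsto_sandwich[OF _ assms(1) tendsto_const assms(2)]) (simp add: hc_prob_nonneg)

lemma hc_prob_split: "hc_prob lam d \<Phi> = hc_prob lam d (\<lambda>I. \<Phi> I \<and> \<Psi> I) + hc_prob lam d (\<lambda>I. \<Phi> I \<and> \<not> \<Psi> I)"
proof -
  have "(\<lambda>I. \<Phi> I \<and> \<Psi> I \<or> \<Phi> I \<and> \<not> \<Psi> I) = \<Phi>" "(\<lambda>I. (\<Phi> I \<and> \<Psi> I) \<and> \<Phi> I \<and> \<not> \<Psi> I) = (\<lambda>I. False)" by auto
  moreover have "hc_prob lam d (\<lambda>I. False) = 0" by (simp add: hc_prob_def)
  ultimately show ?thesis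
    using hc_prob_disj_conj[of lam d "\<lambda>I. \<Phi> I \<and> \<Psi> I" "\<lambda>I. \<Phi> I \<and> \<not> \<Psi> I"] by simp
qed

lemma aas_iff_hc_prob: "aas (\<lambda>d. hard_core (hypercube d) lam) \<Phi> \<longleftrightarrow> (\<lambda>d. hc_prob lam d (\<lambda>I. \<not> \<Phi> d I)) \<longlonglongrightarrow> 0"
proof -
  have "(\<lambda>d. hc_prob lam d (\<lambda>I. \<not> \<Phi> d I)) = (\<lambda>d. 1 - hc_prob lam d (\<Phi> d))" by (simp add: hc_prob_not)
  moreover have "(\<lambda>d. 1 - hc_prob lam d (\<Phi> d)) \<longlonglongrightarrow> 0 \<longleftrightarrow> (\<lambda>d. hc_prob lam d (\<Phi> d)) \<longlonglongrightarrow> 1"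
    using tendsto_diff[OF tendsto_const[of 1], of "\<lambda>d. hc_prob lam d (\<Phi> d)" 1 sequentially]
      tendsto_diff[OF tendsto_const[of 1], of "\<lambda>d. 1 - hc_prob lam d (\<Phi> d)" 0 sequentially] by auto
  ultimately show ?thesis by (simp add: aas_def hc_prob_def)
qed

text \<open>Bounds the expected number of components with at least two vertices relative to
  \<open>hc_mean\<close>; the second vertex is responsible for the additional
  \<open>(1 + lam) ^ d\<close> in the denominator.\<close>

definition larger_ratio :: "real \<Rightarrow> nat \<Rightarrow> nat \<Rightarrow> real" where
  "larger_ratio lam m d = 2 / lam * (1 + lam) ^ (m + m ^ 2) * (real (Suc d) ^ (12 * m) / (1 + lam) ^ d)"

lemma larger_bound_eq:
  assumes "lam > 0"
  shows "larger_bound lam m d = hc_mean lam d * larger_ratio lam m d"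
proof -
  have "(1 + lam) ^ (2 * d) = (1 + lam) ^ d * (1 + lam) ^ d" by (simp add: mult_2 power_add)
  moreover have "(real (Suc d) ^ 12) ^ m = real (Suc d) ^ (12 * m)" by (simp only: power_mult)
  ultimately show ?thesis
    using assms unfolding larger_bound_def hc_mean_def larger_ratio_def by (simp add: power_divide field_simps)
qed

lemma larger_ratio_tendsto_0:
  assumes "lam > 0"
  shows "larger_ratio lam m \<longlonglongrightarrow> 0"
  unfolding larger_ratio_def
  by (rule tendsto_mult_right_zero[OF poly_over_exp_tendsto_0]) (use assms in simp)

lemma unbalanced_tendsto_0:
  assumes lam: "lam > 0"
  shows "(\<lambda>d. hc_prob lam d (\<lambda>I. comps_le m d b I \<and> card (I \<inter> side d (\<not> b)) \<le> card (I \<inter> side d b))) \<longlonglongrightarrow> 0"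
proof (rule hc_prob_tendsto_0I)
  let ?\<rho> = "larger_ratio lam m"
  define q where "q = (1 + lam / 2) / (1 + lam)"
  have q: "0 < q" "q < 1" using lam by (auto simp: q_def field_simps)
  let ?g = "\<lambda>d. 2 * lam * (real (Suc d) ^ 1 / (1 + lam) ^ d) * (1 + m * ?\<rho> d)
    + 2 powr (2 ^ d / (4 * real d)) * q powr (2 ^ d / 4)"
  have "(\<lambda>d. 2 * lam * (real (Suc d) ^ 1 / (1 + lam) ^ d) * (1 + m * ?\<rho> d)) \<longlonglongrightarrow> 2 * lam * 0 * (1 + real m * 0)"
    by (intro tendsto_mult tendsto_add tendsto_const poly_over_exp_tendsto_0 larger_ratio_tendsto_0 lam) (use lam in simp)
  \<comment> \<open>Doubly exponential decay, since \<open>2 ^ d / 4\<close> outgrows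
    \<open>2 ^ d / (4 * d)\<close>.\<close>
  moreover have "(\<lambda>d::nat. 2 powr (2 ^ d / (4 * real d)) * q powr (2 ^ d / 4)) \<longlonglongrightarrow> 0"
    using q by real_asymp
  ultimately show "?g \<longlonglongrightarrow> 0" using tendsto_add by fastforce
  show "\<forall>\<^sub>F d in sequentially. hc_prob lam d (\<lambda>I. comps_le m d b I \<and> card (I \<inter> side d (\<not> b)) \<le> card (I \<inter> side d b)) \<le> ?g d"
    using eventually_gt_at_top[of 0]
  proof eventually_elim
    case (elim d)
    interpret hypercube_hard_core lam d b using elim lam by unfold_locales
    have \<rho>: "?\<rho> d \<ge> 0" using lam by (simp add: larger_ratio_def)
    have "(hc_mean lam d + real m * larger_bound lam m d) / (2 ^ d / (4 * d)) = 2 * lam * (real d / (1 + lam) ^ d) * (1 + m * ?\<rho> d)"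
      unfolding larger_bound_eq[OF lam] hc_mean_def using elim lam by (simp add: power_divide field_simps)
    also have "\<dots> \<le> 2 * lam * (real (Suc d) ^ 1 / (1 + lam) ^ d) * (1 + m * ?\<rho> d)"
      using lam \<rho> by (intro mult_right_mono mult_left_mono divide_right_mono) auto
    finally show ?case using hc_prob_unbalanced[of m] by (simp add: q_def)
  qed
qed

section \<open>Passage from a fixed side to the smaller part\<close>

locale smaller_part_choice =
  fixes lam :: real and Imin :: "nat \<Rightarrow> bool list set \<Rightarrow> bool list set"
  assumes lam: "lam > 0"
    and Imin: "\<And>d I. I \<in> independent_sets (hypercube d) \<Longrightarrow> is_smaller_part d I (Imin d I)"
begin

text \<open>Ties are left open by the locale; \<open>uniq_tendsto\<close> passes through an event
  with strict inequality, where the choice is forced.\<close>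

lemma Imin_eq:
  assumes "I \<in> independent_sets (hypercube d)" "card (I \<inter> side d b) < card (I \<inter> side d (\<not> b))"
  shows "Imin d I = I \<inter> side d b"
  using Imin[OF assms(1)] assms(2) unfolding is_smaller_part_def even_verts_eq odd_verts_eq
  by (cases b) auto

definition uniq :: "nat \<Rightarrow> nat \<Rightarrow> bool list set \<Rightarrow> bool" where
  "uniq m d I \<longleftrightarrow> (\<exists>b. comps_le m d b I \<and> \<not> comps_le m d (\<not> b) I \<and> Imin d I = I \<inter> side d b)"

text \<open>With high probability some side is good and every good side is strictly smaller than its
  opposite. Both sides cannot be strictly smaller at once, so the good side is unique.\<close>

lemma uniq_tendsto:
  assumes m: "(1 + lam) ^ Suc m > 2"
  shows "(\<lambda>d. hc_prob lam d (\<lambda>I. \<not> uniq m d I)) \<longlonglongrightarrow> 0"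
proof -
  obtain B where B: "B \<longlonglongrightarrow> 0"
    "\<forall>\<^sub>F d in sequentially. \<forall>b. hard_core_bipartite.bad_sum (side d b) cube_nb lam m \<le> B d"
    using bad_sum_tendsto_0[OF lam m] by blast
  let ?u = "\<lambda>b d. hc_prob lam d (\<lambda>I. comps_le m d b I \<and> card (I \<inter> side d (\<not> b)) \<le> card (I \<inter> side d b))"
  have "(\<lambda>d. 2 * B d + (?u True d + ?u False d)) \<longlonglongrightarrow> 2 * 0 + (0 + 0)"
    by (intro tendsto_add tendsto_mult tendsto_const B(1) unbalanced_tendsto_0 lam)
  then have lim: "(\<lambda>d. 2 * B d + (?u True d + ?u False d)) \<longlonglongrightarrow> 0" by simp
  show ?thesis
  proof (rule hc_prob_tendsto_0I[OF _ lim])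
    show "\<forall>\<^sub>F d in sequentially. hc_prob lam d (\<lambda>I. \<not> uniq m d I) \<le> 2 * B d + (?u True d + ?u False d)"
      using B(2) eventually_gt_at_top[of 0]
    proof eventually_elim
      case (elim d)
      let ?U = "\<lambda>b I. comps_le m d b I \<and> card (I \<inter> side d (\<not> b)) \<le> card (I \<inter> side d b)"
      have "hc_prob lam d (\<lambda>I. \<not> uniq m d I)
          \<le> hc_prob lam d (\<lambda>I. (\<forall>b. \<not> comps_le m d b I) \<or> (?U True I \<or> ?U False I))"
      proof (rule hc_prob_mono[OF lam])
        fix I assume I: "I \<in> independent_sets (hypercube d)" and nu: "\<not> uniq m d I"
        show "(\<forall>b. \<not> comps_le m d b I) \<or> (?U True I \<or> ?U False I)"
        proof (rule ccontr)
          assume n: "\<not> ?thesis"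
          then obtain b where b: "comps_le m d b I" by blast
          have U: "\<not> ?U b I" for b using n by (cases b) auto
          have lt: "card (I \<inter> side d b) < card (I \<inter> side d (\<not> b))" using U[of b] b by auto
          then have "\<not> comps_le m d (\<not> b) I" using U[of "\<not> b"] by auto
          then have "uniq m d I" using b Imin_eq[OF I lt] unfolding uniq_def by blast
          then show False using nu by simp
        qed
      qed
      also have "\<dots> \<le> hc_prob lam d (\<lambda>I. \<forall>b. \<not> comps_le m d b I) + (?u True d + ?u False d)"
        by (intro order_trans[OF hc_prob_disj_le] add_left_mono hc_prob_disj_le)
      also have "hc_prob lam d (\<lambda>I. \<forall>b. \<not> comps_le m d b I) \<le> 2 * B d"
        using elim by (intro hc_prob_no_good_side lam) auto
      finally show ?case by simp
    qed
  qed
qed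

text \<open>Transfer principle: a property of the random smaller part is established for each fixed
  side, on the event that the components there are small.\<close>

lemma aas_smaller_part:
  assumes m: "(1 + lam) ^ Suc m > 2"
    and \<Psi>: "\<And>b. (\<lambda>d. hc_prob lam d (\<lambda>I. comps_le m d b I \<and> \<not> \<Psi> d b I)) \<longlonglongrightarrow> 0"
    and imp: "\<forall>\<^sub>F d in sequentially. \<forall>b I. comps_le m d b I \<longrightarrow> \<Psi> d b I \<longrightarrow> \<Phi> d (I \<inter> side d b)"
  shows "aas (\<lambda>d. hard_core (hypercube d) lam) (\<lambda>d I. \<Phi> d (Imin d I))"
  unfolding aas_iff_hc_prob
proof (rule hc_prob_tendsto_0I)
  let ?p = "\<lambda>b d. hc_prob lam d (\<lambda>I. comps_le m d b I \<and> \<not> \<Psi> d b I)"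
  have "(\<lambda>d. hc_prob lam d (\<lambda>I. \<not> uniq m d I) + (?p True d + ?p False d)) \<longlonglongrightarrow> 0 + (0 + 0)"
    by (intro tendsto_add uniq_tendsto[OF m] \<Psi>)
  then show "(\<lambda>d. hc_prob lam d (\<lambda>I. \<not> uniq m d I) + (?p True d + ?p False d)) \<longlonglongrightarrow> 0" by simp
  show "\<forall>\<^sub>F d in sequentially. hc_prob lam d (\<lambda>I. \<not> \<Phi> d (Imin d I))
      \<le> hc_prob lam d (\<lambda>I. \<not> uniq m d I) + (?p True d + ?p False d)"
    using imp
  proof eventually_elim
    case (elim d)
    have "hc_prob lam d (\<lambda>I. \<not> \<Phi> d (Imin d I))
        \<le> hc_prob lam d (\<lambda>I. \<not> uniq m d I \<or> ((comps_le m d True I \<and> \<not> \<Psi> d True I) \<or> (comps_le m d False I \<and> \<not> \<Psi> d False I)))"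
    proof (rule hc_prob_mono[OF lam])
      fix I assume n: "\<not> \<Phi> d (Imin d I)"
      show "\<not> uniq m d I \<or> ((comps_le m d True I \<and> \<not> \<Psi> d True I) \<or> (comps_le m d False I \<and> \<not> \<Psi> d False I))"
      proof (cases "uniq m d I")
        case True
        then obtain b where "comps_le m d b I" "Imin d I = I \<inter> side d b" by (auto simp: uniq_def)
        then have "comps_le m d b I \<and> \<not> \<Psi> d b I" using n elim by auto
        then show ?thesis by (cases b) auto
      qed simp
    qed
    also have "\<dots> \<le> hc_prob lam d (\<lambda>I. \<not> uniq m d I) + (?p True d + ?p False d)"
      by (intro order_trans[OF hc_prob_disj_le] add_left_mono hc_prob_disj_le)
    finally show ?case .
  qed
qed

text \<open>The case \<open>m = 0\<close>, in which \<open>comps_le\<close> forces the part to be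
  empty.\<close>

lemma aas_empty:
  assumes "lam > 1"
  shows "aas (\<lambda>d. hard_core (hypercube d) lam) (\<lambda>d I. Imin d I = {})"
proof (rule aas_smaller_part[where m = 0 and \<Psi> = "\<lambda>_ _ _. True"])
  show "(\<lambda>d. hc_prob lam d (\<lambda>I. comps_le 0 d b I \<and> \<not> True)) \<longlonglongrightarrow> 0" for b by (simp add: hc_prob_def)
  show "\<forall>\<^sub>F d in sequentially. \<forall>b I. comps_le 0 d b I \<longrightarrow> True \<longrightarrow> I \<inter> side d b = {}"
    using eventually_gt_at_top[of 0]
  proof eventually_elim
    case (elim d)
    have "hypercube_hard_core lam d" using elim lam by unfold_locales
    then show ?case using hypercube_hard_core.comps_le_0_imp_empty by blast
  qed
qed (use assms in simp)

lemma comps_le_1_singletons: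
  assumes "d > 0" "comps_le 1 d b I"
  shows "(\<forall>C\<in>two_components d (I \<inter> side d b). card C = 1) \<and>
    card (two_components d (I \<inter> side d b)) = singletons d b I"
proof -
  interpret hypercube_hard_core lam d b using assms lam by unfold_locales
  show ?thesis by (rule singletons_comps_le_1[OF assms(2)])
qed

lemma aas_all_singletons:
  assumes "(1 + lam) ^ 2 > 2"
  shows "aas (\<lambda>d. hard_core (hypercube d) lam) (\<lambda>d I. \<forall>C\<in>two_components d (Imin d I). card C = 1)"
proof (rule aas_smaller_part[where m = 1 and \<Psi> = "\<lambda>_ _ _. True"])
  show "(\<lambda>d. hc_prob lam d (\<lambda>I. comps_le 1 d b I \<and> \<not> True)) \<longlonglongrightarrow> 0" for b by (simp add: hc_prob_def)
  show "\<forall>\<^sub>F d in sequentially. \<forall>b I. comps_le 1 d b I \<longrightarrow> True \<longrightarrow> (\<forall>C\<in>two_components d (I \<inter> side d b). card C = 1)"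
    using eventually_gt_at_top[of 0] by eventually_elim (use comps_le_1_singletons in blast)
qed (use assms in \<open>simp add: numeral_2_eq_2\<close>)

lemma singletons_deviation_tendsto:
  assumes m: "m \<ge> 1" and s: "\<forall>\<^sub>F d in sequentially. s d > 0"
    and lim: "(\<lambda>d. (hc_mean lam d + 2 * hc_mean lam d * (lam / (1 + lam) ^ d * real d ^ 2 * (hc_mean lam d + real m * larger_bound lam m d))) / (s d)\<^sup>2) \<longlonglongrightarrow> 0"
  shows "(\<lambda>d. hc_prob lam d (\<lambda>I. comps_le m d b I \<and> s d < \<bar>real (singletons d b I) - hc_mean lam d\<bar>)) \<longlonglongrightarrow> 0"
proof (rule hc_prob_tendsto_0I[OF _ lim])
  show "\<forall>\<^sub>F d in sequentially. hc_prob lam d (\<lambda>I. comps_le m d b I \<and> s d < \<bar>real (singletons d b I) - hc_mean lam d\<bar>)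
      \<le> (hc_mean lam d + 2 * hc_mean lam d * (lam / (1 + lam) ^ d * real d ^ 2 * (hc_mean lam d + real m * larger_bound lam m d))) / (s d)\<^sup>2"
    using s eventually_gt_at_top[of 0]
  proof eventually_elim
    case (elim d)
    interpret hypercube_hard_core lam d b using elim lam by unfold_locales
    have "hc_mean lam d \<ge> 0" using lam by (simp add: hc_mean_def)
    then have "(hc_mean lam d + 2 * hc_mean lam d * (w1 * real d ^ 2 * size_sum m)) / (s d)\<^sup>2
        \<le> (hc_mean lam d + 2 * hc_mean lam d * (w1 * real d ^ 2 * (hc_mean lam d + real m * larger_bound lam m d))) / (s d)\<^sup>2"
      using size_sum_le[of m] w1_pos
      by (intro divide_right_mono add_left_mono mult_left_mono) auto
    then show ?case using hc_prob_singletons_deviation[OF m elim(1)] by (simp add: w1_def)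
  qed
qed

lemma hc_mean_at_top:
  assumes "lam < 1"
  shows "filterlim (hc_mean lam) at_top sequentially"
proof -
  have *: "filterlim (\<lambda>d::nat. c * q ^ d) at_top at_top" if "c > 0" "q > 1" for c q :: real
    using that by real_asymp
  show ?thesis unfolding hc_mean_def by (rule *) (use lam assms in auto)
qed

text \<open>The loss of \<open>stein_lower\<close> relative to \<open>hc_mean\<close>. The absolute
  loss need not vanish when \<open>(1 + lam) ^ 2 < 2\<close>.\<close>

lemma first_moment_error_tendsto_0:
  "(\<lambda>d. lam / (1 + lam) ^ d * real d ^ 2 * (1 + m * larger_ratio lam m d)) \<longlonglongrightarrow> 0"
proof -
  have "(\<lambda>d. real (Suc d) ^ 2 / (1 + lam) ^ d) \<longlonglongrightarrow> 0" using lam by (intro poly_over_exp_tendsto_0) simp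
  then have "(\<lambda>d. real d ^ 2 / (1 + lam) ^ d) \<longlonglongrightarrow> 0"
    by (rule tendsto_sandwich[OF _ _ tendsto_const, rotated 2])
      (use lam in \<open>auto intro!: always_eventually divide_right_mono power_mono\<close>)
  then have "(\<lambda>d. lam * (real d ^ 2 / (1 + lam) ^ d) * (1 + m * larger_ratio lam m d)) \<longlonglongrightarrow> lam * 0 * (1 + real m * 0)"
    by (intro tendsto_mult tendsto_add tendsto_const larger_ratio_tendsto_0 lam)
  then show ?thesis by simp
qed

text \<open>Chebyshev's inequality suffices: the variance is at most of order
  \<open>hc_mean\<close>, and the logarithm in the width makes the quotient tend to 0. The condition
  \<open>(1 + lam) ^ 2 > 2\<close> excludes larger components and makes the absolute loss
  \<open>e\<close> vanish.\<close>

lemma aas_concentration: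
  assumes lam1: "lam < 1" and lam2: "(1 + lam) ^ 2 > 2" and \<epsilon>: "\<epsilon> > 0"
  shows "aas (\<lambda>d. hard_core (hypercube d) lam)
    (\<lambda>d I. (\<forall>C\<in>two_components d (Imin d I). card C = 1) \<and>
      \<bar>real (card (two_components d (Imin d I))) - hc_mean lam d\<bar> \<le> sqrt ((2 + \<epsilon>) * hc_mean lam d * ln (hc_mean lam d)))"
proof (rule aas_smaller_part[where m = 1 and
    \<Psi> = "\<lambda>d b I. \<not> sqrt ((2 + \<epsilon>) * hc_mean lam d * ln (hc_mean lam d)) < \<bar>real (singletons d b I) - hc_mean lam d\<bar>"])
  let ?s = "\<lambda>d. sqrt ((2 + \<epsilon>) * hc_mean lam d * ln (hc_mean lam d))"
  let ?\<rho> = "larger_ratio lam 1"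
  have top: "filterlim (hc_mean lam) at_top sequentially" by (rule hc_mean_at_top[OF lam1])
  have big: "\<forall>\<^sub>F d in sequentially. hc_mean lam d > 1" using top by (auto simp: filterlim_at_top_dense)
  define e where "e d = lam / (1 + lam) ^ d * real d ^ 2 * hc_mean lam d" for d
  have e: "e \<longlonglongrightarrow> 0"
  proof (rule tendsto_sandwich[OF _ _ tendsto_const])
    have "(\<lambda>d. lam\<^sup>2 / 2 * (real (Suc d) ^ 2 / ((1 + lam) ^ 2 / 2) ^ d)) \<longlonglongrightarrow> lam\<^sup>2 / 2 * 0"
      using lam2 by (intro tendsto_mult tendsto_const poly_over_exp_tendsto_0) simp
    then show "(\<lambda>d. lam\<^sup>2 / 2 * (real (Suc d) ^ 2 / ((1 + lam) ^ 2 / 2) ^ d)) \<longlonglongrightarrow> 0" by simp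
    have eq: "e d = lam\<^sup>2 / 2 * (real d ^ 2 / ((1 + lam) ^ 2 / 2) ^ d)" for d
      by (simp add: e_def hc_mean_def power_divide power2_eq_square power_mult_distrib mult_ac)
    show "\<forall>\<^sub>F d in sequentially. e d \<le> lam\<^sup>2 / 2 * (real (Suc d) ^ 2 / ((1 + lam) ^ 2 / 2) ^ d)"
      unfolding eq using lam by (intro always_eventually allI mult_left_mono divide_right_mono power_mono) auto
    show "\<forall>\<^sub>F d in sequentially. 0 \<le> e d" unfolding eq using lam by simp
  qed
  show "(\<lambda>d. hc_prob lam d (\<lambda>I. comps_le 1 d b I \<and> \<not> \<not> ?s d < \<bar>real (singletons d b I) - hc_mean lam d\<bar>)) \<longlonglongrightarrow> 0" for b
    unfolding not_not
  proof (rule singletons_deviation_tendsto)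
    show "\<forall>\<^sub>F d in sequentially. ?s d > 0"
      using big by eventually_elim (use \<epsilon> in simp)
    have "(\<lambda>d. (1 + 2 * (e d * (1 + ?\<rho> d))) * (1 / (2 + \<epsilon>)) * inverse (ln (hc_mean lam d))) \<longlonglongrightarrow> (1 + 2 * (0 * (1 + 0))) * (1 / (2 + \<epsilon>)) * 0"
      by (intro tendsto_mult tendsto_add tendsto_const e larger_ratio_tendsto_0 lam tendsto_inverse_0_at_top
          filterlim_compose[OF ln_at_top top])
    then have lim: "(\<lambda>d. (1 + 2 * (e d * (1 + ?\<rho> d))) * (1 / (2 + \<epsilon>)) * inverse (ln (hc_mean lam d))) \<longlonglongrightarrow> 0" by simp
    have "\<forall>\<^sub>F d in sequentially. (1 + 2 * (e d * (1 + ?\<rho> d))) * (1 / (2 + \<epsilon>)) * inverse (ln (hc_mean lam d))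
        = (hc_mean lam d + 2 * hc_mean lam d * (lam / (1 + lam) ^ d * real d ^ 2 * (hc_mean lam d + real 1 * larger_bound lam 1 d))) / (?s d)\<^sup>2"
      using big
    proof eventually_elim
      case (elim d)
      have s: "(?s d)\<^sup>2 = (2 + \<epsilon>) * hc_mean lam d * ln (hc_mean lam d)" using elim \<epsilon> by simp
      have E: "lam / (1 + lam) ^ d * real d ^ 2 * (hc_mean lam d + real 1 * larger_bound lam 1 d) = e d * (1 + ?\<rho> d)"
        unfolding larger_bound_eq[OF lam] e_def by (simp add: algebra_simps add_divide_distrib)
      have cancel: "(1 + 2 * y) * (1 / c) * inverse l = (M + 2 * M * y) / (c * M * l)" if "M > 0" for y c l M :: real
      proof -
        have "(M + 2 * M * y) / (c * M * l) = (M * (1 + 2 * y)) / (M * (c * l))" by (simp add: algebra_simps)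
        also have "\<dots> = (1 + 2 * y) / (c * l)" using that by (intro mult_divide_mult_cancel_left) simp
        also have "\<dots> = (1 + 2 * y) * (1 / c) * inverse l" by (simp add: divide_inverse)
        finally show ?thesis ..
      qed
      show ?case unfolding s E using elim by (intro cancel) simp
    qed
    then show "(\<lambda>d. (hc_mean lam d + 2 * hc_mean lam d * (lam / (1 + lam) ^ d * real d ^ 2 * (hc_mean lam d + real 1 * larger_bound lam 1 d))) / (?s d)\<^sup>2) \<longlonglongrightarrow> 0"
      using lim by (simp add: tendsto_cong)
  qed simp
  show "\<forall>\<^sub>F d in sequentially. \<forall>b I. comps_le 1 d b I \<longrightarrow> \<not> ?s d < \<bar>real (singletons d b I) - hc_mean lam d\<bar> \<longrightarrow>
      (\<forall>C\<in>two_components d (I \<inter> side d b). card C = 1) \<and>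
      \<bar>real (card (two_components d (I \<inter> side d b))) - hc_mean lam d\<bar> \<le> ?s d"
    using eventually_gt_at_top[of 0] by eventually_elim (use comps_le_1_singletons in \<open>auto simp: not_less\<close>)
qed (use lam2 in \<open>simp add: numeral_2_eq_2\<close>)

text \<open>With high probability the singletons number between 1/2 and 3/2 of the mean, and the
  larger components at most the mean. The total lies between 1/2 and 5/2 of it, and the stated
  constants are weaker because \<open>ln m \<ge> 1 / 2\<close> and
  \<open>exp 1 * m \<ge> 4\<close>.\<close>

lemma aas_bounded_components:
  assumes m: "m \<ge> 2" and lam1: "lam < 1" and lam2: "(1 + lam) ^ Suc m > 2"
  shows "aas (\<lambda>d. hard_core (hypercube d) lam)
    (\<lambda>d I. (\<forall>C\<in>two_components d (Imin d I). card C \<le> m) \<and>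
      1 / (4 * ln (real m)) * hc_mean lam d \<le> real (card (two_components d (Imin d I))) \<and>
      real (card (two_components d (Imin d I))) \<le> exp 1 * real m * hc_mean lam d)"
proof (rule aas_smaller_part[where m = m and
    \<Psi> = "\<lambda>d b I. \<not> hc_mean lam d / 2 < \<bar>real (singletons d b I) - hc_mean lam d\<bar> \<and>
      \<not> real (singletons d b I) + hc_mean lam d < card (two_components d (I \<inter> side d b))"])
  define e where "e d = lam / (1 + lam) ^ d * real d ^ 2 * (1 + m * larger_ratio lam m d)" for d
  have e: "e \<longlonglongrightarrow> 0" unfolding e_def by (rule first_moment_error_tendsto_0)
  have pos: "hc_mean lam d > 0" for d using lam by (simp add: hc_mean_def)
  have 1: "(\<lambda>d. hc_prob lam d (\<lambda>I. comps_le m d b I \<and> hc_mean lam d / 2 < \<bar>real (singletons d b I) - hc_mean lam d\<bar>)) \<longlonglongrightarrow> 0" for b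
  proof (rule singletons_deviation_tendsto)
    have "(\<lambda>d. 4 * inverse (hc_mean lam d) + 8 * e d) \<longlonglongrightarrow> 4 * 0 + 8 * 0"
      by (intro tendsto_add tendsto_mult tendsto_const e tendsto_inverse_0_at_top hc_mean_at_top lam1)
    then have "(\<lambda>d. 4 * inverse (hc_mean lam d) + 8 * e d) \<longlonglongrightarrow> 0" by simp
    also have "(\<lambda>d. 4 * inverse (hc_mean lam d) + 8 * e d)
        = (\<lambda>d. (hc_mean lam d + 2 * hc_mean lam d * (lam / (1 + lam) ^ d * real d ^ 2 * (hc_mean lam d + real m * larger_bound lam m d))) / (hc_mean lam d / 2)\<^sup>2)"
    proof
      fix d :: nat
      have "lam / (1 + lam) ^ d * real d ^ 2 * (hc_mean lam d + real m * larger_bound lam m d) = e d * hc_mean lam d"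
        unfolding larger_bound_eq[OF lam] e_def by (simp add: algebra_simps add_divide_distrib)
      then show "4 * inverse (hc_mean lam d) + 8 * e d
          = (hc_mean lam d + 2 * hc_mean lam d * (lam / (1 + lam) ^ d * real d ^ 2 * (hc_mean lam d + real m * larger_bound lam m d))) / (hc_mean lam d / 2)\<^sup>2"
        using pos[of d] by (simp add: power2_eq_square field_simps)
    qed
    finally show "(\<lambda>d. (hc_mean lam d + 2 * hc_mean lam d * (lam / (1 + lam) ^ d * real d ^ 2 * (hc_mean lam d + real m * larger_bound lam m d))) / (hc_mean lam d / 2)\<^sup>2) \<longlonglongrightarrow> 0" .
  qed (use m pos in auto)
  have 2: "(\<lambda>d. hc_prob lam d (\<lambda>I. comps_le m d b I \<and> real (singletons d b I) + hc_mean lam d < card (two_components d (I \<inter> side d b)))) \<longlonglongrightarrow> 0" for b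
  proof (rule hc_prob_tendsto_0I[OF _ larger_ratio_tendsto_0[OF lam]])
    show "\<forall>\<^sub>F d in sequentially. hc_prob lam d (\<lambda>I. comps_le m d b I \<and> real (singletons d b I) + hc_mean lam d < card (two_components d (I \<inter> side d b))) \<le> larger_ratio lam m d"
      using eventually_gt_at_top[of 0]
    proof eventually_elim
      case (elim d)
      interpret hypercube_hard_core lam d b using elim lam by unfold_locales
      show ?case using hc_prob_larger_comps[OF pos[of d], of m] pos[of d] by (simp add: larger_bound_eq[OF lam])
    qed
  qed
  show "(\<lambda>d. hc_prob lam d (\<lambda>I. comps_le m d b I \<and> \<not> (\<not> hc_mean lam d / 2 < \<bar>real (singletons d b I) - hc_mean lam d\<bar> \<and>
      \<not> real (singletons d b I) + hc_mean lam d < card (two_components d (I \<inter> side d b))))) \<longlonglongrightarrow> 0" for b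
  proof (rule hc_prob_tendsto_0I)
    show "(\<lambda>d. hc_prob lam d (\<lambda>I. comps_le m d b I \<and> hc_mean lam d / 2 < \<bar>real (singletons d b I) - hc_mean lam d\<bar>)
      + hc_prob lam d (\<lambda>I. comps_le m d b I \<and> real (singletons d b I) + hc_mean lam d < card (two_components d (I \<inter> side d b)))) \<longlonglongrightarrow> 0"
      using tendsto_add[OF 1 2] by simp
  qed (intro always_eventually allI order_trans[OF hc_prob_mono[OF lam] hc_prob_disj_le], blast)
  have m_bounds: "1 / (4 * ln (real m)) \<le> 1 / 2" "5 / 2 \<le> exp 1 * real m"
  proof -
    have "1 / 2 \<le> ln (2 :: real)" using ln_add_one_self_le_self2 ln2_ge_two_thirds by linarith
    also have "\<dots> \<le> ln m" using m by simp
    finally have "1 / 2 \<le> ln (real m)" .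
    then show "1 / (4 * ln (real m)) \<le> 1 / 2" by (simp add: field_simps)
    have "2 * 2 \<le> exp 1 * real m" using m exp_ge_add_one_self[of 1] by (intro mult_mono) auto
    then show "5 / 2 \<le> exp 1 * real m" by linarith
  qed
  show "\<forall>\<^sub>F d in sequentially. \<forall>b I. comps_le m d b I \<longrightarrow>
      (\<not> hc_mean lam d / 2 < \<bar>real (singletons d b I) - hc_mean lam d\<bar> \<and>
      \<not> real (singletons d b I) + hc_mean lam d < card (two_components d (I \<inter> side d b))) \<longrightarrow>
      (\<forall>C\<in>two_components d (I \<inter> side d b). card C \<le> m) \<and>
      1 / (4 * ln (real m)) * hc_mean lam d \<le> real (card (two_components d (I \<inter> side d b))) \<and>
      real (card (two_components d (I \<inter> side d b))) \<le> exp 1 * real m * hc_mean lam d"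
  proof (intro always_eventually allI impI)
    fix d b I
    let ?K = "card (two_components d (I \<inter> side d b))"
    assume g: "comps_le m d b I" and h: "\<not> hc_mean lam d / 2 < \<bar>real (singletons d b I) - hc_mean lam d\<bar> \<and>
      \<not> real (singletons d b I) + hc_mean lam d < ?K"
    have "finite (two_components d (I \<inter> side d b))"
      by (rule finite_subset[of _ "Pow (side d b)"]) (auto simp: two_components_def finite_side)
    then have "singletons d b I \<le> ?K" unfolding singletons_def by (intro card_mono) auto
    then have lo: "1 / 2 * hc_mean lam d \<le> ?K" and hi: "?K \<le> 5 / 2 * hc_mean lam d" using h by linarith+
    have "1 / (4 * ln (real m)) * hc_mean lam d \<le> 1 / 2 * hc_mean lam d"
      using m_bounds(1) pos[of d] by (intro mult_right_mono) auto
    moreover have "5 / 2 * hc_mean lam d \<le> exp 1 * real m * hc_mean lam d"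
      using m_bounds(2) pos[of d] by (intro mult_right_mono) auto
    ultimately show "(\<forall>C\<in>two_components d (I \<inter> side d b). card C \<le> m) \<and>
        1 / (4 * ln (real m)) * hc_mean lam d \<le> ?K \<and> ?K \<le> exp 1 * real m * hc_mean lam d"
      using lo hi g unfolding comps_le_def by (intro conjI) (assumption, linarith+)
  qed
qed (rule lam2)

text \<open>On \<open>uniq\<close> the event is the disjoint union of its versions for the two
  sides. The factor 2 pays for the failure of \<open>uniq\<close> and for the overlap of the
  versions outside it.\<close>

lemma prob_card_two_components:
  "\<bar>hc_prob lam d (\<lambda>I. card (two_components d (Imin d I)) = j)
    - (hc_prob lam d (\<lambda>I. comps_le 1 d True I \<and> singletons d True I = j) + hc_prob lam d (\<lambda>I. comps_le 1 d False I \<and> singletons d False I = j))\<bar>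
    \<le> 2 * hc_prob lam d (\<lambda>I. \<not> uniq 1 d I)" if d: "d > 0"
proof -
  let ?E = "\<lambda>b I. comps_le 1 d b I \<and> singletons d b I = j"
  let ?K = "\<lambda>I. card (two_components d (Imin d I)) = j"
  let ?u = "hc_prob lam d (\<lambda>I. \<not> uniq 1 d I)"
  have uniqD: "?K I \<longleftrightarrow> ?E True I \<or> ?E False I" "\<not> (?E True I \<and> ?E False I)" if u: "uniq 1 d I" for I
  proof -
    obtain b where b: "comps_le 1 d b I" "\<not> comps_le 1 d (\<not> b) I" "Imin d I = I \<inter> side d b"
      using u unfolding uniq_def by blast
    show "?K I \<longleftrightarrow> ?E True I \<or> ?E False I"
      using b comps_le_1_singletons[OF d b(1)] by (cases b) auto
    show "\<not> (?E True I \<and> ?E False I)" using b by (cases b) auto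
  qed
  have "hc_prob lam d ?K \<le> hc_prob lam d (\<lambda>I. (?E True I \<or> ?E False I) \<or> \<not> uniq 1 d I)"
    by (rule hc_prob_mono[OF lam]) (use uniqD in blast)
  also have "\<dots> \<le> hc_prob lam d (\<lambda>I. ?E True I \<or> ?E False I) + ?u" by (rule hc_prob_disj_le)
  also have "\<dots> \<le> (hc_prob lam d (?E True) + hc_prob lam d (?E False)) + ?u"
    by (intro add_right_mono hc_prob_disj_le)
  finally have 1: "hc_prob lam d ?K \<le> (hc_prob lam d (?E True) + hc_prob lam d (?E False)) + ?u" .
  have "hc_prob lam d (\<lambda>I. ?E True I \<or> ?E False I) \<le> hc_prob lam d (\<lambda>I. ?K I \<or> \<not> uniq 1 d I)"
    by (rule hc_prob_mono[OF lam]) (use uniqD in blast)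
  also have "\<dots> \<le> hc_prob lam d ?K + ?u" by (rule hc_prob_disj_le)
  finally have 2: "hc_prob lam d (\<lambda>I. ?E True I \<or> ?E False I) \<le> hc_prob lam d ?K + ?u" .
  have 3: "hc_prob lam d (\<lambda>I. ?E True I \<and> ?E False I) \<le> ?u"
    by (rule hc_prob_mono[OF lam]) (use uniqD in blast)
  show ?thesis using 1 2 3 hc_prob_disj_conj[of lam d "?E True" "?E False"] hc_prob_nonneg[of lam d "\<lambda>I. \<not> uniq 1 d I"]
    by linarith
qed

text \<open>The sum is the expected number of good sides, and exactly one side is good on
  \<open>uniq\<close>.\<close>

lemma hc_prob_good_sides_tendsto_1:
  assumes "(1 + lam) ^ 2 > 2"
  shows "(\<lambda>d. hc_prob lam d (comps_le 1 d True) + hc_prob lam d (comps_le 1 d False)) \<longlonglongrightarrow> 1"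
proof -
  let ?u = "\<lambda>d. hc_prob lam d (\<lambda>I. \<not> uniq 1 d I)"
  have u: "?u \<longlonglongrightarrow> 0" by (rule uniq_tendsto) (use assms in \<open>simp add: numeral_2_eq_2\<close>)
  have "\<bar>hc_prob lam d (comps_le 1 d True) + hc_prob lam d (comps_le 1 d False) - 1\<bar> \<le> 1 * ?u d" for d
  proof -
    have uniqD: "(comps_le 1 d True I \<or> comps_le 1 d False I) \<and> \<not> (comps_le 1 d True I \<and> comps_le 1 d False I)" if "uniq 1 d I" for I
    proof -
      obtain b where "comps_le 1 d b I" "\<not> comps_le 1 d (\<not> b) I" using \<open>uniq 1 d I\<close> unfolding uniq_def by blast
      then show ?thesis by (cases b) auto
    qed
    have "hc_prob lam d (\<lambda>I. comps_le 1 d True I \<and> comps_le 1 d False I) \<le> ?u d"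
      by (rule hc_prob_mono[OF lam]) (use uniqD in blast)
    moreover have "hc_prob lam d (\<lambda>I. \<not> (comps_le 1 d True I \<or> comps_le 1 d False I)) \<le> ?u d"
      by (rule hc_prob_mono[OF lam]) (use uniqD in blast)
    ultimately show ?thesis
      using hc_prob_disj_conj[of lam d "comps_le 1 d True" "comps_le 1 d False"]
        hc_prob_not[of lam d "\<lambda>I. comps_le 1 d True I \<or> comps_le 1 d False I"]
        hc_prob_nonneg[of lam d "\<lambda>I. comps_le 1 d True I \<and> comps_le 1 d False I"]
        hc_prob_le_1[of lam d "\<lambda>I. comps_le 1 d True I \<or> comps_le 1 d False I"]
      by linarith
  qed
  then have "(\<lambda>d. \<bar>hc_prob lam d (comps_le 1 d True) + hc_prob lam d (comps_le 1 d False) - 1\<bar>) \<longlonglongrightarrow> 0"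
    by (intro tendsto_sandwich[OF _ _ tendsto_const u]) simp_all
  then show ?thesis by (rule LIM_zero_cancel[OF tendsto_rabs_zero_cancel])
qed

text \<open>The recursion determines \<open>r j\<close> asymptotically up to the factor
  \<open>r 0\<close>, and the total mass 1 fixes this factor. Adding the two sides makes the total
  mass known, so that neither side has to be understood separately.\<close>

lemma poisson_limit:
  assumes lam1: "lam = 1"
  shows "(\<lambda>d. hc_prob lam d (\<lambda>I. card (two_components d (Imin d I)) = j)) \<longlonglongrightarrow> exp (- 1 / 2) * (1 / 2) ^ j / fact j"
proof -
  define p where "p b j d = hc_prob lam d (\<lambda>I. comps_le 1 d b I \<and> singletons d b I = j)" for b j d
  define r where "r j d = p True j d + p False j d" for j d
  define q where "q j = (1 / 2) ^ j / (fact j :: real)" for j :: nat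
  define G where "G d = hc_prob lam d (comps_le 1 d True) + hc_prob lam d (comps_le 1 d False)" for d
  have hc_mean: "hc_mean lam d = 1 / 2" for d by (simp add: hc_mean_def lam1)
  have sq: "(1 + lam) ^ 2 > 2" by (simp add: lam1)
  have G: "G \<longlonglongrightarrow> 1" unfolding G_def by (rule hc_prob_good_sides_tendsto_1[OF sq])
  have pos: "\<forall>\<^sub>F d::nat in sequentially. d > 0" by (rule eventually_gt_at_top)
  have stein: "(\<lambda>d. real (Suc j) * r (Suc j) d - 1 / 2 * r j d) \<longlonglongrightarrow> 0" for j
  proof (rule tendsto_sandwich[OF _ _ _ tendsto_const])
    have "(\<lambda>d. - lam * (real (Suc d) ^ 2 / (1 + lam) ^ d)) \<longlonglongrightarrow> - lam * 0"
      by (intro tendsto_mult tendsto_const poly_over_exp_tendsto_0) (simp add: lam1)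
    then show "(\<lambda>d. - lam * (real (Suc d) ^ 2 / (1 + lam) ^ d)) \<longlonglongrightarrow> 0" by simp
    have upper: "real (Suc j) * p b (Suc j) d \<le> 1 / 2 * p b j d"
      and lower: "1 / 2 * p b j d - lam / 2 * (real (Suc d) ^ 2 / (1 + lam) ^ d) \<le> real (Suc j) * p b (Suc j) d"
      if "d > 0" for b d
    proof -
      interpret hypercube_hard_core lam d b using that lam by unfold_locales
      show "real (Suc j) * p b (Suc j) d \<le> 1 / 2 * p b j d"
        using hc_prob_singletons_upper[of j] unfolding p_def hc_mean .
      have "w1 * d ^ 2 * hc_mean lam d = lam / 2 * (real d ^ 2 / (1 + lam) ^ d)" by (simp add: w1_def hc_mean)
      also have "\<dots> \<le> lam / 2 * (real (Suc d) ^ 2 / (1 + lam) ^ d)"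
        using lam by (intro mult_left_mono divide_right_mono power_mono) auto
      finally show "1 / 2 * p b j d - lam / 2 * (real (Suc d) ^ 2 / (1 + lam) ^ d) \<le> real (Suc j) * p b (Suc j) d"
        using hc_prob_singletons_lower[of j] unfolding p_def hc_mean by linarith
    qed
    have r: "real (Suc j) * r (Suc j) d - 1 / 2 * r j d
        = (real (Suc j) * p True (Suc j) d - 1 / 2 * p True j d) + (real (Suc j) * p False (Suc j) d - 1 / 2 * p False j d)" for d
      by (simp only: r_def distrib_left)
    show "\<forall>\<^sub>F d in sequentially. - lam * (real (Suc d) ^ 2 / (1 + lam) ^ d) \<le> real (Suc j) * r (Suc j) d - 1 / 2 * r j d"
      using pos
    proof eventually_elim
      case (elim d)
      have add: "- l * y \<le> (a - c) + (b - e)" if "c - l / 2 * y \<le> a" "e - l / 2 * y \<le> b" for a b c e l y :: real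
        using that by (simp add: field_simps)
      show ?case unfolding r by (rule add[OF lower[OF elim] lower[OF elim]])
    qed
    show "\<forall>\<^sub>F d in sequentially. real (Suc j) * r (Suc j) d - 1 / 2 * r j d \<le> 0"
      using pos
    proof eventually_elim
      case (elim d)
      show ?case unfolding r using upper[OF elim, of True] upper[OF elim, of False] by linarith
    qed
  qed
  \<comment> \<open>\<open>q\<close> solves the limiting recursion exactly, with
    \<open>q 0 = 1\<close>, so the errors can be iterated.\<close>
  have ratio: "(\<lambda>d. r j d - q j * r 0 d) \<longlonglongrightarrow> 0" for j
  proof (induction j)
    case (Suc j)
    have eq: "r (Suc j) d - q (Suc j) * r 0 d
        = (real (Suc j) * r (Suc j) d - 1 / 2 * r j d + 1 / 2 * (r j d - q j * r 0 d)) / real (Suc j)" for d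
      by (simp add: q_def field_simps del: of_nat_Suc)
    have "(\<lambda>d. r (Suc j) d - q (Suc j) * r 0 d) \<longlonglongrightarrow> (0 + 1 / 2 * 0) / real (Suc j)"
      unfolding eq by (intro tendsto_add tendsto_mult tendsto_divide tendsto_const stein Suc) simp
    then show ?case by simp
  qed (simp add: q_def)
  have sum_p: "hc_prob lam d (comps_le 1 d b) = (\<Sum>j\<le>J. p b j d) + hc_prob lam d (\<lambda>I. comps_le 1 d b I \<and> J < singletons d b I)" for b d J
  proof (induction J)
    case 0
    show ?case using hc_prob_split[of lam d "comps_le 1 d b" "\<lambda>I. singletons d b I = 0"] by (simp add: p_def)
  next
    case (Suc J)
    have "hc_prob lam d (\<lambda>I. comps_le 1 d b I \<and> J < singletons d b I)
        = hc_prob lam d (\<lambda>I. (comps_le 1 d b I \<and> J < singletons d b I) \<and> singletons d b I = Suc J)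
          + hc_prob lam d (\<lambda>I. (comps_le 1 d b I \<and> J < singletons d b I) \<and> \<not> singletons d b I = Suc J)"
      by (rule hc_prob_split)
    also have "(\<lambda>I. (comps_le 1 d b I \<and> J < singletons d b I) \<and> singletons d b I = Suc J) = (\<lambda>I. comps_le 1 d b I \<and> singletons d b I = Suc J)"
      by auto
    also have "(\<lambda>I. (comps_le 1 d b I \<and> J < singletons d b I) \<and> \<not> singletons d b I = Suc J) = (\<lambda>I. comps_le 1 d b I \<and> Suc J < singletons d b I)"
      by auto
    finally show ?case using Suc by (simp add: p_def)
  qed
  \<comment> \<open>Markov's inequality with mean at most 1/2 on each side. The bound is uniform in
    \<open>d\<close>, which allows \<open>J\<close> to be fixed before \<open>d\<close> tends to
    infinity.\<close>
  have tail: "\<bar>(\<Sum>j\<le>J. r j d) - G d\<bar> \<le> 1 / (real J + 1)" if "d > 0" for J d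
  proof -
    have t: "hc_prob lam d (\<lambda>I. comps_le 1 d b I \<and> J < singletons d b I) \<le> (1 / 2) / (real J + 1)" for b
    proof -
      interpret hypercube_hard_core lam d b using that lam by unfold_locales
      show ?thesis using hc_prob_singletons_tail[of J] by (simp add: hc_mean)
    qed
    have "G d - (\<Sum>j\<le>J. r j d) = hc_prob lam d (\<lambda>I. comps_le 1 d True I \<and> J < singletons d True I)
        + hc_prob lam d (\<lambda>I. comps_le 1 d False I \<and> J < singletons d False I)"
      using sum_p[of d True J] sum_p[of d False J] by (simp add: G_def r_def sum.distrib)
    moreover have "(1 / 2) / (real J + 1) + (1 / 2) / (real J + 1) = 1 / (real J + 1)" by (simp add: field_simps)
    ultimately show ?thesis using t[of True] t[of False]
        hc_prob_nonneg[of lam d "\<lambda>I. comps_le 1 d True I \<and> J < singletons d True I"]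
        hc_prob_nonneg[of lam d "\<lambda>I. comps_le 1 d False I \<and> J < singletons d False I"] by linarith
  qed
  have p01: "0 \<le> p b 0 d" "p b 0 d \<le> 1" for b d by (simp_all add: p_def hc_prob_nonneg hc_prob_le_1)
  have r0: "\<bar>r 0 d\<bar> \<le> 2" for d
    unfolding r_def using p01[of True d] p01[of False d] by linarith
  have "q sums exp (1 / 2)"
  proof -
    have "(\<lambda>j. (1 / 2) ^ j /\<^sub>R fact j) = q"
      by (rule ext) (simp only: q_def real_scaleR_def divide_inverse[of _ "fact _"] mult.commute)
    then show ?thesis using exp_converges[of "1 / 2 :: real"] by simp
  qed
  then have q_lim: "(\<lambda>J. \<Sum>j\<le>J. q j) \<longlonglongrightarrow> exp (1 / 2)" unfolding sums_def_le .
  have "(\<lambda>d. exp (1 / 2) * r 0 d) \<longlonglongrightarrow> 1"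
  proof (rule LIMSEQ_I)
    fix \<epsilon> :: real assume \<epsilon>: "\<epsilon> > 0"
    have "(\<lambda>J. 2 * \<bar>exp (1 / 2) - (\<Sum>j\<le>J. q j)\<bar> + 1 / (real J + 1)) \<longlonglongrightarrow> 2 * \<bar>exp (1 / 2) - exp (1 / 2)\<bar> + 0"
      by (intro tendsto_add tendsto_mult tendsto_const tendsto_rabs tendsto_diff q_lim) real_asymp
    then have "\<forall>\<^sub>F J in sequentially. 2 * \<bar>exp (1 / 2) - (\<Sum>j\<le>J. q j)\<bar> + 1 / (real J + 1) < \<epsilon> / 2"
      using \<epsilon> by (intro order_tendstoD(2)) auto
    then obtain J where J: "2 * \<bar>exp (1 / 2) - (\<Sum>j\<le>J. q j)\<bar> + 1 / (real J + 1) < \<epsilon> / 2"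
      using eventually_sequentially by auto
    have "(\<lambda>d. \<Sum>j\<le>J. r j d - q j * r 0 d) \<longlonglongrightarrow> (\<Sum>j\<le>J. 0)" by (intro tendsto_sum ratio)
    then have "(\<lambda>d. \<bar>\<Sum>j\<le>J. r j d - q j * r 0 d\<bar>) \<longlonglongrightarrow> 0" by (simp add: tendsto_rabs_zero)
    then have e1: "\<forall>\<^sub>F d in sequentially. \<bar>\<Sum>j\<le>J. r j d - q j * r 0 d\<bar> < \<epsilon> / 4"
      using \<epsilon> by (intro order_tendstoD(2)) auto
    have "(\<lambda>d. \<bar>G d - 1\<bar>) \<longlonglongrightarrow> \<bar>1 - 1\<bar>" by (intro tendsto_intros G)
    then have e2: "\<forall>\<^sub>F d in sequentially. \<bar>G d - 1\<bar> < \<epsilon> / 4"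
      using \<epsilon> by (intro order_tendstoD(2)) auto
    have "\<forall>\<^sub>F d in sequentially. norm (exp (1 / 2) * r 0 d - 1) < \<epsilon>"
      using e1 e2 pos
    proof eventually_elim
      case (elim d)
      define S where "S = (\<Sum>j\<le>J. q j)"
      have "(\<Sum>j\<le>J. r j d - q j * r 0 d) = (\<Sum>j\<le>J. r j d) - S * r 0 d"
        by (simp add: S_def sum_subtractf sum_distrib_right)
      then have "\<bar>(\<Sum>j\<le>J. r j d) - S * r 0 d\<bar> < \<epsilon> / 4" using elim(1) by simp
      moreover have "\<bar>(exp (1 / 2) - S) * r 0 d\<bar> \<le> \<bar>exp (1 / 2) - S\<bar> * 2"
        unfolding abs_mult by (intro mult_left_mono r0) simp
      \<comment> \<open>The choice of \<open>J\<close> bounds the first and the third term together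
        by \<open>\<epsilon> / 2\<close>; for large \<open>d\<close> the other two are below
        \<open>\<epsilon> / 4\<close> each.\<close>
      moreover have "exp (1 / 2) * r 0 d - 1
          = (exp (1 / 2) - S) * r 0 d - ((\<Sum>j\<le>J. r j d) - S * r 0 d) + ((\<Sum>j\<le>J. r j d) - G d) + (G d - 1)"
        by (simp add: algebra_simps)
      ultimately show ?case
        using tail[OF elim(3), of J] elim(2) J unfolding S_def[symmetric] real_norm_def by linarith
    qed
    then show "\<exists>N. \<forall>d\<ge>N. norm (exp (1 / 2) * r 0 d - 1) < \<epsilon>" by (simp add: eventually_sequentially)
  qed
  then have "(\<lambda>d. exp (- 1 / 2) * (exp (1 / 2) * r 0 d)) \<longlonglongrightarrow> exp (- 1 / 2) * 1"
    by (intro tendsto_mult tendsto_const)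
  moreover have eq: "exp (- 1 / 2) * (exp (1 / 2) * r 0 d) = r 0 d" for d
  proof -
    have "exp (- 1 / 2) * exp (1 / 2) = (1 :: real)" by (simp flip: exp_add)
    then show ?thesis by (simp only: mult.assoc[symmetric] mult_1_left)
  qed
  ultimately have "(\<lambda>d. r 0 d) \<longlonglongrightarrow> exp (- 1 / 2) * 1" by (simp only: eq)
  then have r0_lim: "r 0 \<longlonglongrightarrow> exp (- 1 / 2)" by simp
  have "(\<lambda>d. (r j d - q j * r 0 d) + q j * r 0 d) \<longlonglongrightarrow> 0 + q j * exp (- 1 / 2)"
    by (intro tendsto_add tendsto_mult tendsto_const ratio r0_lim)
  then have r_lim: "r j \<longlonglongrightarrow> exp (- 1 / 2) * (1 / 2) ^ j / fact j" by (simp add: q_def mult.commute)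
  have u: "(\<lambda>d. hc_prob lam d (\<lambda>I. \<not> uniq 1 d I)) \<longlonglongrightarrow> 0"
    by (rule uniq_tendsto) (simp add: lam1)
  have "(\<lambda>d. hc_prob lam d (\<lambda>I. card (two_components d (Imin d I)) = j) - r j d) \<longlonglongrightarrow> 0"
  proof (rule tendsto_rabs_zero_cancel, rule tendsto_sandwich[OF _ _ tendsto_const])
    show "(\<lambda>d. 2 * hc_prob lam d (\<lambda>I. \<not> uniq 1 d I)) \<longlonglongrightarrow> 0" using tendsto_mult_left[OF u, of 2] by simp
    show "\<forall>\<^sub>F d in sequentially. \<bar>hc_prob lam d (\<lambda>I. card (two_components d (Imin d I)) = j) - r j d\<bar>
        \<le> 2 * hc_prob lam d (\<lambda>I. \<not> uniq 1 d I)"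
      using pos by eventually_elim (use prob_card_two_components in \<open>simp add: r_def p_def\<close>)
  qed simp
  from tendsto_add[OF this r_lim] show ?thesis by simp
qed

end

theorem theorem1p4:
  fixes lam :: real
    and Imin :: "nat \<Rightarrow> bool list set \<Rightarrow> bool list set"
  assumes "lam > 0"
    and "\<And>d I. I \<in> independent_sets (hypercube d) \<Longrightarrow> is_smaller_part d I (Imin d I)"
  shows
    "(lam > 1 \<longrightarrow> aas (\<lambda>d. hard_core (hypercube d) lam) (\<lambda>d I. Imin d I = {})) \<and>
     (lam = 1 \<longrightarrow>
        aas (\<lambda>d. hard_core (hypercube d) lam)
          (\<lambda>d I. \<forall>C\<in>two_components d (Imin d I). card C = 1) \<and>
        (\<forall>j::nat. (\<lambda>d. measure_pmf.prob (hard_core (hypercube d) lam)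
              {I. card (two_components d (Imin d I)) = j})
            \<longlonglongrightarrow> exp (- 1/2) * (1/2) ^ j / fact j)) \<and>
     (1 > lam \<and> lam > sqrt 2 - 1 \<longrightarrow> (\<forall>\<epsilon>::real. \<epsilon> > 0 \<longrightarrow>
        aas (\<lambda>d. hard_core (hypercube d) lam)
          (\<lambda>d I. (\<forall>C\<in>two_components d (Imin d I). card C = 1) \<and>
             \<bar>real (card (two_components d (Imin d I))) - lam/2 * (2 / (1 + lam)) ^ d\<bar>
               \<le> sqrt ((2 + \<epsilon>) * (lam/2 * (2 / (1 + lam)) ^ d)
                         * ln (lam/2 * (2 / (1 + lam)) ^ d))))) \<and>
     (\<forall>m::nat. m \<ge> 2 \<and> 2 powr (1 / real m) - 1 \<ge> lam \<and> lam > 2 powr (1 / real (m + 1)) - 1 \<longrightarrow>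
        aas (\<lambda>d. hard_core (hypercube d) lam)
          (\<lambda>d I. (\<forall>C\<in>two_components d (Imin d I). card C \<le> m) \<and>
             1 / (4 * ln (real m)) * (lam/2 * (2 / (1 + lam)) ^ d)
               \<le> real (card (two_components d (Imin d I))) \<and>
             real (card (two_components d (Imin d I)))
               \<le> exp 1 * real m * (lam/2 * (2 / (1 + lam)) ^ d)))"
proof -
  interpret smaller_part_choice lam Imin by unfold_locales (use assms in auto)
  have 2: "(1 + lam) ^ 2 > 2" if "lam > sqrt 2 - 1"
  proof -
    have "sqrt 2 ^ 2 < (1 + lam) ^ 2" using that by (intro power_strict_mono) auto
    then show ?thesis by simp
  qed
  have 3: "lam < 1" if "m \<ge> 2" "2 powr (1 / real m) - 1 \<ge> lam" for m
  proof -
    have "2 powr (1 / real m) < 2 powr (1 :: real)" using that(1) by (intro powr_less_mono) auto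
    then show ?thesis using that(2) by simp
  qed
  have 4: "(1 + lam) ^ Suc m > 2" if "lam > 2 powr (1 / real (m + 1)) - 1" for m
  proof -
    have "(2 powr (1 / real (m + 1))) ^ Suc m < (1 + lam) ^ Suc m"
      using that by (intro power_strict_mono) auto
    moreover have "(2 powr (1 / real (m + 1))) ^ Suc m = (2 powr (1 / real (m + 1)) :: real) powr real (Suc m)"
      by (rule powr_realpow[symmetric]) simp
    moreover have "\<dots> = 2 powr (1 / real (m + 1) * real (Suc m))" by (rule powr_powr)
    ultimately show ?thesis by simp
  qed
  have all_singletons: "aas (\<lambda>d. hard_core (hypercube d) lam) (\<lambda>d I. \<forall>C\<in>two_components d (Imin d I). card C = 1)"
    if "lam = 1"
    by (rule aas_all_singletons) (simp add: that)
  note concentration = aas_concentration[OF _ 2, unfolded hc_mean_def]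
  note bounded = aas_bounded_components[OF _ 3 4, unfolded hc_mean_def]
  show ?thesis
    by (intro conjI impI allI)
      (erule aas_empty, erule all_singletons, erule poisson_limit[unfolded hc_prob_def],
        elim conjE, (rule concentration; assumption), elim conjE, (rule bounded; assumption))
qed

end
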